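(* The operad $\operatorname{Perm}$ has a unique structure of anticyclic operad such that the quotient map $\operatorname{Dias}\to\operatorname{Perm}$ is a morphism of anticyclic operads.
   Context: All vector spaces are over $\mathbb{Q}$. The symmetric group $\mathfrak{S}_n$ acts on $\mathcal{P}(n)$ by $(\sigma\cdot E)(x_1,\dots,x_n)=E(x_{\sigma(1)},\dots,x_{\sigma(n)})$. An anticyclic operad is a symmetric operad $\mathcal{P}$ (unit $1\in\mathcal{P}(1)$, partial compositions $\circ_i$) together with an action of $\mathfrak{S}_{n+1}$ on each $\mathcal{P}(n)$ extending the action of $\mathfrak{S}_n$ (the stabilizer of $n+1$), such that, writing $\tau_n$ for the action of the long cycle $(n+1,n,\dots,2,1)$ ($1\mapsto n+1$, $i\mapsto i-1$ for $i\ge 2$): $\tau_1(1)=-1$ and, for $f\in\mathcal{P}(m)$, $g\in\mathcal{P}(n)$, $\tau(f\circ_i g)=\tau_m(f)\circ_{i-1}g$ for $2\le i\le m$ and $\tau(f\circ_1 g)=-\tau_n(g)\circ_n\tau_m(f)$. A morphism of anticyclic operads is a morphism of operads commuting with the actions of $\mathfrak{S}_{n+1}$. A non-symmetric anticyclic operad is a non-symmetric operad with endomorphisms $\tau_n$ of $\mathcal{P}(n)$ satisfying $\tau_n^{n+1}=\mathrm{Id}$ and these same identities. If $\mathcal{P}$ is a non-symmetric anticyclic operad, the symmetric operad with components $\mathcal{P}(n)\otimes\mathbb{Q}\mathfrak{S}_n\cong\operatorname{Ind}_{\mathbb{Z}/(n+1)\mathbb{Z}}^{\mathfrak{S}_{n+1}}\mathcal{P}(n)$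 is naturally an anticyclic operad, with $\tau_n(E\otimes 1)=\tau_n(E)\otimes 1$. The non-symmetric operad $\operatorname{Dias}$ is generated by binary operations $x\dashv y$, $x\vdash y$ with relations $x\dashv(y\vdash z)=x\dashv(y\dashv z)=(x\dashv y)\dashv z$, $x\vdash(y\dashv z)=(x\vdash y)\dashv z$, $x\vdash(y\vdash z)=(x\vdash y)\vdash z=(x\dashv y)\vdash z$. It is a non-symmetric anticyclic operad with the unique structure such that $\tau_1=-\mathrm{Id}$, $\tau_2(x_1\dashv x_2)=-x_1\vdash x_2$, $\tau_2(x_1\vdash x_2)=x_1\dashv x_2-x_1\vdash x_2$. In the claim, $\operatorname{Dias}$ denotes the associated (symmetric) anticyclic operad. $\operatorname{Perm}$ is the quotient of the symmetric operad $\operatorname{Dias}$ by the ideal generated by $x_1\dashv x_2-x_2\vdash x_1$; denoting by $x_1x_2$ the image of $x_1\dashv x_2$, it is generated by the binary product $xy$ with relations $(xy)z=x(yz)=x(zy)$. *)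

theory Defs
  imports
    "HOL-Algebra.Algebraic_Closure_Type"
    "HOL-Combinatorics.Permutations"
    "HOL-Library.FuncSet"
    "HOL-Library.Poly_Mapping"
    "HOL-Library.Tree"
begin

section \<open>Linear algebra over the rationals\<close>

abbreviation rat_field :: "rat ring"
  where "rat_field \<equiv> ring_of_type_algebra"

definition linear_on :: "(rat, 'a, 'm) module_scheme \<Rightarrow> (rat, 'b, 'n) module_scheme \<Rightarrow> ('a \<Rightarrow> 'b) \<Rightarrow> bool"
  where "linear_on V W f \<longleftrightarrow>
    f \<in> carrier V \<rightarrow> carrier W \<and>
    (\<forall>x\<in>carrier V. \<forall>y\<in>carrier V. f (x \<oplus>\<^bsub>V\<^esub> y) = f x \<oplus>\<^bsub>W\<^esub> f y) \<and>
    (\<forall>c. \<forall>x\<in>carrier V. f (c \<odot>\<^bsub>V\<^esub> x) = c \<odot>\<^bsub>W\<^esub> f x)"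

text \<open>A module record also has multiplicative components, which the locale
  \<^locale>\<open>module\<close> ignores; they are left undefined in all constructions below.\<close>

definition quot_module :: "(rat, 'a, 'm) module_scheme \<Rightarrow> 'a set \<Rightarrow> (rat, 'a set) module"
  where "quot_module V H =
    \<lparr> carrier = a_rcosets\<^bsub>V\<^esub> H, monoid.mult = undefined, one = undefined, zero = H,
      add = (\<lambda>U W. \<Union>x\<in>U. \<Union>y\<in>W. H +>\<^bsub>V\<^esub> (x \<oplus>\<^bsub>V\<^esub> y)),
      module.smult = (\<lambda>c U. \<Union>x\<in>U. H +>\<^bsub>V\<^esub> (c \<odot>\<^bsub>V\<^esub> x)) \<rparr>"

section \<open>Operads\<close>

text \<open>In HOL-Algebra the token \<open>inv\<close> is reserved for inverses in a group structure.\<close>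

abbreviation perm_inv :: "(nat \<Rightarrow> nat) \<Rightarrow> nat \<Rightarrow> nat"
  where "perm_inv \<equiv> inv_into UNIV"

text \<open>Operads have components in arities \<open>n \<ge> 1\<close> only; the component with index 0 is never
  looked at. The term \<open>pcomp P m n i f g\<close> stands for \<open>f \<circ>\<^sub>i g\<close>, with \<open>f\<close> of arity \<open>m\<close> and
  \<open>g\<close> of arity \<open>n\<close>; the arities are arguments because components may overlap as sets.\<close>

record 'a ns_operad =
  comps :: "nat \<Rightarrow> (rat, 'a) module"
  unit :: 'a
  pcomp :: "nat \<Rightarrow> nat \<Rightarrow> nat \<Rightarrow> 'a \<Rightarrow> 'a \<Rightarrow> 'a"

record 'a sym_operad = "'a ns_operad" +
  sact :: "nat \<Rightarrow> (nat \<Rightarrow> nat) \<Rightarrow> 'a \<Rightarrow> 'a"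

abbreviation elems :: "('a, 'm) ns_operad_scheme \<Rightarrow> nat \<Rightarrow> 'a set"
  where "elems P n \<equiv> carrier (comps P n)"

locale ns_operad =
  fixes P :: "('a, 'm) ns_operad_scheme"
  assumes vector_space: "1 \<le> n \<Longrightarrow> module rat_field (comps P n)"
    and unit_closed: "unit P \<in> elems P 1"
    and pcomp_linear_left:
      "\<lbrakk>1 \<le> i; i \<le> m; 1 \<le> n; g \<in> elems P n\<rbrakk> \<Longrightarrow>
        linear_on (comps P m) (comps P (m + n - 1)) (\<lambda>f. pcomp P m n i f g)"
    and pcomp_linear_right:
      "\<lbrakk>1 \<le> i; i \<le> m; 1 \<le> n; f \<in> elems P m\<rbrakk> \<Longrightarrow>
        linear_on (comps P n) (comps P (m + n - 1)) (\<lambda>g. pcomp P m n i f g)"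
    and unit_left: "\<lbrakk>1 \<le> n; f \<in> elems P n\<rbrakk> \<Longrightarrow> pcomp P 1 n 1 (unit P) f = f"
    and unit_right: "\<lbrakk>1 \<le> i; i \<le> n; f \<in> elems P n\<rbrakk> \<Longrightarrow> pcomp P n 1 i f (unit P) = f"
    and assoc_sequential:
      "\<lbrakk>1 \<le> i; i \<le> l; 1 \<le> j; j \<le> m; 1 \<le> n; f \<in> elems P l; g \<in> elems P m; h \<in> elems P n\<rbrakk> \<Longrightarrow>
        pcomp P (l + m - 1) n (i + j - 1) (pcomp P l m i f g) h =
        pcomp P l (m + n - 1) i f (pcomp P m n j g h)"
    and assoc_parallel:
      "\<lbrakk>1 \<le> i; i < k; k \<le> l; 1 \<le> m; 1 \<le> n; f \<in> elems P l; g \<in> elems P m; h \<in> elems P n\<rbrakk> \<Longrightarrow>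
        pcomp P (l + m - 1) n (k + m - 1) (pcomp P l m i f g) h =
        pcomp P (l + n - 1) m i (pcomp P l n k f h) g"

text \<open>With \<open>(\<sigma> \<cdot> E)(x\<^sub>1, \<dots>, x\<^sub>n) = E(x\<^bsub>\<sigma>(1)\<^esub>, \<dots>, x\<^bsub>\<sigma>(n)\<^esub>)\<close> (a left action), substituting
  \<open>\<pi> \<cdot> F\<close> for \<open>x\<^sub>i\<close> in \<open>\<sigma> \<cdot> E\<close> amounts to substituting \<open>F\<close> at position \<open>j = \<sigma>\<inverse>(i)\<close> of \<open>E\<close>
  and listing the variables in the following order.\<close>

definition perm_pcomp :: "nat \<Rightarrow> nat \<Rightarrow> nat \<Rightarrow> (nat \<Rightarrow> nat) \<Rightarrow> (nat \<Rightarrow> nat) \<Rightarrow> nat \<Rightarrow> nat"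
  where "perm_pcomp m n i \<sigma> \<pi> p =
    (let j = perm_inv \<sigma> i; relabel = (\<lambda>a. if a < i then a else a + n - 1) in
     if p < 1 \<or> m + n - 1 < p then p
     else if p < j then relabel (\<sigma> p)
     else if p < j + n then i - 1 + \<pi> (p - j + 1)
     else relabel (\<sigma> (p - n + 1)))"

locale sym_operad = ns_operad P
  for P :: "('a, 'm) sym_operad_scheme" +
  assumes sact_linear:
      "\<lbrakk>1 \<le> n; \<sigma> permutes {1..n}\<rbrakk> \<Longrightarrow> linear_on (comps P n) (comps P n) (sact P n \<sigma>)"
    and sact_id: "\<lbrakk>1 \<le> n; f \<in> elems P n\<rbrakk> \<Longrightarrow> sact P n id f = f"
    and sact_comp:
      "\<lbrakk>1 \<le> n; \<sigma> permutes {1..n}; \<pi> permutes {1..n}; f \<in> elems P n\<rbrakk> \<Longrightarrow>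
        sact P n (\<sigma> \<circ> \<pi>) f = sact P n \<sigma> (sact P n \<pi> f)"
    and equivariant:
      "\<lbrakk>1 \<le> i; i \<le> m; 1 \<le> n; \<sigma> permutes {1..m}; \<pi> permutes {1..n};
        f \<in> elems P m; g \<in> elems P n\<rbrakk> \<Longrightarrow>
        pcomp P m n i (sact P m \<sigma> f) (sact P n \<pi> g) =
        sact P (m + n - 1) (perm_pcomp m n i \<sigma> \<pi>) (pcomp P m n (perm_inv \<sigma> i) f g)"

locale sym_operad_hom = P: sym_operad P + Q: sym_operad Q
  for P :: "('a, 'm) sym_operad_scheme" and Q :: "('b, 'n) sym_operad_scheme"
    and \<phi> :: "nat \<Rightarrow> 'a \<Rightarrow> 'b" +
  assumes hom_linear: "1 \<le> n \<Longrightarrow> linear_on (comps P n) (comps Q n) (\<phi> n)"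
    and hom_unit: "\<phi> 1 (unit P) = unit Q"
    and hom_pcomp:
      "\<lbrakk>1 \<le> i; i \<le> m; 1 \<le> n; f \<in> elems P m; g \<in> elems P n\<rbrakk> \<Longrightarrow>
        \<phi> (m + n - 1) (pcomp P m n i f g) = pcomp Q m n i (\<phi> m f) (\<phi> n g)"
    and hom_sact:
      "\<lbrakk>1 \<le> n; \<sigma> permutes {1..n}; f \<in> elems P n\<rbrakk> \<Longrightarrow>
        \<phi> n (sact P n \<sigma> f) = sact Q n \<sigma> (\<phi> n f)"

section \<open>Anticyclic operads\<close>

definition long_cycle :: "nat \<Rightarrow> nat \<Rightarrow> nat"
  where "long_cycle n i =
    (if i = 1 then n + 1 else if 2 \<le> i \<and> i \<le> n + 1 then i - 1 else i)"

definition anticyclic_identities ::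
    "('a, 'm) ns_operad_scheme \<Rightarrow> (nat \<Rightarrow> 'a \<Rightarrow> 'a) \<Rightarrow> bool"
  where "anticyclic_identities P \<tau> \<longleftrightarrow>
    \<tau> 1 (unit P) = \<ominus>\<^bsub>comps P 1\<^esub> unit P \<and>
    (\<forall>m\<ge>1. \<forall>n\<ge>1. \<forall>f\<in>elems P m. \<forall>g\<in>elems P n.
      (\<forall>i. 2 \<le> i \<and> i \<le> m \<longrightarrow>
        \<tau> (m + n - 1) (pcomp P m n i f g) = pcomp P m n (i - 1) (\<tau> m f) g) \<and>
      \<tau> (m + n - 1) (pcomp P m n 1 f g) =
        \<ominus>\<^bsub>comps P (m + n - 1)\<^esub> pcomp P n m n (\<tau> n g) (\<tau> m f))"

text \<open>The structure maps are required to be \<^const>\<open>undefined\<close> outside their domains, so that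
  equality of structures is equality of functions.\<close>

locale ns_anticyclic_operad = ns_operad P
  for P :: "('a, 'm) ns_operad_scheme" and \<tau> :: "nat \<Rightarrow> 'a \<Rightarrow> 'a" +
  assumes tau_typed: "\<tau> \<in> (\<Pi>\<^sub>E n\<in>{1..}. elems P n \<rightarrow>\<^sub>E elems P n)"
    and tau_linear: "1 \<le> n \<Longrightarrow> linear_on (comps P n) (comps P n) (\<tau> n)"
    and tau_power: "\<lbrakk>1 \<le> n; f \<in> elems P n\<rbrakk> \<Longrightarrow> (\<tau> n ^^ (n + 1)) f = f"
    and tau_identities: "anticyclic_identities P \<tau>"

locale anticyclic_operad = sym_operad P
  for P :: "('a, 'm) sym_operad_scheme" and A :: "nat \<Rightarrow> (nat \<Rightarrow> nat) \<Rightarrow> 'a \<Rightarrow> 'a" +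
  assumes cact_typed:
      "A \<in> (\<Pi>\<^sub>E n\<in>{1..}. \<Pi>\<^sub>E \<sigma>\<in>{\<sigma>. \<sigma> permutes {1..n + 1}}. elems P n \<rightarrow>\<^sub>E elems P n)"
    and cact_linear:
      "\<lbrakk>1 \<le> n; \<sigma> permutes {1..n + 1}\<rbrakk> \<Longrightarrow> linear_on (comps P n) (comps P n) (A n \<sigma>)"
    and cact_comp:
      "\<lbrakk>1 \<le> n; \<sigma> permutes {1..n + 1}; \<pi> permutes {1..n + 1}; f \<in> elems P n\<rbrakk> \<Longrightarrow>
        A n (\<sigma> \<circ> \<pi>) f = A n \<sigma> (A n \<pi> f)"
    and cact_extends:
      "\<lbrakk>1 \<le> n; \<sigma> permutes {1..n}; f \<in> elems P n\<rbrakk> \<Longrightarrow> A n \<sigma> f = sact P n \<sigma> f"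
    and cact_identities: "anticyclic_identities P (\<lambda>n. A n (long_cycle n))"

locale anticyclic_operad_hom =
  P: anticyclic_operad P A + Q: anticyclic_operad Q B + sym_operad_hom P Q \<phi>
  for P :: "('a, 'm) sym_operad_scheme" and A :: "nat \<Rightarrow> (nat \<Rightarrow> nat) \<Rightarrow> 'a \<Rightarrow> 'a"
    and Q :: "('b, 'n) sym_operad_scheme" and B :: "nat \<Rightarrow> (nat \<Rightarrow> nat) \<Rightarrow> 'b \<Rightarrow> 'b"
    and \<phi> :: "nat \<Rightarrow> 'a \<Rightarrow> 'b" +
  assumes hom_cact:
    "\<lbrakk>1 \<le> n; \<sigma> permutes {1..n + 1}; f \<in> elems P n\<rbrakk> \<Longrightarrow> \<phi> n (A n \<sigma> f) = B n \<sigma> (\<phi> n f)"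

section \<open>Ideals and quotients\<close>

definition ns_ideal :: "('a, 'm) ns_operad_scheme \<Rightarrow> (nat \<Rightarrow> 'a set) \<Rightarrow> bool"
  where "ns_ideal P I \<longleftrightarrow>
    (\<forall>n\<ge>1. submodule (I n) rat_field (comps P n)) \<and>
    (\<forall>m n i. \<forall>f\<in>elems P m. \<forall>g\<in>elems P n.
      1 \<le> i \<and> i \<le> m \<and> 1 \<le> n \<and> (f \<in> I m \<or> g \<in> I n) \<longrightarrow> pcomp P m n i f g \<in> I (m + n - 1))"

definition sym_ideal :: "('a, 'm) sym_operad_scheme \<Rightarrow> (nat \<Rightarrow> 'a set) \<Rightarrow> bool"
  where "sym_ideal P I \<longleftrightarrow>
    ns_ideal P I \<and> (\<forall>n\<ge>1. \<forall>\<sigma>. \<sigma> permutes {1..n} \<longrightarrow> (\<forall>f\<in>I n. sact P n \<sigma> f \<in> I n))"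

definition gen_ns_ideal :: "('a, 'm) ns_operad_scheme \<Rightarrow> (nat \<Rightarrow> 'a set) \<Rightarrow> nat \<Rightarrow> 'a set"
  where "gen_ns_ideal P S n = \<Inter>{I n | I. ns_ideal P I \<and> (\<forall>k. S k \<subseteq> I k)}"

definition gen_sym_ideal :: "('a, 'm) sym_operad_scheme \<Rightarrow> (nat \<Rightarrow> 'a set) \<Rightarrow> nat \<Rightarrow> 'a set"
  where "gen_sym_ideal P S n = \<Inter>{I n | I. sym_ideal P I \<and> (\<forall>k. S k \<subseteq> I k)}"

definition quot_map :: "('a, 'm) ns_operad_scheme \<Rightarrow> (nat \<Rightarrow> 'a set) \<Rightarrow> nat \<Rightarrow> 'a \<Rightarrow> 'a set"
  where "quot_map P I n f = I n +>\<^bsub>comps P n\<^esub> f"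

definition quot_ns_operad :: "('a, 'm) ns_operad_scheme \<Rightarrow> (nat \<Rightarrow> 'a set) \<Rightarrow> 'a set ns_operad"
  where "quot_ns_operad P I =
    \<lparr> comps = (\<lambda>n. quot_module (comps P n) (I n)),
      unit = quot_map P I 1 (unit P),
      pcomp = (\<lambda>m n i U W. \<Union>f\<in>U. \<Union>g\<in>W. quot_map P I (m + n - 1) (pcomp P m n i f g)) \<rparr>"

definition quot_sym_operad :: "('a, 'm) sym_operad_scheme \<Rightarrow> (nat \<Rightarrow> 'a set) \<Rightarrow> 'a set sym_operad"
  where "quot_sym_operad P I =
    ns_operad.extend (quot_ns_operad P I)
      \<lparr> sact = (\<lambda>n \<sigma> U. \<Union>f\<in>U. quot_map P I n (sact P n \<sigma> f)) \<rparr>"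

section \<open>The symmetric operad of a non-symmetric operad\<close>

text \<open>An element of \<open>P(n) \<otimes> \<rat>\<SS>\<^sub>n\<close> is given by its coefficients: the family \<open>u\<close> stands for
  \<open>\<Sum>\<rho>. u \<rho> \<otimes> \<rho>\<close>, where \<open>E \<otimes> \<rho>\<close> is the operation \<open>E(x\<^bsub>\<rho>(1)\<^esub>, \<dots>, x\<^bsub>\<rho>(n)\<^esub>)\<close>.\<close>

definition perms :: "nat \<Rightarrow> (nat \<Rightarrow> nat) set"
  where "perms n = {\<sigma>. \<sigma> permutes {1..n}}"

definition pure_tensor ::
    "('a, 'm) ns_operad_scheme \<Rightarrow> nat \<Rightarrow> 'a \<Rightarrow> (nat \<Rightarrow> nat) \<Rightarrow> ((nat \<Rightarrow> nat) \<Rightarrow> 'a)"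
  where "pure_tensor P n E \<sigma> = (\<lambda>\<rho>\<in>perms n. if \<rho> = \<sigma> then E else \<zero>\<^bsub>comps P n\<^esub>)"

definition symmetrization ::
    "('a, 'm) ns_operad_scheme \<Rightarrow> ((nat \<Rightarrow> nat) \<Rightarrow> 'a) sym_operad"
  where "symmetrization P =
    \<lparr> comps = (\<lambda>n.
        \<lparr> carrier = perms n \<rightarrow>\<^sub>E elems P n, monoid.mult = undefined, one = undefined,
          zero = (\<lambda>\<rho>\<in>perms n. \<zero>\<^bsub>comps P n\<^esub>),
          add = (\<lambda>u v. \<lambda>\<rho>\<in>perms n. u \<rho> \<oplus>\<^bsub>comps P n\<^esub> v \<rho>),
          module.smult = (\<lambda>c u. \<lambda>\<rho>\<in>perms n. c \<odot>\<^bsub>comps P n\<^esub> u \<rho>) \<rparr>),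
      unit = pure_tensor P 1 (unit P) id,
      pcomp = (\<lambda>m n i u v. \<lambda>\<rho>\<in>perms (m + n - 1).
        finsum (comps P (m + n - 1))
          (\<lambda>(\<sigma>, \<pi>). pcomp P m n (perm_inv \<sigma> i) (u \<sigma>) (v \<pi>))
          {(\<sigma>, \<pi>) \<in> perms m \<times> perms n. perm_pcomp m n i \<sigma> \<pi> = \<rho>}),
      sact = (\<lambda>n \<sigma> u. \<lambda>\<rho>\<in>perms n. u (perm_inv \<sigma> \<circ> \<rho>)) \<rparr>"

text \<open>The induced action of \<open>\<SS>\<^bsub>n+1\<^esub>\<close> on \<open>P(n) \<otimes> \<rat>\<SS>\<^sub>n\<close>: writing \<open>c\<close> for the long cycle, every
  permutation of \<open>{1..n+1}\<close> is uniquely of the form \<open>\<rho> c\<^sup>k\<close> with \<open>\<rho>\<close> fixing \<open>n + 1\<close> and \<open>0 \<le> k \<le> n\<close>,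
  and for \<open>\<sigma> \<pi> = \<rho> c\<^sup>k\<close> one has \<open>\<sigma> \<cdot> (E \<otimes> \<pi>) = \<tau>\<^sup>k(E) \<otimes> \<rho>\<close>. For given \<open>\<sigma>\<close> and \<open>\<rho>\<close> the permutation
  \<open>\<pi> = \<sigma>\<inverse> \<rho> c\<^sup>k\<close> fixes \<open>n + 1\<close> exactly when \<open>k = n + 1 - \<rho>\<inverse>(\<sigma>(n + 1))\<close>.\<close>

definition induced_action ::
    "('a, 'm) ns_operad_scheme \<Rightarrow> (nat \<Rightarrow> 'a \<Rightarrow> 'a) \<Rightarrow>
      nat \<Rightarrow> (nat \<Rightarrow> nat) \<Rightarrow> ((nat \<Rightarrow> nat) \<Rightarrow> 'a) \<Rightarrow> ((nat \<Rightarrow> nat) \<Rightarrow> 'a)"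
  where "induced_action P \<tau> =
    (\<lambda>n\<in>{1..}. \<lambda>\<sigma>\<in>perms (n + 1). \<lambda>u\<in>elems (symmetrization P) n. \<lambda>\<rho>\<in>perms n.
      let k = n + 1 - perm_inv \<rho> (\<sigma> (n + 1))
      in (\<tau> n ^^ k) (u (perm_inv \<sigma> \<circ> \<rho> \<circ> (long_cycle n ^^ k))))"

section \<open>The operads Dias and Perm\<close>

text \<open>The free non-symmetric operad on a set of binary operations: a planar binary tree with
  nodes labelled by operations and with \<open>n\<close> leaves is an operation of arity \<open>n\<close>.\<close>

primrec graft :: "'g tree \<Rightarrow> nat \<Rightarrow> 'g tree \<Rightarrow> 'g tree"
  where
    "graft Leaf i t = t"
  | "graft (Node l a r) i t =
      (if i \<le> size1 l then Node (graft l i t) a r else Node l a (graft r (i - size1 l) t))"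

definition free_ns_operad :: "('g tree \<Rightarrow>\<^sub>0 rat) ns_operad"
  where "free_ns_operad =
    \<lparr> comps = (\<lambda>n.
        \<lparr> carrier = {f. \<forall>t\<in>Poly_Mapping.keys f. size1 t = n}, monoid.mult = undefined, one = undefined,
          zero = 0, add = (+), module.smult = (\<lambda>c. Poly_Mapping.map ((*) c)) \<rparr>),
      unit = Poly_Mapping.single Leaf 1,
      pcomp = (\<lambda>m n i f g. \<Sum>s\<in>Poly_Mapping.keys f. \<Sum>t\<in>Poly_Mapping.keys g.
        Poly_Mapping.single (graft s i t) (Poly_Mapping.lookup f s * Poly_Mapping.lookup g t)) \<rparr>"

datatype dias_op = Dashv | Vdash

abbreviation dashv :: "dias_op tree \<Rightarrow> dias_op tree \<Rightarrow> dias_op tree"  (infix \<open>\<stileturn>\<close> 70)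
  where "x \<stileturn> y \<equiv> Node x Dashv y"

abbreviation vdash :: "dias_op tree \<Rightarrow> dias_op tree \<Rightarrow> dias_op tree"  (infix \<open>\<turnstile>\<close> 70)
  where "x \<turnstile> y \<equiv> Node x Vdash y"

abbreviation tree_op :: "dias_op tree \<Rightarrow> dias_op tree \<Rightarrow>\<^sub>0 rat"
  where "tree_op t \<equiv> Poly_Mapping.single t 1"

definition dias_relations :: "nat \<Rightarrow> (dias_op tree \<Rightarrow>\<^sub>0 rat) set"
  where "dias_relations n = (let x = Leaf; y = Leaf; z = Leaf in
    if n = 3 then
      { tree_op (x \<stileturn> (y \<turnstile> z)) - tree_op (x \<stileturn> (y \<stileturn> z)),
        tree_op (x \<stileturn> (y \<stileturn> z)) - tree_op ((x \<stileturn> y) \<stileturn> z),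
        tree_op (x \<turnstile> (y \<stileturn> z)) - tree_op ((x \<turnstile> y) \<stileturn> z),
        tree_op (x \<turnstile> (y \<turnstile> z)) - tree_op ((x \<turnstile> y) \<turnstile> z),
        tree_op ((x \<turnstile> y) \<turnstile> z) - tree_op ((x \<stileturn> y) \<turnstile> z) }
    else {})"

definition dias_ideal :: "nat \<Rightarrow> (dias_op tree \<Rightarrow>\<^sub>0 rat) set"
  where "dias_ideal = gen_ns_ideal free_ns_operad dias_relations"

definition ns_Dias :: "(dias_op tree \<Rightarrow>\<^sub>0 rat) set ns_operad"
  where "ns_Dias = quot_ns_operad free_ns_operad dias_ideal"

definition dias_dashv :: "(dias_op tree \<Rightarrow>\<^sub>0 rat) set"
  where "dias_dashv = quot_map free_ns_operad dias_ideal 2 (tree_op (Leaf \<stileturn> Leaf))"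

definition dias_vdash :: "(dias_op tree \<Rightarrow>\<^sub>0 rat) set"
  where "dias_vdash = quot_map free_ns_operad dias_ideal 2 (tree_op (Leaf \<turnstile> Leaf))"

definition dias_tau ::
    "nat \<Rightarrow> (dias_op tree \<Rightarrow>\<^sub>0 rat) set \<Rightarrow> (dias_op tree \<Rightarrow>\<^sub>0 rat) set"
  where "dias_tau = (THE \<tau>.
    ns_anticyclic_operad ns_Dias \<tau> \<and>
    (\<forall>f\<in>elems ns_Dias 1. \<tau> 1 f = \<ominus>\<^bsub>comps ns_Dias 1\<^esub> f) \<and>
    \<tau> 2 dias_dashv = \<ominus>\<^bsub>comps ns_Dias 2\<^esub> dias_vdash \<and>
    \<tau> 2 dias_vdash = dias_dashv \<ominus>\<^bsub>comps ns_Dias 2\<^esub> dias_vdash)"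

type_synonym dias_elem = "(nat \<Rightarrow> nat) \<Rightarrow> (dias_op tree \<Rightarrow>\<^sub>0 rat) set"

definition Dias :: "dias_elem sym_operad"
  where "Dias = symmetrization ns_Dias"

definition Dias_action :: "nat \<Rightarrow> (nat \<Rightarrow> nat) \<Rightarrow> dias_elem \<Rightarrow> dias_elem"
  where "Dias_action = induced_action ns_Dias dias_tau"

text \<open>The element \<open>x\<^sub>1 \<stileturn> x\<^sub>2 - x\<^sub>2 \<turnstile> x\<^sub>1\<close> of \<open>Dias(2)\<close>.\<close>

definition perm_relations :: "nat \<Rightarrow> dias_elem set"
  where "perm_relations n =
    (if n = 2 then
      { pure_tensor ns_Dias 2 dias_dashv id
          \<ominus>\<^bsub>comps Dias 2\<^esub> pure_tensor ns_Dias 2 dias_vdash (transpose 1 2) }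
    else {})"

definition perm_ideal :: "nat \<Rightarrow> dias_elem set"
  where "perm_ideal = gen_sym_ideal Dias perm_relations"

definition Perm :: "dias_elem set sym_operad"
  where "Perm = quot_sym_operad Dias perm_ideal"

definition Dias_to_Perm :: "nat \<Rightarrow> dias_elem \<Rightarrow> dias_elem set"
  where "Dias_to_Perm = quot_map Dias perm_ideal"

end

theory Submission
  imports Defs
begin

text \<open>The quotient map is onto, so at most one action of the symmetric groups on \<open>Perm\<close> makes it a
  morphism, and there is one exactly when the ideal that defines \<open>Perm\<close> is stable under the action of
  \<open>\<SS>\<^bsub>n+1\<^esub>\<close> on \<open>Dias(n)\<close> (\<open>anticyclic_quotient\<close>). Stability has to be checked on generators only:
  the two identities of an anticyclic operad say that the long cycle maps a composite \<open>f \<circ>\<^sub>i g\<close>, up to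
  sign, to a composite of one of \<open>f\<close> or its image with one of \<open>g\<close> or its image. Hence the elements of
  an ideal whose orbits stay inside the ideal form an ideal themselves (\<open>gen_sym_ideal_stable\<close>). For
  \<open>Perm\<close> the only generator is \<open>r = x\<^sub>1 \<stileturn> x\<^sub>2 - x\<^sub>2 \<turnstile> x\<^sub>1\<close>, and the long cycle sends it to \<open>(1 2) r\<close> and
  then to \<open>- r - (1 2) r\<close> (\<open>perm_ideal_stable\<close>).

  This argument presupposes that \<open>Dias\<close> is an anticyclic operad, which takes two further steps.
  First, the non-symmetric operad \<open>Dias\<close> has a map \<open>\<tau>\<close> as required. Monomials of \<open>Dias(n)\<close> are
  determined by the variable \<open>x\<^sub>j\<close> to which their operation signs point. Sending them to \<open>e\<^sub>j - e\<^bsub>n+1\<^esub>\<close>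
  identifies \<open>Dias(n)\<close> with the vectors of coordinate sum zero in an \<open>(n + 1)\<close>-dimensional space
  (\<open>mem_dias_ideal_iff\<close>), and \<open>\<tau>\<close> with the cyclic rotation of coordinates
  (\<open>dias_rotation_anticyclic\<close>). It is the only possible map, since \<open>Dias\<close> is generated in arity two
  (\<open>ns_Dias_anticyclic_unique\<close>).

  Second, the symmetrization of a non-symmetric anticyclic operad is an anticyclic operad
  (\<open>induced_action_anticyclic\<close>). Substitution of permutations is injective, so the coefficients of a
  composite are single composites of coefficients, and every identity reduces to a combinatorial
  one between permutations. For the long cycle \<open>c\<close> and a permutation \<open>\<sigma>\<close> of \<open>n\<close> letters one has
  \<open>c \<sigma> = \<rho> c\<^sup>k\<close> with \<open>k = \<sigma>\<inverse>(1)\<close>, which turns one step of the long cycle into \<open>k\<close> steps of \<open>\<tau>\<close>. On a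
  composite these steps walk through the two factors one after the other, and so does the rotation of
  the substituted permutations (\<open>tau_pow_pcomp_outer\<close>, \<open>tau_pow_pcomp_inner\<close>,
  \<open>long_cycle_perm_pcomp\<close>, \<open>long_cycle_perm_pcomp_first\<close>).\<close>

section \<open>Linear maps and quotient spaces\<close>

lemma rat_field_sel [simp]:
  "carrier rat_field = UNIV" "a \<otimes>\<^bsub>rat_field\<^esub> b = a * b" "\<one>\<^bsub>rat_field\<^esub> = 1"
  "\<zero>\<^bsub>rat_field\<^esub> = 0" "a \<oplus>\<^bsub>rat_field\<^esub> b = a + b"
  by (simp_all add: ring_of_type_algebra_def)

lemma module_ratI:
  assumes "\<zero>\<^bsub>V\<^esub> \<in> carrier V"
    and "\<And>x y. \<lbrakk>x \<in> carrier V; y \<in> carrier V\<rbrakk> \<Longrightarrow> x \<oplus>\<^bsub>V\<^esub> y \<in> carrier V"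
    and "\<And>c x. x \<in> carrier V \<Longrightarrow> c \<odot>\<^bsub>V\<^esub> x \<in> carrier V"
    and "\<And>x y z. \<lbrakk>x \<in> carrier V; y \<in> carrier V; z \<in> carrier V\<rbrakk> \<Longrightarrow>
      (x \<oplus>\<^bsub>V\<^esub> y) \<oplus>\<^bsub>V\<^esub> z = x \<oplus>\<^bsub>V\<^esub> (y \<oplus>\<^bsub>V\<^esub> z)"
    and "\<And>x y. \<lbrakk>x \<in> carrier V; y \<in> carrier V\<rbrakk> \<Longrightarrow> x \<oplus>\<^bsub>V\<^esub> y = y \<oplus>\<^bsub>V\<^esub> x"
    and "\<And>x. x \<in> carrier V \<Longrightarrow> \<zero>\<^bsub>V\<^esub> \<oplus>\<^bsub>V\<^esub> x = x"
    and "\<And>x. x \<in> carrier V \<Longrightarrow> (-1) \<odot>\<^bsub>V\<^esub> x \<oplus>\<^bsub>V\<^esub> x = \<zero>\<^bsub>V\<^esub>"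
    and "\<And>c d x. x \<in> carrier V \<Longrightarrow> (c + d) \<odot>\<^bsub>V\<^esub> x = c \<odot>\<^bsub>V\<^esub> x \<oplus>\<^bsub>V\<^esub> d \<odot>\<^bsub>V\<^esub> x"
    and "\<And>c x y. \<lbrakk>x \<in> carrier V; y \<in> carrier V\<rbrakk> \<Longrightarrow>
      c \<odot>\<^bsub>V\<^esub> (x \<oplus>\<^bsub>V\<^esub> y) = c \<odot>\<^bsub>V\<^esub> x \<oplus>\<^bsub>V\<^esub> c \<odot>\<^bsub>V\<^esub> y"
    and "\<And>c d x. x \<in> carrier V \<Longrightarrow> (c * d) \<odot>\<^bsub>V\<^esub> x = c \<odot>\<^bsub>V\<^esub> (d \<odot>\<^bsub>V\<^esub> x)"
    and "\<And>x. x \<in> carrier V \<Longrightarrow> 1 \<odot>\<^bsub>V\<^esub> x = x"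
  shows "module rat_field V"
proof (rule moduleI)
  show "cring rat_field" ..
  show "abelian_group V"
    by (rule abelian_groupI) (fact assms(1,2,4,5,6) | meson assms(3,7))+
qed (simp_all only: rat_field_sel assms(3,8-11))

lemma (in module) uminus_smult:
  assumes "x \<in> carrier M" shows "\<ominus>\<^bsub>M\<^esub> x = (\<ominus> \<one>) \<odot>\<^bsub>M\<^esub> x"
  using assms by (simp add: smult_l_minus)

lemma rat_uminus_one: "\<ominus>\<^bsub>rat_field\<^esub> \<one>\<^bsub>rat_field\<^esub> = -1"
proof -
  interpret cring rat_field ..
  show ?thesis by (rule minus_equality) simp_all
qed

lemma uminus_smult_rat:
  assumes "module rat_field V" "x \<in> carrier V"
  shows "\<ominus>\<^bsub>V\<^esub> x = (-1) \<odot>\<^bsub>V\<^esub> x"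
  using module.uminus_smult[OF assms] rat_uminus_one by metis

lemma linear_onD:
  assumes "linear_on V W f"
  shows "x \<in> carrier V \<Longrightarrow> f x \<in> carrier W"
    and "\<lbrakk>x \<in> carrier V; y \<in> carrier V\<rbrakk> \<Longrightarrow> f (x \<oplus>\<^bsub>V\<^esub> y) = f x \<oplus>\<^bsub>W\<^esub> f y"
    and "x \<in> carrier V \<Longrightarrow> f (c \<odot>\<^bsub>V\<^esub> x) = c \<odot>\<^bsub>W\<^esub> f x"
  using assms unfolding linear_on_def by auto

lemma linear_onI:
  assumes "\<And>x. x \<in> carrier V \<Longrightarrow> f x \<in> carrier W"
    and "\<And>x y. \<lbrakk>x \<in> carrier V; y \<in> carrier V\<rbrakk> \<Longrightarrow> f (x \<oplus>\<^bsub>V\<^esub> y) = f x \<oplus>\<^bsub>W\<^esub> f y"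
    and "\<And>c x. x \<in> carrier V \<Longrightarrow> f (c \<odot>\<^bsub>V\<^esub> x) = c \<odot>\<^bsub>W\<^esub> f x"
  shows "linear_on V W f"
  using assms unfolding linear_on_def by auto

lemma linear_on_zero:
  assumes "module rat_field V" "module rat_field W" "linear_on V W f"
  shows "f \<zero>\<^bsub>V\<^esub> = \<zero>\<^bsub>W\<^esub>"
proof -
  interpret V: module rat_field V by fact
  interpret W: module rat_field W by fact
  have "f \<zero>\<^bsub>V\<^esub> = f (0 \<odot>\<^bsub>V\<^esub> \<zero>\<^bsub>V\<^esub>)" using V.smult_l_null[OF V.zero_closed] by simp
  also have "\<dots> = 0 \<odot>\<^bsub>W\<^esub> f \<zero>\<^bsub>V\<^esub>" by (rule linear_onD(3)[OF assms(3) V.zero_closed])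
  also have "\<dots> = \<zero>\<^bsub>W\<^esub>"
    using W.smult_l_null[OF linear_onD(1)[OF assms(3) V.zero_closed]] by simp
  finally show ?thesis .
qed

lemma linear_on_uminus:
  assumes "module rat_field V" "module rat_field W" "linear_on V W f" "x \<in> carrier V"
  shows "f (\<ominus>\<^bsub>V\<^esub> x) = \<ominus>\<^bsub>W\<^esub> f x"
  using assms by (simp add: uminus_smult_rat linear_onD)

lemma linear_on_minus:
  assumes "module rat_field V" "module rat_field W" "linear_on V W f"
    "x \<in> carrier V" "y \<in> carrier V"
  shows "f (x \<ominus>\<^bsub>V\<^esub> y) = f x \<ominus>\<^bsub>W\<^esub> f y"
proof -
  interpret V: module rat_field V by fact
  show ?thesis
    using assms by (simp add: a_minus_def linear_on_uminus linear_onD)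
qed

lemma linear_on_funpow:
  assumes "linear_on V V f"
  shows "linear_on V V (f ^^ k)"
proof (induction k)
  case 0
  show ?case by (rule linear_onI) simp_all
next
  case (Suc k)
  then show ?case using assms unfolding linear_on_def by (auto simp: Pi_iff)
qed

lemma linear_on_compose:
  assumes "linear_on U V f" "linear_on V W g"
  shows "linear_on U W (\<lambda>x. g (f x))"
  using assms unfolding linear_on_def by (auto simp: Pi_iff)

lemma module_image:
  assumes V: "module rat_field V" and lin: "linear_on V W \<phi>"
    and surj: "\<phi> ` carrier V = carrier W" and zero: "\<phi> \<zero>\<^bsub>V\<^esub> = \<zero>\<^bsub>W\<^esub>"
  shows "module rat_field W"
proof -
  interpret V: module rat_field V by fact
  note add = linear_onD(2)[OF lin, symmetric] and smult = linear_onD(3)[OF lin, symmetric]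
  show ?thesis
  proof (rule module_ratI, unfold surj[symmetric] zero[symmetric])
    fix x assume "x \<in> \<phi> ` carrier V"
    then obtain u where u: "x = \<phi> u" "u \<in> carrier V" by auto
    have "(-1) \<odot>\<^bsub>V\<^esub> u \<oplus>\<^bsub>V\<^esub> u = \<zero>\<^bsub>V\<^esub>"
      using uminus_smult_rat[OF V u(2)] V.l_neg[OF u(2)] by simp
    then show "(-1) \<odot>\<^bsub>W\<^esub> x \<oplus>\<^bsub>W\<^esub> x = \<phi> \<zero>\<^bsub>V\<^esub>"
      using u V.smult_closed by (simp add: add smult)
    show "1 \<odot>\<^bsub>W\<^esub> x = x" using u V.smult_one by (simp add: smult)
    show "\<phi> \<zero>\<^bsub>V\<^esub> \<oplus>\<^bsub>W\<^esub> x = x" using u by (simp add: add)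
    fix c d
    show "c \<odot>\<^bsub>W\<^esub> x \<in> \<phi> ` carrier V" using u V.smult_closed by (simp add: smult)
    show "(c + d) \<odot>\<^bsub>W\<^esub> x = c \<odot>\<^bsub>W\<^esub> x \<oplus>\<^bsub>W\<^esub> d \<odot>\<^bsub>W\<^esub> x"
      using u V.smult_closed V.smult_l_distr[of c d] by (simp add: smult add)
    show "(c * d) \<odot>\<^bsub>W\<^esub> x = c \<odot>\<^bsub>W\<^esub> (d \<odot>\<^bsub>W\<^esub> x)"
      using u V.smult_closed V.smult_assoc1[of c d] by (simp add: smult)
    fix y assume "y \<in> \<phi> ` carrier V"
    then obtain v where v: "y = \<phi> v" "v \<in> carrier V" by auto
    show "x \<oplus>\<^bsub>W\<^esub> y \<in> \<phi> ` carrier V" using u v by (simp add: add)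
    show "x \<oplus>\<^bsub>W\<^esub> y = y \<oplus>\<^bsub>W\<^esub> x" using u v by (simp add: add V.a_comm)
    show "c \<odot>\<^bsub>W\<^esub> (x \<oplus>\<^bsub>W\<^esub> y) = c \<odot>\<^bsub>W\<^esub> x \<oplus>\<^bsub>W\<^esub> c \<odot>\<^bsub>W\<^esub> y"
      using u v V.smult_closed V.smult_r_distr[of c] by (simp add: smult add)
    fix z assume "z \<in> \<phi> ` carrier V"
    then obtain w where w: "z = \<phi> w" "w \<in> carrier V" by auto
    show "(x \<oplus>\<^bsub>W\<^esub> y) \<oplus>\<^bsub>W\<^esub> z = x \<oplus>\<^bsub>W\<^esub> (y \<oplus>\<^bsub>W\<^esub> z)" using u v w by (simp add: add V.a_assoc)
  qed simp
qed

lemma submodule_facts: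
  assumes "module rat_field V" "submodule H rat_field V"
  shows "H \<subseteq> carrier V" "\<zero>\<^bsub>V\<^esub> \<in> H"
    and "\<And>a b. \<lbrakk>a \<in> H; b \<in> H\<rbrakk> \<Longrightarrow> a \<oplus>\<^bsub>V\<^esub> b \<in> H"
    and "\<And>c a. a \<in> H \<Longrightarrow> c \<odot>\<^bsub>V\<^esub> a \<in> H"
    and "\<And>a. a \<in> H \<Longrightarrow> \<ominus>\<^bsub>V\<^esub> a \<in> H"
    and "abelian_subgroup H V"
proof -
  interpret V: module rat_field V by fact
  note E = V.submoduleE[OF assms(2)]
  show "H \<subseteq> carrier V" "\<And>a b. \<lbrakk>a \<in> H; b \<in> H\<rbrakk> \<Longrightarrow> a \<oplus>\<^bsub>V\<^esub> b \<in> H"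
    "\<And>c a. a \<in> H \<Longrightarrow> c \<odot>\<^bsub>V\<^esub> a \<in> H" "\<And>a. a \<in> H \<Longrightarrow> \<ominus>\<^bsub>V\<^esub> a \<in> H"
    using E(1,3,4,5) by simp_all
  have sg: "subgroup H (add_monoid V)" using assms(2) by (rule submodule.axioms(1))
  show "\<zero>\<^bsub>V\<^esub> \<in> H" using subgroup.one_closed[OF sg] by simp
  show "abelian_subgroup H V"
    by (rule abelian_subgroupI3)
      (auto intro: additive_subgroup.intro sg V.abelian_group_axioms)
qed

lemma submodule_ratI:
  assumes "module rat_field V" "H \<subseteq> carrier V" "\<zero>\<^bsub>V\<^esub> \<in> H"
    and "\<And>a b. \<lbrakk>a \<in> H; b \<in> H\<rbrakk> \<Longrightarrow> a \<oplus>\<^bsub>V\<^esub> b \<in> H"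
    and "\<And>c a. a \<in> H \<Longrightarrow> c \<odot>\<^bsub>V\<^esub> a \<in> H"
  shows "submodule H rat_field V"
  using assms uminus_smult_rat[OF assms(1)]
  by (intro module.submoduleI) (auto simp: subset_iff)

lemma coset_eq_iff:
  assumes "module rat_field V" "submodule H rat_field V" "x \<in> carrier V" "y \<in> carrier V"
  shows "H +>\<^bsub>V\<^esub> x = H +>\<^bsub>V\<^esub> y \<longleftrightarrow> x \<ominus>\<^bsub>V\<^esub> y \<in> H"
proof -
  interpret abelian_subgroup H V using submodule_facts(6)[OF assms(1,2)] .
  have "x \<ominus>\<^bsub>V\<^esub> y \<in> H \<longleftrightarrow> x \<in> H +>\<^bsub>V\<^esub> y"
    using a_rcos_module[OF assms(4,3)] by (simp add: a_minus_def)
  also have "\<dots> \<longleftrightarrow> H +>\<^bsub>V\<^esub> x = H +>\<^bsub>V\<^esub> y"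
    using a_repr_independence' a_repr_independenceD assms(3,4) by metis
  finally show ?thesis by simp
qed

lemma coset_memD:
  assumes "module rat_field V" "submodule H rat_field V" "x \<in> carrier V" "y \<in> H +>\<^bsub>V\<^esub> x"
  shows "y \<in> carrier V" "y \<ominus>\<^bsub>V\<^esub> x \<in> H"
proof -
  interpret abelian_subgroup H V using submodule_facts(6)[OF assms(1,2)] .
  show "y \<in> carrier V" using a_elemrcos_carrier assms(3,4) by blast
  show "y \<ominus>\<^bsub>V\<^esub> x \<in> H"
    using a_rcos_module_imp[OF assms(3,4)] by (simp add: a_minus_def)
qed

lemma coset_self:
  assumes "module rat_field V" "submodule H rat_field V" "x \<in> carrier V"
  shows "x \<in> H +>\<^bsub>V\<^esub> x"
  using abelian_subgroup.a_rcos_self[OF submodule_facts(6)[OF assms(1,2)] assms(3)] .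

text \<open>The operations of a quotient are unions over representatives. Such a union collapses when
  congruent representatives contribute the same set.\<close>

lemma UN_coset:
  assumes "module rat_field V" "submodule H rat_field V" "x \<in> carrier V"
    and "\<And>y. \<lbrakk>y \<in> carrier V; y \<ominus>\<^bsub>V\<^esub> x \<in> H\<rbrakk> \<Longrightarrow> h y = h x"
  shows "(\<Union>y\<in>H +>\<^bsub>V\<^esub> x. h y) = h x"
  using coset_memD[OF assms(1-3)] coset_self[OF assms(1-3)] assms(4) by blast

lemma (in abelian_group) diff_add_eq:
  assumes "a \<in> carrier G" "b \<in> carrier G" "x \<in> carrier G" "y \<in> carrier G"
  shows "(a \<oplus> b) \<ominus> (x \<oplus> y) = (a \<ominus> x) \<oplus> (b \<ominus> y)"
  using assms by (simp add: a_minus_def minus_add a_ac)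

lemma linear_on_smult:
  assumes "module rat_field V" shows "linear_on V V (\<lambda>x. c \<odot>\<^bsub>V\<^esub> x)"
proof -
  interpret V: module rat_field V by fact
  show ?thesis
    using V.smult_closed V.smult_r_distr V.smult_assoc1[symmetric]
    by (intro linear_onI) (auto simp: mult.commute)
qed

lemma quot_module_ops:
  assumes V: "module rat_field V" and H: "submodule H rat_field V"
  shows "(\<lambda>x. H +>\<^bsub>V\<^esub> x) ` carrier V = carrier (quot_module V H)"
    and "linear_on V (quot_module V H) (\<lambda>x. H +>\<^bsub>V\<^esub> x)"
    and "H +>\<^bsub>V\<^esub> \<zero>\<^bsub>V\<^esub> = \<zero>\<^bsub>quot_module V H\<^esub>"
proof -
  interpret V: module rat_field V by fact
  note S = submodule_facts[OF V H]
  show 1: "(\<lambda>x. H +>\<^bsub>V\<^esub> x) ` carrier V = carrier (quot_module V H)"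
    unfolding quot_module_def A_RCOSETS_def' by auto
  show "H +>\<^bsub>V\<^esub> \<zero>\<^bsub>V\<^esub> = \<zero>\<^bsub>quot_module V H\<^esub>"
    unfolding quot_module_def using S(1) by simp
  show "linear_on V (quot_module V H) (\<lambda>x. H +>\<^bsub>V\<^esub> x)"
  proof (rule linear_onI)
    fix x y assume xy: "x \<in> carrier V" "y \<in> carrier V"
    have *: "H +>\<^bsub>V\<^esub> (a \<oplus>\<^bsub>V\<^esub> b) = H +>\<^bsub>V\<^esub> (x \<oplus>\<^bsub>V\<^esub> y)"
      if "a \<in> carrier V" "b \<in> carrier V" "a \<ominus>\<^bsub>V\<^esub> x \<in> H" "b \<ominus>\<^bsub>V\<^esub> y \<in> H" for a b
      using that xy S(3) by (subst coset_eq_iff[OF V H]) (auto simp: V.diff_add_eq)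
    have y: "y \<ominus>\<^bsub>V\<^esub> y \<in> H" using xy S(2) by (simp add: V.r_neg a_minus_def)
    have "(H +>\<^bsub>V\<^esub> x) \<oplus>\<^bsub>quot_module V H\<^esub> (H +>\<^bsub>V\<^esub> y)
      = (\<Union>a\<in>H +>\<^bsub>V\<^esub> x. \<Union>b\<in>H +>\<^bsub>V\<^esub> y. H +>\<^bsub>V\<^esub> (a \<oplus>\<^bsub>V\<^esub> b))"
      by (simp add: quot_module_def)
    also have "\<dots> = (\<Union>a\<in>H +>\<^bsub>V\<^esub> x. H +>\<^bsub>V\<^esub> (a \<oplus>\<^bsub>V\<^esub> y))"
    proof (rule SUP_cong[OF refl])
      fix a assume a: "a \<in> H +>\<^bsub>V\<^esub> x"
      note a = coset_memD[OF V H xy(1) a]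
      show "(\<Union>b\<in>H +>\<^bsub>V\<^esub> y. H +>\<^bsub>V\<^esub> (a \<oplus>\<^bsub>V\<^esub> b)) = H +>\<^bsub>V\<^esub> (a \<oplus>\<^bsub>V\<^esub> y)"
        by (rule UN_coset[OF V H xy(2)]) (simp only: *[OF a(1) _ a(2)] *[OF a(1) xy(2) a(2) y])
    qed
    also have "\<dots> = H +>\<^bsub>V\<^esub> (x \<oplus>\<^bsub>V\<^esub> y)"
      by (rule UN_coset[OF V H xy(1)]) (rule *[OF _ xy(2) _ y])
    finally show "H +>\<^bsub>V\<^esub> (x \<oplus>\<^bsub>V\<^esub> y) =
      (H +>\<^bsub>V\<^esub> x) \<oplus>\<^bsub>quot_module V H\<^esub> (H +>\<^bsub>V\<^esub> y)" ..
  next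
    fix c x assume x: "x \<in> carrier V"
    show "H +>\<^bsub>V\<^esub> (c \<odot>\<^bsub>V\<^esub> x) = c \<odot>\<^bsub>quot_module V H\<^esub> (H +>\<^bsub>V\<^esub> x)"
      unfolding quot_module_def module.simps
    proof (rule UN_coset[OF V H x, symmetric])
      fix y assume y: "y \<in> carrier V" "y \<ominus>\<^bsub>V\<^esub> x \<in> H"
      then have "c \<odot>\<^bsub>V\<^esub> y \<ominus>\<^bsub>V\<^esub> c \<odot>\<^bsub>V\<^esub> x \<in> H"
        using x S(4) linear_on_minus[OF V V linear_on_smult[OF V]] by metis
      then show "H +>\<^bsub>V\<^esub> (c \<odot>\<^bsub>V\<^esub> y) = H +>\<^bsub>V\<^esub> (c \<odot>\<^bsub>V\<^esub> x)"
        using x y V.smult_closed by (subst coset_eq_iff[OF V H]) auto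
    qed
  qed (use 1 in auto)
qed

section \<open>Substitution of permutations\<close>

text \<open>The positions of a composite are of two kinds: \<open>outer_pos n i a\<close> is where the \<open>a\<close>-th input
  of the outer operation goes when its \<open>i\<close>-th input is replaced by \<open>n\<close> inputs, and \<open>inner_pos i b\<close>
  is where the \<open>b\<close>-th of the new inputs goes. In these terms \<^const>\<open>perm_pcomp\<close> applies \<open>\<sigma>\<close> to the
  outer positions and \<open>\<pi>\<close> to the inner ones, so that identities between composites reduce to
  identities between positions, in which no permutation occurs.\<close>

definition outer_pos :: "nat \<Rightarrow> nat \<Rightarrow> nat \<Rightarrow> nat"
  where "outer_pos n i a = (if a < i then a else a + n - 1)"

definition inner_pos :: "nat \<Rightarrow> nat \<Rightarrow> nat"
  where "inner_pos i b = i + b - 1"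

lemmas pos_defs = outer_pos_def inner_pos_def

lemma pos_cases:
  assumes "1 \<le> i" "i \<le> m" "1 \<le> n" "1 \<le> p" "p \<le> m + n - 1"
  obtains a where "1 \<le> a" "a \<le> m" "a \<noteq> i" "p = outer_pos n i a"
    | b where "1 \<le> b" "b \<le> n" "p = inner_pos i b"
proof -
  consider "p < i" | "i \<le> p" "p < i + n" | "i + n \<le> p" by linarith
  then show thesis
  proof cases
    case 1
    then show thesis using that(1)[of p] assms by (simp add: pos_defs)
  next
    case 2
    then show thesis using that(2)[of "p + 1 - i"] assms by (simp add: pos_defs)
  next
    case 3
    then show thesis using that(1)[of "p + 1 - n"] assms by (simp add: pos_defs)
  qed
qed

lemma pos_bounds:
  assumes "1 \<le> i" "i \<le> m" "1 \<le> n"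
  shows "\<lbrakk>1 \<le> a; a \<le> m\<rbrakk> \<Longrightarrow> 1 \<le> outer_pos n i a"
    and "\<lbrakk>1 \<le> a; a \<le> m\<rbrakk> \<Longrightarrow> outer_pos n i a \<le> m + n - 1"
    and "\<lbrakk>1 \<le> b; b \<le> n\<rbrakk> \<Longrightarrow> 1 \<le> inner_pos i b"
    and "\<lbrakk>1 \<le> b; b \<le> n\<rbrakk> \<Longrightarrow> inner_pos i b \<le> m + n - 1"
  using assms by (auto simp: pos_defs)

lemma outer_pos_inject:
  assumes "a \<noteq> i" "a' \<noteq> i" "1 \<le> n" shows "outer_pos n i a = outer_pos n i a' \<longleftrightarrow> a = a'"
  using assms by (auto simp: pos_defs)

lemma inner_pos_inject:
  assumes "1 \<le> b" "1 \<le> b'" shows "inner_pos i b = inner_pos i b' \<longleftrightarrow> b = b'"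
  using assms by (auto simp: pos_defs)

lemma outer_neq_inner:
  assumes "a \<noteq> i" "1 \<le> b" "b \<le> n" shows "outer_pos n i a \<noteq> inner_pos i b"
  using assms by (auto simp: pos_defs)

lemma permutes_nat_bounds:
  fixes \<sigma> :: "nat \<Rightarrow> nat"
  assumes "\<sigma> permutes {1..m}" "1 \<le> a" "a \<le> m"
  shows "1 \<le> \<sigma> a" "\<sigma> a \<le> m"
  using permutes_in_image[OF assms(1), of a] assms(2,3) by auto

lemma perm_inv_bounds:
  assumes "\<sigma> permutes {1..m}" "1 \<le> i" "i \<le> m"
  shows "1 \<le> perm_inv \<sigma> i" "perm_inv \<sigma> i \<le> m"
  using permutes_nat_bounds[OF permutes_inv[OF assms(1)]] assms(2,3) by auto

lemma permutes_neq_iff: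
  assumes "\<sigma> permutes S" shows "\<sigma> a = i \<longleftrightarrow> a = perm_inv \<sigma> i"
  using permutes_inv_eq[OF assms, of i a] by auto

text \<open>The extra position \<open>m + 1\<close>, fixed by \<open>\<sigma>\<close>, is included for the sake of long cycles.\<close>

lemma perm_pcomp_outer:
  assumes "\<sigma> permutes {1..m}" "1 \<le> i" "i \<le> m" "1 \<le> n" "1 \<le> a" "a \<le> m + 1" "a \<noteq> perm_inv \<sigma> i"
  shows "perm_pcomp m n i \<sigma> \<pi> (outer_pos n (perm_inv \<sigma> i) a) = outer_pos n i (\<sigma> a)"
proof (cases "a = m + 1")
  case True
  have "\<sigma> a = a" using permutes_not_in[OF assms(1)] True by simp
  with True assms perm_inv_bounds[OF assms(1-3)] show ?thesis
    by (simp add: perm_pcomp_def pos_defs)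
next
  case False
  with assms perm_inv_bounds[OF assms(1-3)] show ?thesis
    unfolding perm_pcomp_def pos_defs Let_def by auto
qed

lemma perm_pcomp_inner:
  assumes "\<sigma> permutes {1..m}" "1 \<le> i" "i \<le> m" "1 \<le> b" "b \<le> n"
  shows "perm_pcomp m n i \<sigma> \<pi> (inner_pos (perm_inv \<sigma> i) b) = inner_pos i (\<pi> b)"
proof -
  define j where "j = perm_inv \<sigma> i"
  have "1 \<le> j" "j \<le> m" using perm_inv_bounds[OF assms(1-3)] by (simp_all add: j_def)
  then show ?thesis
    using assms(2-) unfolding perm_pcomp_def pos_defs Let_def j_def[symmetric] by auto
qed

lemma perm_pcomp_outside:
  "p < 1 \<or> m + n - 1 < p \<Longrightarrow> perm_pcomp m n i \<sigma> \<pi> p = p"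
  by (simp add: perm_pcomp_def)

lemma perm_pcomp_permutes:
  assumes i: "1 \<le> i" "i \<le> m" "1 \<le> n" and p: "\<sigma> permutes {1..m}" "\<pi> permutes {1..n}"
  shows "perm_pcomp m n i \<sigma> \<pi> permutes {1..m + n - 1}"
proof -
  let ?j = "perm_inv \<sigma> i" and ?f = "perm_pcomp m n i \<sigma> \<pi>"
  note j = perm_inv_bounds[OF p(1) i(1,2)]
  note outer = perm_pcomp_outer[OF p(1) i] and inner = perm_pcomp_inner[OF p(1) i(1,2)]
  note neq = permutes_neq_iff[OF p(1)]
  note \<sigma> = permutes_nat_bounds[OF p(1)] and \<pi> = permutes_nat_bounds[OF p(2)]
  have "?f q \<in> {1..m + n - 1}" if q: "q \<in> {1..m + n - 1}" for q
  proof -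
    from q have q: "1 \<le> q" "q \<le> m + n - 1" by auto
    show ?thesis
    proof (cases rule: pos_cases[OF j i(3) q])
      case (1 a)
      then show ?thesis
        using outer[of a] pos_bounds(1,2)[OF i \<sigma>[OF 1(1,2)]] by auto
    next
      case (2 b)
      then show ?thesis
        using inner[of b] pos_bounds(3,4)[OF i \<pi>[OF 2(1,2)]] by auto
    qed
  qed
  moreover have "inj_on ?f {1..m + n - 1}"
  proof (rule inj_onI)
    fix q r assume qr: "q \<in> {1..m + n - 1}" "r \<in> {1..m + n - 1}" "?f q = ?f r"
    from qr(1) have q: "1 \<le> q" "q \<le> m + n - 1" by auto
    from qr(2) have r: "1 \<le> r" "r \<le> m + n - 1" by auto
    show "q = r"
    proof (cases rule: pos_cases[OF j i(3) q])
      case (1 a)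
      note a = this
      show ?thesis
      proof (cases rule: pos_cases[OF j i(3) r])
        case (1 a')
        then show ?thesis
          using a qr(3) outer[of a] outer[of a'] neq
            outer_pos_inject[of "\<sigma> a" i "\<sigma> a'" n] i(3) permutes_inj[OF p(1)]
          by (auto dest: injD)
      next
        case (2 b)
        then show ?thesis
          using a qr(3) outer[of a] inner[of b] neq outer_neq_inner[of "\<sigma> a" i "\<pi> b" n] \<pi> by auto
      qed
    next
      case (2 b)
      note b = this
      show ?thesis
      proof (cases rule: pos_cases[OF j i(3) r])
        case (1 a)
        then show ?thesis
          using b qr(3) outer[of a] inner[of b] neq outer_neq_inner[of "\<sigma> a" i "\<pi> b" n] \<pi> by auto
      next
        case (2 b')
        then show ?thesis
          using b qr(3) inner[of b] inner[of b'] inner_pos_inject[of "\<pi> b" "\<pi> b'" i] \<pi>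
            permutes_inj[OF p(2)]
          by (auto dest: injD)
      qed
    qed
  qed
  ultimately have "bij_betw ?f {1..m + n - 1} {1..m + n - 1}"
    by (metis bij_betw_def endo_inj_surj finite_atLeastAtMost image_subsetI)
  then show ?thesis
    by (rule bij_imp_permutes) (auto intro: perm_pcomp_outside)
qed

lemma perm_pcomp_eqI:
  assumes "1 \<le> j" "j \<le> m" "1 \<le> n"
    and "\<And>p. p < 1 \<or> m + n - 1 < p \<Longrightarrow> f p = p" "\<And>p. p < 1 \<or> m + n - 1 < p \<Longrightarrow> g p = p"
    and "\<And>a. \<lbrakk>1 \<le> a; a \<le> m; a \<noteq> j\<rbrakk> \<Longrightarrow> f (outer_pos n j a) = g (outer_pos n j a)"
    and "\<And>b. \<lbrakk>1 \<le> b; b \<le> n\<rbrakk> \<Longrightarrow> f (inner_pos j b) = g (inner_pos j b)"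
  shows "f = g"
proof
  fix p
  show "f p = g p"
  proof (cases "p < 1 \<or> m + n - 1 < p")
    case True
    then show ?thesis using assms(4)[of p] assms(5)[of p] by simp
  next
    case False
    then have "1 \<le> p" "p \<le> m + n - 1" by auto
    then show ?thesis
      by (cases rule: pos_cases[OF assms(1-3)]) (use assms(6,7) in auto)
  qed
qed

lemma perm_pcomp_inv_inner:
  assumes i: "1 \<le> i" "i \<le> m" "1 \<le> b" "b \<le> n" and p: "\<sigma> permutes {1..m}" "\<pi> permutes {1..n}"
  shows "perm_inv (perm_pcomp m n i \<sigma> \<pi>) (inner_pos i b) =
    inner_pos (perm_inv \<sigma> i) (perm_inv \<pi> b)"
proof -
  have n: "1 \<le> n" using i by simp
  have "perm_pcomp m n i \<sigma> \<pi> (inner_pos (perm_inv \<sigma> i) (perm_inv \<pi> b)) = inner_pos i b"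
    using perm_pcomp_inner[OF p(1) i(1,2)] perm_inv_bounds[OF p(2) i(3,4)] permutes_inverses[OF p(2)]
    by simp
  then show ?thesis
    using permutes_inv_eq[OF perm_pcomp_permutes[OF i(1,2) n p]] by blast
qed

lemma perm_pcomp_inv_outer:
  assumes i: "1 \<le> i" "i \<le> m" "1 \<le> n" "1 \<le> k" "k \<le> m" "k \<noteq> i"
    and p: "\<sigma> permutes {1..m}" "\<pi> permutes {1..n}"
  shows "perm_inv (perm_pcomp m n i \<sigma> \<pi>) (outer_pos n i k) =
    outer_pos n (perm_inv \<sigma> i) (perm_inv \<sigma> k)"
proof -
  have k: "perm_inv \<sigma> k \<noteq> perm_inv \<sigma> i"
    using i(6) permutes_inj[OF permutes_inv[OF p(1)]] by (auto dest: injD)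
  have "perm_pcomp m n i \<sigma> \<pi> (outer_pos n (perm_inv \<sigma> i) (perm_inv \<sigma> k)) = outer_pos n i k"
    using perm_pcomp_outer[OF p(1) i(1,2,3) _ _ k] perm_inv_bounds[OF p(1) i(4,5)]
      permutes_inverses[OF p(1)]
    by simp
  then show ?thesis
    using permutes_inv_eq[OF perm_pcomp_permutes[OF i(1,2,3) p]] by blast
qed

text \<open>In a composite the values \<open>i, \<dots>, i + n - 1\<close> fill a block of consecutive positions. The
  block determines the place of insertion, and then \<open>\<pi>\<close> can be read off inside and \<open>\<sigma>\<close> outside.\<close>

lemma perm_pcomp_inject:
  assumes i: "1 \<le> i" "i \<le> m" "1 \<le> n"
    and p: "\<sigma> permutes {1..m}" "\<pi> permutes {1..n}" and p': "\<sigma>' permutes {1..m}" "\<pi>' permutes {1..n}"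
    and eq: "perm_pcomp m n i \<sigma> \<pi> = perm_pcomp m n i \<sigma>' \<pi>'"
  shows "\<sigma> = \<sigma>'" "\<pi> = \<pi>'"
proof -
  \<comment> \<open>The first position of the block of \<open>\<sigma>, \<pi>\<close> carries the value \<open>i + \<pi>(1) - 1\<close>, which the other
    composite also takes inside its block.\<close>
  have le: "perm_inv \<sigma>' i \<le> perm_inv \<sigma> i"
    if p: "\<sigma> permutes {1..m}" "\<pi> permutes {1..n}" and p': "\<sigma>' permutes {1..m}" "\<pi>' permutes {1..n}"
      and eq: "perm_pcomp m n i \<sigma> \<pi> = perm_pcomp m n i \<sigma>' \<pi>'" for \<sigma> \<pi> \<sigma>' \<pi>'
  proof -
    note b = permutes_nat_bounds[OF p(2) order_refl i(3)]
    have "inner_pos (perm_inv \<sigma> i) (perm_inv \<pi> (\<pi> 1)) = inner_pos (perm_inv \<sigma>' i) (perm_inv \<pi>' (\<pi> 1))"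
      using perm_pcomp_inv_inner[OF i(1,2) b p] perm_pcomp_inv_inner[OF i(1,2) b p'] eq by simp
    then show ?thesis
      using permutes_inverses[OF p(2)] perm_inv_bounds[OF p'(2) b] by (simp add: pos_defs)
  qed
  have j: "perm_inv \<sigma> i = perm_inv \<sigma>' i"
    using le[OF p p' eq] le[OF p' p eq[symmetric]] by simp
  show "\<pi> = \<pi>'"
  proof
    fix b
    show "\<pi> b = \<pi>' b"
    proof (cases "b \<in> {1..n}")
      case True
      then have "inner_pos i (\<pi> b) = inner_pos i (\<pi>' b)"
        using perm_pcomp_inner[OF p(1) i(1,2), of b n \<pi>] perm_pcomp_inner[OF p'(1) i(1,2), of b n \<pi>'] eq j
        by simp
      then show ?thesis
        using inner_pos_inject permutes_nat_bounds[OF p(2)] permutes_nat_bounds[OF p'(2)] True by auto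
    qed (use permutes_not_in[OF p(2)] permutes_not_in[OF p'(2)] in simp)
  qed
  show "\<sigma> = \<sigma>'"
  proof
    fix a
    consider "a \<notin> {1..m}" | "a = perm_inv \<sigma> i" | "a \<in> {1..m}" "a \<noteq> perm_inv \<sigma> i" by blast
    then show "\<sigma> a = \<sigma>' a"
    proof cases
      case 1
      then show ?thesis using permutes_not_in[OF p(1)] permutes_not_in[OF p'(1)] by simp
    next
      case 2
      then show ?thesis
        using permutes_neq_iff[OF p(1), of a i] permutes_neq_iff[OF p'(1), of a i] j by simp
    next
      case 3
      then have "outer_pos n i (\<sigma> a) = outer_pos n i (\<sigma>' a)"
        using perm_pcomp_outer[OF p(1) i, of a \<pi>] perm_pcomp_outer[OF p'(1) i, of a \<pi>'] eq j by simp
      then show ?thesis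
        using outer_pos_inject[of "\<sigma> a" i "\<sigma>' a" n] 3 i(3) j
          permutes_neq_iff[OF p(1), of a i] permutes_neq_iff[OF p'(1), of a i] by simp
    qed
  qed
qed

lemma perm_pcomp_id_left:
  assumes "1 \<le> n" "\<pi> permutes {1..n}" shows "perm_pcomp 1 n 1 id \<pi> = \<pi>"
proof (rule perm_pcomp_eqI[where j = 1 and m = 1 and n = n])
  show "perm_pcomp 1 n 1 id \<pi> (inner_pos 1 b) = \<pi> (inner_pos 1 b)" if "1 \<le> b" "b \<le> n" for b
    using perm_pcomp_inner[of id 1 1 b n \<pi>] that by (simp add: permutes_id inner_pos_def)
qed (use assms permutes_not_in[OF assms(2)] in \<open>auto simp: perm_pcomp_outside\<close>)

lemma perm_pcomp_id_right:
  assumes "1 \<le> i" "i \<le> n" "\<sigma> permutes {1..n}" shows "perm_pcomp n 1 i \<sigma> id = \<sigma>"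
proof (rule perm_pcomp_eqI[where j = "perm_inv \<sigma> i" and m = n and n = 1])
  show "perm_pcomp n 1 i \<sigma> id (outer_pos 1 (perm_inv \<sigma> i) a) = \<sigma> (outer_pos 1 (perm_inv \<sigma> i) a)"
    if "1 \<le> a" "a \<le> n" "a \<noteq> perm_inv \<sigma> i" for a
    using perm_pcomp_outer[OF assms(3,1,2), of 1 a id] that by (simp add: outer_pos_def)
  show "perm_pcomp n 1 i \<sigma> id (inner_pos (perm_inv \<sigma> i) b) = \<sigma> (inner_pos (perm_inv \<sigma> i) b)"
    if "1 \<le> b" "b \<le> 1" for b
    using perm_pcomp_inner[OF assms(3,1,2), of b 1 id] that permutes_inverses[OF assms(3)]
    by (simp add: inner_pos_def)
qed (use assms perm_inv_bounds[OF assms(3,1,2)] permutes_not_in[OF assms(3)] in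
      \<open>auto simp: perm_pcomp_outside\<close>)

text \<open>The combinatorial content of equivariance, and after it that of the two associativity axioms.\<close>

lemma perm_pcomp_compose:
  assumes i: "1 \<le> i" "i \<le> m" "1 \<le> n"
    and p: "\<sigma> permutes {1..m}" "\<pi> permutes {1..n}" and p': "\<sigma>' permutes {1..m}" "\<pi>' permutes {1..n}"
  shows "perm_pcomp m n i (\<sigma> \<circ> \<sigma>') (\<pi> \<circ> \<pi>') =
    perm_pcomp m n i \<sigma> \<pi> \<circ> perm_pcomp m n (perm_inv \<sigma> i) \<sigma>' \<pi>'"
proof -
  let ?j = "perm_inv \<sigma> i"
  let ?k = "perm_inv \<sigma>' ?j"
  note j = perm_inv_bounds[OF p(1) i(1,2)] note k = perm_inv_bounds[OF p'(1) j]
  have inv: "perm_inv (\<sigma> \<circ> \<sigma>') i = ?k"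
    using p(1) p'(1) by (simp add: permutes_inv_o(2)[OF p(1)] permutes_bij o_inv_distrib)
  note \<sigma>\<sigma>' = permutes_compose[OF p'(1) p(1)]
  show ?thesis
  proof (rule perm_pcomp_eqI[OF k i(3)])
    fix a assume a: "1 \<le> a" "a \<le> m" "a \<noteq> ?k"
    note b = permutes_nat_bounds[OF p'(1) a(1,2)]
    have "\<sigma>' a \<noteq> ?j" using a(3) permutes_neq_iff[OF p'(1)] by blast
    then show "perm_pcomp m n i (\<sigma> \<circ> \<sigma>') (\<pi> \<circ> \<pi>') (outer_pos n ?k a) =
        (perm_pcomp m n i \<sigma> \<pi> \<circ> perm_pcomp m n ?j \<sigma>' \<pi>') (outer_pos n ?k a)"
      using perm_pcomp_outer[OF \<sigma>\<sigma>' i, of a] perm_pcomp_outer[OF p'(1) j i(3), of a]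
        perm_pcomp_outer[OF p(1) i, of "\<sigma>' a"] a b inv by simp
  next
    fix b assume b: "1 \<le> b" "b \<le> n"
    then show "perm_pcomp m n i (\<sigma> \<circ> \<sigma>') (\<pi> \<circ> \<pi>') (inner_pos ?k b) =
        (perm_pcomp m n i \<sigma> \<pi> \<circ> perm_pcomp m n ?j \<sigma>' \<pi>') (inner_pos ?k b)"
      using perm_pcomp_inner[OF \<sigma>\<sigma>' i(1,2), of b n] perm_pcomp_inner[OF p'(1) j, of b n]
        perm_pcomp_inner[OF p(1) i(1,2), of "\<pi>' b" n] permutes_nat_bounds[OF p'(2) b] inv by simp
  qed (simp_all add: perm_pcomp_outside)
qed

lemma perm_pcomp_sequential:
  assumes i: "1 \<le> i" "i \<le> l" "1 \<le> j" "j \<le> m" "1 \<le> n"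
    and p: "\<sigma> permutes {1..l}" "\<pi> permutes {1..m}" "\<kappa> permutes {1..n}"
  shows "perm_pcomp (l + m - 1) n (i + j - 1) (perm_pcomp l m i \<sigma> \<pi>) \<kappa> =
    perm_pcomp l (m + n - 1) i \<sigma> (perm_pcomp m n j \<pi> \<kappa>)" (is "?L = ?R")
proof -
  let ?a = "perm_inv \<sigma> i" and ?b = "perm_inv \<pi> j"
  let ?J = "inner_pos ?a ?b"
  have m: "1 \<le> m" "1 \<le> m + n - 1" using i by auto
  note a = perm_inv_bounds[OF p(1) i(1,2)] and b = perm_inv_bounds[OF p(2) i(3,4)]
  have ij: "i + j - 1 = inner_pos i j" by (simp add: inner_pos_def)
  note \<sigma>\<pi> = perm_pcomp_permutes[OF i(1,2) m(1) p(1,2)]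
  have ij': "1 \<le> inner_pos i j" "inner_pos i j \<le> l + m - 1" using pos_bounds[OF i(1,2) m(1)] i by auto
  have J: "perm_inv (perm_pcomp l m i \<sigma> \<pi>) (inner_pos i j) = ?J"
    by (rule perm_pcomp_inv_inner[OF i(1-4) p(1,2)])
  note outL = perm_pcomp_outer[OF \<sigma>\<pi> ij' i(5), unfolded J]
  note innL = perm_pcomp_inner[OF \<sigma>\<pi> ij', unfolded J]
  have assoc: "outer_pos n (inner_pos a b) (outer_pos m a x) = outer_pos (m + n - 1) a x"
    if "1 \<le> b" "b \<le> m" "x \<noteq> a" for a b x using that i(5) by (auto simp: pos_defs)
  have assoc': "outer_pos n (inner_pos a b) (inner_pos a y) = inner_pos a (outer_pos n b y)"
    if "1 \<le> b" "1 \<le> y" "1 \<le> a" for a b y using that i(5) by (auto simp: pos_defs)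
  have assoc'': "inner_pos (inner_pos a b) z = inner_pos a (inner_pos b z)"
    if "1 \<le> b" "1 \<le> z" "1 \<le> a" for a b z using that by (auto simp: pos_defs)
  show ?thesis
    unfolding ij
  proof (rule perm_pcomp_eqI[OF a m(2)])
    fix x assume x: "1 \<le> x" "x \<le> l" "x \<noteq> ?a"
    have x': "\<sigma> x \<noteq> i" using permutes_neq_iff[OF p(1)] x by blast
    have "perm_pcomp (l + m - 1) n (inner_pos i j) (perm_pcomp l m i \<sigma> \<pi>) \<kappa>
        (outer_pos n ?J (outer_pos m ?a x)) = outer_pos n (inner_pos i j) (perm_pcomp l m i \<sigma> \<pi> (outer_pos m ?a x))"
      using outer_neq_inner[OF x(3) b] pos_bounds(1,2)[OF a m(1) x(1,2)] by (intro outL) auto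
    then show "perm_pcomp (l + m - 1) n (inner_pos i j) (perm_pcomp l m i \<sigma> \<pi>) \<kappa>
          (outer_pos (m + n - 1) ?a x) = ?R (outer_pos (m + n - 1) ?a x)"
      using perm_pcomp_outer[OF p(1) i(1,2) m(1), of x] perm_pcomp_outer[OF p(1) i(1,2) m(2), of x] x
      by (simp add: assoc[OF b x(3)] assoc[OF i(3,4) x'] del: One_nat_def)
  next
    fix c assume c: "1 \<le> c" "c \<le> m + n - 1"
    have innR: "?R (inner_pos ?a c) = inner_pos i (perm_pcomp m n j \<pi> \<kappa> c)"
      by (rule perm_pcomp_inner[OF p(1) i(1,2) c])
    show "perm_pcomp (l + m - 1) n (inner_pos i j) (perm_pcomp l m i \<sigma> \<pi>) \<kappa>
          (inner_pos ?a c) = ?R (inner_pos ?a c)"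
    proof (cases rule: pos_cases[OF b i(5) c])
      case (1 y)
      note y = permutes_nat_bounds[OF p(2) 1(1,2)]
      have neq: "inner_pos ?a y \<noteq> ?J" using inner_pos_inject[of y ?b ?a] 1 b by simp
      have "perm_pcomp (l + m - 1) n (inner_pos i j) (perm_pcomp l m i \<sigma> \<pi>) \<kappa>
          (outer_pos n ?J (inner_pos ?a y)) = outer_pos n (inner_pos i j) (perm_pcomp l m i \<sigma> \<pi> (inner_pos ?a y))"
        using pos_bounds(3,4)[OF a m(1) 1(1,2)] neq by (intro outL) auto
      then show ?thesis
        using perm_pcomp_inner[OF p(1) i(1,2) 1(1,2)] perm_pcomp_outer[OF p(2) i(3-5), of y] 1
        by (simp add: innR[unfolded 1(4)] assoc'[OF b(1) 1(1) a(1)] assoc'[OF i(3) y(1) i(1)] del: One_nat_def)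
    next
      case (2 z)
      note z = permutes_nat_bounds[OF p(3) 2(1,2)]
      show ?thesis
        using innL[OF 2(1,2)] perm_pcomp_inner[OF p(2) i(3,4) 2(1,2)] 2(3)
        by (simp add: innR[unfolded 2(3)] assoc''[OF b(1) 2(1) a(1)] assoc''[OF i(3) z(1) i(1)] del: One_nat_def)
    qed
  qed ((rule perm_pcomp_outside, use m in arith)+)
qed

text \<open>Replacing the \<open>a\<close>-th and the \<open>c\<close>-th input can be done in either order.\<close>

lemma pos_parallel:
  assumes "a \<noteq> c" "1 \<le> a" "1 \<le> c" "1 \<le> m" "1 \<le> n"
  shows "\<lbrakk>x \<noteq> a; x \<noteq> c\<rbrakk> \<Longrightarrow>
      outer_pos n (outer_pos m a c) (outer_pos m a x) = outer_pos m (outer_pos n c a) (outer_pos n c x)"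
    and "\<lbrakk>1 \<le> y; y \<le> m\<rbrakk> \<Longrightarrow> outer_pos n (outer_pos m a c) (inner_pos a y) = inner_pos (outer_pos n c a) y"
    and "\<lbrakk>1 \<le> z; z \<le> n\<rbrakk> \<Longrightarrow> inner_pos (outer_pos m a c) z = outer_pos m (outer_pos n c a) (inner_pos c z)"
  using assms by (auto simp: pos_defs)

lemma perm_pcomp_parallel:
  assumes i: "1 \<le> i" "i \<le> l" "1 \<le> k" "k \<le> l" "i \<noteq> k" "1 \<le> m" "1 \<le> n"
    and p: "\<sigma> permutes {1..l}" "\<pi> permutes {1..m}" "\<kappa> permutes {1..n}"
  shows "perm_pcomp (l + m - 1) n (outer_pos m i k) (perm_pcomp l m i \<sigma> \<pi>) \<kappa> =
    perm_pcomp (l + n - 1) m (outer_pos n k i) (perm_pcomp l n k \<sigma> \<kappa>) \<pi>" (is "?L = ?R")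
proof -
  let ?a = "perm_inv \<sigma> i" and ?c = "perm_inv \<sigma> k"
  note a = perm_inv_bounds[OF p(1) i(1,2)] and c = perm_inv_bounds[OF p(1) i(3,4)]
  have ac: "?a \<noteq> ?c"
    using i(5) permutes_inj[OF permutes_inv[OF p(1)]] by (auto dest: injD)
  note \<sigma>\<pi> = perm_pcomp_permutes[OF i(1,2,6) p(1,2)] and \<sigma>\<kappa> = perm_pcomp_permutes[OF i(3,4,7) p(1,3)]
  note J = perm_pcomp_inv_outer[OF i(1,2,6,3,4) i(5)[symmetric] p(1,2)]
  note J' = perm_pcomp_inv_outer[OF i(3,4,7,1,2,5) p(1,3)]
  note ik = pos_bounds(1,2)[OF i(1,2,6,3,4)] and ki = pos_bounds(1,2)[OF i(3,4,7,1,2)]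
  note outL = perm_pcomp_outer[OF \<sigma>\<pi> ik i(7), unfolded J]
  note innL = perm_pcomp_inner[OF \<sigma>\<pi> ik, unfolded J]
  note outR = perm_pcomp_outer[OF \<sigma>\<kappa> ki i(6), unfolded J']
  note innR = perm_pcomp_inner[OF \<sigma>\<kappa> ki, unfolded J']
  note J_bounds = pos_bounds(1,2)[OF a i(6) c]
  show ?thesis
  proof (rule perm_pcomp_eqI[OF J_bounds i(7)])
    fix q assume q: "1 \<le> q" "q \<le> l + m - 1" "q \<noteq> outer_pos m ?a ?c"
    show "?L (outer_pos n (outer_pos m ?a ?c) q) = ?R (outer_pos n (outer_pos m ?a ?c) q)"
    proof (cases rule: pos_cases[OF a i(6) q(1,2)])
      case (1 x)
      have xc: "x \<noteq> ?c" using 1(4) q(3) by blast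
      have \<sigma>x: "\<sigma> x \<noteq> i" "\<sigma> x \<noteq> k" using permutes_neq_iff[OF p(1)] 1(3) xc by blast+
      have "?L (outer_pos n (outer_pos m ?a ?c) q) = outer_pos n (outer_pos m i k) (outer_pos m i (\<sigma> x))"
        using outL[of q] q perm_pcomp_outer[OF p(1) i(1,2,6), of x] 1 by simp
      moreover have "?R (outer_pos m (outer_pos n ?c ?a) (outer_pos n ?c x)) =
          outer_pos m (outer_pos n k i) (outer_pos n k (\<sigma> x))"
        using outR[of "outer_pos n ?c x"] pos_bounds(1,2)[OF c i(7) 1(1,2)]
          outer_pos_inject[OF xc ac i(7)] perm_pcomp_outer[OF p(1) i(3,4,7), of x] 1 xc by simp
      ultimately show ?thesis
        using pos_parallel(1)[OF ac a(1) c(1) i(6,7) 1(3) xc] pos_parallel(1)[OF i(5,1,3,6,7) \<sigma>x] 1(4)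
        by simp
    next
      case (2 y)
      note y = permutes_nat_bounds[OF p(2) 2(1,2)]
      have "?L (outer_pos n (outer_pos m ?a ?c) q) = outer_pos n (outer_pos m i k) (inner_pos i (\<pi> y))"
        using outL[of q] q perm_pcomp_inner[OF p(1) i(1,2) 2(1,2)] 2 by simp
      then show ?thesis
        using pos_parallel(2)[OF ac a(1) c(1) i(6,7) 2(1,2)] pos_parallel(2)[OF i(5,1,3,6,7) y]
          innR[OF 2(1,2)] 2(3) by simp
    qed
  next
    fix z assume z: "1 \<le> z" "z \<le> n"
    note z' = permutes_nat_bounds[OF p(3) z]
    have "?R (outer_pos m (outer_pos n ?c ?a) (inner_pos ?c z)) =
        outer_pos m (outer_pos n k i) (inner_pos k (\<kappa> z))"
      using outR[of "inner_pos ?c z"] pos_bounds(3,4)[OF c i(7) z] outer_neq_inner[OF ac z]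
        perm_pcomp_inner[OF p(1) i(3,4) z] by simp
    then show "?L (inner_pos (outer_pos m ?a ?c) z) = ?R (inner_pos (outer_pos m ?a ?c) z)"
      using innL[OF z] pos_parallel(3)[OF ac a(1) c(1) i(6,7) z] pos_parallel(3)[OF i(5,1,3,6,7) z'] by simp
  qed ((rule perm_pcomp_outside, use i in arith)+)
qed

section \<open>Quotients of operads\<close>

lemma (in ns_operad) comps_closed:
  assumes "1 \<le> n"
  shows "\<zero>\<^bsub>comps P n\<^esub> \<in> elems P n"
    and "x \<in> elems P n \<Longrightarrow> \<ominus>\<^bsub>comps P n\<^esub> x \<in> elems P n"
    and "\<lbrakk>x \<in> elems P n; y \<in> elems P n\<rbrakk> \<Longrightarrow> x \<ominus>\<^bsub>comps P n\<^esub> y \<in> elems P n"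
    and "\<lbrakk>x \<in> elems P n; y \<in> elems P n\<rbrakk> \<Longrightarrow> x \<oplus>\<^bsub>comps P n\<^esub> y \<in> elems P n"
    and "x \<in> elems P n \<Longrightarrow> c \<odot>\<^bsub>comps P n\<^esub> x \<in> elems P n"
proof -
  interpret V: module rat_field "comps P n" using vector_space[OF assms] .
  show "\<zero>\<^bsub>comps P n\<^esub> \<in> elems P n" by simp
  show "x \<in> elems P n \<Longrightarrow> \<ominus>\<^bsub>comps P n\<^esub> x \<in> elems P n" by simp
  show "\<lbrakk>x \<in> elems P n; y \<in> elems P n\<rbrakk> \<Longrightarrow> x \<ominus>\<^bsub>comps P n\<^esub> y \<in> elems P n" by simp
  show "\<lbrakk>x \<in> elems P n; y \<in> elems P n\<rbrakk> \<Longrightarrow> x \<oplus>\<^bsub>comps P n\<^esub> y \<in> elems P n" by simp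
  show "x \<in> elems P n \<Longrightarrow> c \<odot>\<^bsub>comps P n\<^esub> x \<in> elems P n" using V.smult_closed by simp
qed

lemma (in ns_operad) pcomp_closed:
  "\<lbrakk>1 \<le> i; i \<le> m; 1 \<le> n; f \<in> elems P m; g \<in> elems P n\<rbrakk> \<Longrightarrow>
    pcomp P m n i f g \<in> elems P (m + n - 1)"
  using linear_onD(1)[OF pcomp_linear_left] by blast

text \<open>The axioms of an operad are equations and linearity statements, so they pass to the image of
  a surjective map that preserves the operations. For quotients this reduces the axioms to the
  well-definedness of the operations on cosets.\<close>

lemma ns_operad_image:
  fixes P :: "('a, 'm) ns_operad_scheme" and Q :: "('b, 'n) ns_operad_scheme"
  assumes P: "ns_operad P"
    and lin: "\<And>n. 1 \<le> n \<Longrightarrow> linear_on (comps P n) (comps Q n) (\<phi> n)"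
    and surj: "\<And>n. 1 \<le> n \<Longrightarrow> \<phi> n ` elems P n = elems Q n"
    and zero: "\<And>n. 1 \<le> n \<Longrightarrow> \<phi> n \<zero>\<^bsub>comps P n\<^esub> = \<zero>\<^bsub>comps Q n\<^esub>"
    and unit: "\<phi> 1 (unit P) = unit Q"
    and pcomp: "\<And>m n i f g. \<lbrakk>1 \<le> i; i \<le> m; 1 \<le> n; f \<in> elems P m; g \<in> elems P n\<rbrakk> \<Longrightarrow>
      \<phi> (m + n - 1) (pcomp P m n i f g) = pcomp Q m n i (\<phi> m f) (\<phi> n g)"
  shows "ns_operad Q"
proof -
  interpret P: ns_operad P by fact
  have ex: "\<exists>f\<in>elems P n. u = \<phi> n f" if "u \<in> elems Q n" "1 \<le> n" for u n
    using that surj[of n] by blast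
  note closed = linear_onD(1)[OF lin]
  note comp = pcomp[symmetric]
  show ?thesis
  proof (rule ns_operad.intro)
    fix n :: nat assume "1 \<le> n"
    then show "module rat_field (comps Q n)"
      using module_image[OF P.vector_space lin surj zero] by blast
  next
    show "unit Q \<in> elems Q 1" using closed[OF _ P.unit_closed] unit by simp
  next
    fix i m n :: nat and g
    assume i: "1 \<le> i" "i \<le> m" and n: "1 \<le> n" and "g \<in> elems Q n"
    then obtain g' where g: "g = \<phi> n g'" "g' \<in> elems P n" using ex by blast
    have m: "1 \<le> m" "1 \<le> m + n - 1" using i n by auto
    note L = P.pcomp_linear_left[OF i n g(2)]
    show "linear_on (comps Q m) (comps Q (m + n - 1)) (\<lambda>f. pcomp Q m n i f g)"
    proof (rule linear_onI)
      fix x assume "x \<in> elems Q m"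
      then obtain f where f: "x = \<phi> m f" "f \<in> elems P m" using ex m by blast
      show "pcomp Q m n i x g \<in> elems Q (m + n - 1)"
        using closed[OF m(2)] P.pcomp_closed i n f g by (simp add: comp)
      show "pcomp Q m n i (c \<odot>\<^bsub>comps Q m\<^esub> x) g = c \<odot>\<^bsub>comps Q (m + n - 1)\<^esub> pcomp Q m n i x g" for c
        using linear_onD(3)[OF lin] linear_onD(3)[OF L, of f c] P.comps_closed(5) P.pcomp_closed i n f g m
        by (metis (no_types, lifting) comp)
      fix y assume "y \<in> elems Q m"
      then obtain f' where f': "y = \<phi> m f'" "f' \<in> elems P m" using ex m by blast
      show "pcomp Q m n i (x \<oplus>\<^bsub>comps Q m\<^esub> y) g =
        pcomp Q m n i x g \<oplus>\<^bsub>comps Q (m + n - 1)\<^esub> pcomp Q m n i y g"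
        using linear_onD(2)[OF lin] linear_onD(2)[OF L, of f f'] P.comps_closed(4) P.pcomp_closed
          i n f f' g m
        by (metis (no_types, lifting) comp)
    qed
  next
    fix i m n :: nat and f
    assume i: "1 \<le> i" "i \<le> m" and n: "1 \<le> n" and f0: "f \<in> elems Q m"
    have m: "1 \<le> m" "1 \<le> m + n - 1" using i n by auto
    obtain f' where f: "f = \<phi> m f'" "f' \<in> elems P m" using ex f0 m by blast
    note L = P.pcomp_linear_right[OF i n f(2)]
    show "linear_on (comps Q n) (comps Q (m + n - 1)) (\<lambda>g. pcomp Q m n i f g)"
    proof (rule linear_onI)
      fix x assume "x \<in> elems Q n"
      then obtain g where g: "x = \<phi> n g" "g \<in> elems P n" using ex n by blast
      show "pcomp Q m n i f x \<in> elems Q (m + n - 1)"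
        using closed[OF m(2)] P.pcomp_closed i n f g by (simp add: comp)
      show "pcomp Q m n i f (c \<odot>\<^bsub>comps Q n\<^esub> x) = c \<odot>\<^bsub>comps Q (m + n - 1)\<^esub> pcomp Q m n i f x" for c
        using linear_onD(3)[OF lin] linear_onD(3)[OF L, of g c] P.comps_closed(5) P.pcomp_closed i n f g m
        by (metis (no_types, lifting) comp)
      fix y assume "y \<in> elems Q n"
      then obtain g' where g': "y = \<phi> n g'" "g' \<in> elems P n" using ex n by blast
      show "pcomp Q m n i f (x \<oplus>\<^bsub>comps Q n\<^esub> y) =
        pcomp Q m n i f x \<oplus>\<^bsub>comps Q (m + n - 1)\<^esub> pcomp Q m n i f y"
        using linear_onD(2)[OF lin] linear_onD(2)[OF L, of g g'] P.comps_closed(4) P.pcomp_closed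
          i n f g g' m
        by (metis (no_types, lifting) comp)
    qed
  next
    fix n :: nat and f assume "1 \<le> n" "f \<in> elems Q n"
    then obtain f' where f: "1 \<le> n" "f = \<phi> n f'" "f' \<in> elems P n" using ex by blast
    then show "pcomp Q 1 n 1 (unit Q) f = f"
      using pcomp[of 1 1 n "unit P" f'] P.unit_left[of n f'] P.unit_closed unit by simp
  next
    fix i n :: nat and f assume i: "1 \<le> i" "i \<le> n" "f \<in> elems Q n"
    then have n: "1 \<le> n" by simp
    obtain f' where "f = \<phi> n f'" "f' \<in> elems P n" using ex[OF i(3) n] by blast
    with i show "pcomp Q n 1 i f (unit Q) = f"
      using pcomp[of i n 1 f' "unit P"] P.unit_right[of i n f'] P.unit_closed unit by simp
  next
    fix i l j m n :: nat and f g h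
    assume i: "1 \<le> i" "i \<le> l" "1 \<le> j" "j \<le> m" "1 \<le> n"
      and Q: "f \<in> elems Q l" "g \<in> elems Q m" "h \<in> elems Q n"
    have lm: "1 \<le> l" "1 \<le> m" using i by auto
    obtain f' g' h' where
      fgh: "f = \<phi> l f'" "f' \<in> elems P l" "g = \<phi> m g'" "g' \<in> elems P m"
        "h = \<phi> n h'" "h' \<in> elems P n"
      using ex[OF Q(1) lm(1)] ex[OF Q(2) lm(2)] ex[OF Q(3) i(5)] by blast
    note closed = P.pcomp_closed[OF i(1,2) lm(2) fgh(2,4)] P.pcomp_closed[OF i(3,4,5) fgh(4,6)]
    have "pcomp Q (l + m - 1) n (i + j - 1) (pcomp Q l m i f g) h =
        \<phi> (l + m - 1 + n - 1) (pcomp P (l + m - 1) n (i + j - 1) (pcomp P l m i f' g') h')"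
      using i lm fgh closed by (simp add: comp)
    also have "\<dots> = \<phi> (l + (m + n - 1) - 1) (pcomp P l (m + n - 1) i f' (pcomp P m n j g' h'))"
    proof -
      have "l + m - 1 + n - 1 = l + (m + n - 1) - 1" using lm by simp
      then show ?thesis using P.assoc_sequential[of i l j m n f' g' h'] i fgh by simp
    qed
    also have "\<dots> = pcomp Q l (m + n - 1) i f (pcomp Q m n j g h)"
      using i lm fgh closed by (simp add: comp)
    finally show "pcomp Q (l + m - 1) n (i + j - 1) (pcomp Q l m i f g) h =
        pcomp Q l (m + n - 1) i f (pcomp Q m n j g h)" .
  next
    fix i k l m n :: nat and f g h
    assume i: "1 \<le> i" "i < k" "k \<le> l" "1 \<le> m" "1 \<le> n"
      and Q: "f \<in> elems Q l" "g \<in> elems Q m" "h \<in> elems Q n"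
    have lm: "1 \<le> l" using i by auto
    obtain f' g' h' where
      fgh: "f = \<phi> l f'" "f' \<in> elems P l" "g = \<phi> m g'" "g' \<in> elems P m"
        "h = \<phi> n h'" "h' \<in> elems P n"
      using ex[OF Q(1) lm(1)] ex[OF Q(2) i(4)] ex[OF Q(3) i(5)] by blast
    have k: "i \<le> l" "1 \<le> k" using i by auto
    note closed = P.pcomp_closed[OF i(1) k(1) i(4) fgh(2,4)] P.pcomp_closed[OF k(2) i(3,5) fgh(2,6)]
    have "pcomp Q (l + m - 1) n (k + m - 1) (pcomp Q l m i f g) h =
        \<phi> (l + m - 1 + n - 1) (pcomp P (l + m - 1) n (k + m - 1) (pcomp P l m i f' g') h')"
      using i lm fgh closed by (simp add: comp)
    also have "\<dots> = \<phi> (l + n - 1 + m - 1) (pcomp P (l + n - 1) m i (pcomp P l n k f' h') g')"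
    proof -
      have "l + m - 1 + n - 1 = l + n - 1 + m - 1" using lm i by simp
      then show ?thesis using P.assoc_parallel[of i k l m n f' g' h'] i fgh by simp
    qed
    also have "\<dots> = pcomp Q (l + n - 1) m i (pcomp Q l n k f h) g"
      using i lm fgh closed by (simp add: comp)
    finally show "pcomp Q (l + m - 1) n (k + m - 1) (pcomp Q l m i f g) h =
        pcomp Q (l + n - 1) m i (pcomp Q l n k f h) g" .
  qed
qed

lemma sym_operad_image:
  fixes P :: "('a, 'm) sym_operad_scheme" and Q :: "('b, 'n) sym_operad_scheme"
  assumes P: "sym_operad P"
    and lin: "\<And>n. 1 \<le> n \<Longrightarrow> linear_on (comps P n) (comps Q n) (\<phi> n)"
    and surj: "\<And>n. 1 \<le> n \<Longrightarrow> \<phi> n ` elems P n = elems Q n"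
    and zero: "\<And>n. 1 \<le> n \<Longrightarrow> \<phi> n \<zero>\<^bsub>comps P n\<^esub> = \<zero>\<^bsub>comps Q n\<^esub>"
    and unit: "\<phi> 1 (unit P) = unit Q"
    and pcomp: "\<And>m n i f g. \<lbrakk>1 \<le> i; i \<le> m; 1 \<le> n; f \<in> elems P m; g \<in> elems P n\<rbrakk> \<Longrightarrow>
      \<phi> (m + n - 1) (pcomp P m n i f g) = pcomp Q m n i (\<phi> m f) (\<phi> n g)"
    and sact: "\<And>n \<sigma> f. \<lbrakk>1 \<le> n; \<sigma> permutes {1..n}; f \<in> elems P n\<rbrakk> \<Longrightarrow>
      \<phi> n (sact P n \<sigma> f) = sact Q n \<sigma> (\<phi> n f)"
  shows "sym_operad_hom P Q \<phi>"
proof -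
  interpret P: sym_operad P by fact
  interpret Q: ns_operad Q
    by (rule ns_operad_image[where P = P and \<phi> = \<phi>]) (fact P.ns_operad_axioms lin surj zero unit pcomp)+
  have ex: "\<exists>f\<in>elems P n. u = \<phi> n f" if "u \<in> elems Q n" "1 \<le> n" for u n
    using that surj[of n] by blast
  note closed = linear_onD(1)[OF lin]
  have Q: "sym_operad Q"
  proof (rule sym_operad.intro[OF Q.ns_operad_axioms], rule sym_operad_axioms.intro)
    fix n :: nat and \<sigma> assume n: "1 \<le> n" and \<sigma>: "\<sigma> permutes {1..n}"
    note L = P.sact_linear[OF n \<sigma>]
    show "linear_on (comps Q n) (comps Q n) (sact Q n \<sigma>)"
    proof (rule linear_onI)
      fix x assume "x \<in> elems Q n"
      then obtain f where f: "x = \<phi> n f" "f \<in> elems P n" using ex n by blast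
      show "sact Q n \<sigma> x \<in> elems Q n"
        using closed[OF n linear_onD(1)[OF L f(2)]] f by (simp add: sact[OF n \<sigma>])
      show "sact Q n \<sigma> (c \<odot>\<^bsub>comps Q n\<^esub> x) = c \<odot>\<^bsub>comps Q n\<^esub> sact Q n \<sigma> x" for c
        using f linear_onD[OF lin[OF n]] linear_onD[OF L] P.comps_closed[OF n] sact[OF n \<sigma>]
        by metis
      fix y assume "y \<in> elems Q n"
      then obtain f' where f': "y = \<phi> n f'" "f' \<in> elems P n" using ex n by blast
      show "sact Q n \<sigma> (x \<oplus>\<^bsub>comps Q n\<^esub> y) = sact Q n \<sigma> x \<oplus>\<^bsub>comps Q n\<^esub> sact Q n \<sigma> y"
        using f f' linear_onD[OF lin[OF n]] linear_onD[OF L] P.comps_closed[OF n] sact[OF n \<sigma>]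
        by metis
    qed
  next
    fix n :: nat and f assume n: "1 \<le> n" and "f \<in> elems Q n"
    then obtain f' where f: "f = \<phi> n f'" "f' \<in> elems P n" using ex by blast
    show "sact Q n id f = f"
      using sact[OF n permutes_id f(2)] P.sact_id[OF n f(2)] f by simp
    fix \<sigma> \<pi> assume "\<sigma> permutes {1..n}" "\<pi> permutes {1..n}"
    then show "sact Q n (\<sigma> \<circ> \<pi>) f = sact Q n \<sigma> (sact Q n \<pi> f)"
      unfolding f using f(2) n P.sact_comp linear_onD(1)[OF P.sact_linear]
      by (metis permutes_compose sact)
  next
    fix i m n :: nat and \<sigma> \<pi> f g
    assume i: "1 \<le> i" "i \<le> m" "1 \<le> n" and p: "\<sigma> permutes {1..m}" "\<pi> permutes {1..n}"
      and Q: "f \<in> elems Q m" "g \<in> elems Q n"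
    have m: "1 \<le> m" "1 \<le> m + n - 1" using i by auto
    obtain f' g' where fg: "f = \<phi> m f'" "f' \<in> elems P m" "g = \<phi> n g'" "g' \<in> elems P n"
      using ex Q m i by blast
    note j = perm_inv_bounds[OF p(1) i(1,2)]
    have "pcomp Q m n i (sact Q m \<sigma> f) (sact Q n \<pi> g) =
        \<phi> (m + n - 1) (pcomp P m n i (sact P m \<sigma> f') (sact P n \<pi> g'))"
      using linear_onD(1)[OF P.sact_linear[OF m(1) p(1)] fg(2)]
        linear_onD(1)[OF P.sact_linear[OF i(3) p(2)] fg(4)]
        sact[OF m(1) p(1) fg(2)] sact[OF i(3) p(2) fg(4)] i fg
      by (simp add: pcomp del: One_nat_def)
    also have "\<dots> = \<phi> (m + n - 1) (sact P (m + n - 1) (perm_pcomp m n i \<sigma> \<pi>)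
        (pcomp P m n (perm_inv \<sigma> i) f' g'))"
      using P.equivariant i p fg by simp
    also have "\<dots> = sact Q (m + n - 1) (perm_pcomp m n i \<sigma> \<pi>) (pcomp Q m n (perm_inv \<sigma> i) f g)"
      using sact[OF m(2) perm_pcomp_permutes[OF i p] P.pcomp_closed[OF j i(3) fg(2,4)]]
        pcomp[OF j i(3) fg(2,4)] fg by simp
    finally show "pcomp Q m n i (sact Q m \<sigma> f) (sact Q n \<pi> g) =
      sact Q (m + n - 1) (perm_pcomp m n i \<sigma> \<pi>) (pcomp Q m n (perm_inv \<sigma> i) f g)" .
  qed
  show ?thesis
    by (intro sym_operad_hom.intro sym_operad_hom_axioms.intro P Q) (fact lin unit pcomp sact)+
qed

text \<open>Well-definedness of the operations on cosets: a bilinear composition changes by an element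
  of the ideal when either argument does.\<close>

lemma quot_ns_operad_ops:
  assumes P: "ns_operad P" and I: "ns_ideal P I"
  defines "Q \<equiv> quot_ns_operad P I" and "q \<equiv> quot_map P I"
  shows "1 \<le> n \<Longrightarrow> linear_on (comps P n) (comps Q n) (q n)"
    and "1 \<le> n \<Longrightarrow> q n ` elems P n = elems Q n"
    and "1 \<le> n \<Longrightarrow> q n \<zero>\<^bsub>comps P n\<^esub> = \<zero>\<^bsub>comps Q n\<^esub>"
    and "q 1 (unit P) = unit Q"
    and "\<lbrakk>1 \<le> i; i \<le> m; 1 \<le> n; f \<in> elems P m; g \<in> elems P n\<rbrakk> \<Longrightarrow>
      q (m + n - 1) (pcomp P m n i f g) = pcomp Q m n i (q m f) (q n g)"
    and "\<lbrakk>1 \<le> n; f \<in> elems P n; g \<in> elems P n\<rbrakk> \<Longrightarrow> q n f = q n g \<longleftrightarrow> f \<ominus>\<^bsub>comps P n\<^esub> g \<in> I n"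
    and "ns_operad Q"
proof -
  interpret P: ns_operad P by fact
  have sub: "submodule (I n) rat_field (comps P n)" if "1 \<le> n" for n
    using I that unfolding ns_ideal_def by blast
  have q: "q n = (\<lambda>f. I n +>\<^bsub>comps P n\<^esub> f)" for n
    by (simp add: q_def quot_map_def fun_eq_iff)
  have comps: "comps Q n = quot_module (comps P n) (I n)" for n
    by (simp add: Q_def quot_ns_operad_def)
  have qI: "q n f = q n g \<longleftrightarrow> f \<ominus>\<^bsub>comps P n\<^esub> g \<in> I n"
    if "1 \<le> n" "f \<in> elems P n" "g \<in> elems P n" for n f g
    using coset_eq_iff[OF P.vector_space sub, OF that(1,1) that(2,3)] by (simp add: q)
  show 1: "linear_on (comps P n) (comps Q n) (q n)" if "1 \<le> n" for n
    using quot_module_ops(2)[OF P.vector_space[OF that] sub[OF that]] by (simp add: q comps)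
  show 2: "q n ` elems P n = elems Q n" if "1 \<le> n" for n
    using quot_module_ops(1)[OF P.vector_space[OF that] sub[OF that]] by (simp add: q comps)
  show 3: "q n \<zero>\<^bsub>comps P n\<^esub> = \<zero>\<^bsub>comps Q n\<^esub>" if "1 \<le> n" for n
    using quot_module_ops(3)[OF P.vector_space[OF that] sub[OF that]] by (simp add: q comps)
  show 4: "q 1 (unit P) = unit Q"
    by (simp add: q_def Q_def quot_ns_operad_def)
  show 5: "q (m + n - 1) (pcomp P m n i f g) = pcomp Q m n i (q m f) (q n g)"
    if i: "1 \<le> i" "i \<le> m" and n: "1 \<le> n" and f: "f \<in> elems P m" and g: "g \<in> elems P n" for m n i f g
  proof -
    have m: "1 \<le> m" "1 \<le> m + n - 1" using i n by auto
    have ideal: "pcomp P m n i a b \<in> I (m + n - 1)"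
      if "a \<in> elems P m" "b \<in> elems P n" "a \<in> I m \<or> b \<in> I n" for a b
      using I i n that unfolding ns_ideal_def by blast
    have left: "q (m + n - 1) (pcomp P m n i a g) = q (m + n - 1) (pcomp P m n i f g)"
      if a: "a \<in> elems P m" "a \<ominus>\<^bsub>comps P m\<^esub> f \<in> I m" for a
      using ideal[OF P.comps_closed(3)[OF m(1) a(1) f] g] a(2)
        linear_on_minus[OF P.vector_space[OF m(1)] P.vector_space[OF m(2)]
          P.pcomp_linear_left[OF i n g] a(1) f]
      by (simp add: qI[OF m(2) P.pcomp_closed[OF i n a(1) g] P.pcomp_closed[OF i n f g]] del: One_nat_def)
    have right: "q (m + n - 1) (pcomp P m n i a b) = q (m + n - 1) (pcomp P m n i a g)"
      if a: "a \<in> elems P m" and b: "b \<in> elems P n" "b \<ominus>\<^bsub>comps P n\<^esub> g \<in> I n" for a b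
      using ideal[OF a P.comps_closed(3)[OF n b(1) g]] b(2)
        linear_on_minus[OF P.vector_space[OF n] P.vector_space[OF m(2)]
          P.pcomp_linear_right[OF i n a] b(1) g]
      by (simp add: qI[OF m(2) P.pcomp_closed[OF i n a b(1)] P.pcomp_closed[OF i n a g]] del: One_nat_def)
    have "pcomp Q m n i (q m f) (q n g) =
        (\<Union>a\<in>q m f. \<Union>b\<in>q n g. q (m + n - 1) (pcomp P m n i a b))"
      by (simp add: Q_def q_def quot_ns_operad_def)
    also have "\<dots> = (\<Union>a\<in>q m f. q (m + n - 1) (pcomp P m n i a g))"
    proof (rule SUP_cong[OF refl])
      fix a assume "a \<in> q m f"
      then have a: "a \<in> elems P m"
        using coset_memD(1)[OF P.vector_space[OF m(1)] sub[OF m(1)] f] by (simp add: q)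
      show "(\<Union>b\<in>q n g. q (m + n - 1) (pcomp P m n i a b)) = q (m + n - 1) (pcomp P m n i a g)"
        unfolding q[of n] by (rule UN_coset[OF P.vector_space[OF n] sub[OF n] g]) (rule right[OF a])
    qed
    also have "\<dots> = q (m + n - 1) (pcomp P m n i f g)"
      unfolding q[of m] by (rule UN_coset[OF P.vector_space[OF m(1)] sub[OF m(1)] f]) (rule left)
    finally show ?thesis ..
  qed
  show "q n f = q n g \<longleftrightarrow> f \<ominus>\<^bsub>comps P n\<^esub> g \<in> I n"
    if "1 \<le> n" "f \<in> elems P n" "g \<in> elems P n"
    using qI that by blast
  show "ns_operad Q"
    using ns_operad_image[OF P 1 2 3 4 5] .
qed

lemma quot_sym_operad_sel [simp]:
  "comps (quot_sym_operad P I) = comps (quot_ns_operad P I)"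
  "unit (quot_sym_operad P I) = unit (quot_ns_operad P I)"
  "pcomp (quot_sym_operad P I) = pcomp (quot_ns_operad P I)"
  "sact (quot_sym_operad P I) n \<sigma> U = (\<Union>f\<in>U. quot_map P I n (sact P n \<sigma> f))"
  by (simp_all add: quot_sym_operad_def ns_operad.defs)

lemma UN_quot_map:
  assumes P: "ns_operad P" and I: "ns_ideal P I" and n: "1 \<le> n"
    and h: "linear_on (comps P n) (comps P n) h" "\<And>f. f \<in> I n \<Longrightarrow> h f \<in> I n"
    and f: "f \<in> elems P n"
  shows "(\<Union>g\<in>quot_map P I n f. quot_map P I n (h g)) = quot_map P I n (h f)"
proof -
  interpret P: ns_operad P by fact
  have sub: "submodule (I n) rat_field (comps P n)"
    using I n unfolding ns_ideal_def by blast
  have "quot_map P I n (h g) = quot_map P I n (h f)"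
    if "g \<in> elems P n" "g \<ominus>\<^bsub>comps P n\<^esub> f \<in> I n" for g
    using h(2)[OF that(2)] linear_on_minus[OF P.vector_space[OF n] P.vector_space[OF n] h(1) that(1) f]
      quot_ns_operad_ops(6)[OF P I n linear_onD(1)[OF h(1) that(1)] linear_onD(1)[OF h(1) f]]
    by simp
  then show ?thesis
    unfolding quot_map_def[of P I n f] by (rule UN_coset[OF P.vector_space[OF n] sub f])
qed

lemma quot_sym_operad_hom:
  assumes P: "sym_operad P" and I: "sym_ideal P I"
  shows "sym_operad_hom P (quot_sym_operad P I) (quot_map P I)"
proof -
  interpret P: sym_operad P by fact
  have I': "ns_ideal P I" using I by (simp add: sym_ideal_def)
  note ops = quot_ns_operad_ops[OF P.ns_operad_axioms I']
  show ?thesis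
  proof (rule sym_operad_image[OF P], unfold quot_sym_operad_sel)
    fix n \<sigma> f assume n: "1 \<le> n" "\<sigma> permutes {1..n}" "f \<in> elems P n"
    then have "sact P n \<sigma> g \<in> I n" if "g \<in> I n" for g
      using I that by (simp add: sym_ideal_def)
    then show "quot_map P I n (sact P n \<sigma> f) =
        (\<Union>f\<in>quot_map P I n f. quot_map P I n (sact P n \<sigma> f))"
      using UN_quot_map[OF P.ns_operad_axioms I' n(1) P.sact_linear[OF n(1,2)] _ n(3)] by simp
  qed (fact ops)+
qed

section \<open>Long cycles\<close>

lemma long_cycle_permutes: "long_cycle n permutes {1..n + 1}"
proof (rule bij_imp_permutes)
  show "bij_betw (long_cycle n) {1..n + 1} {1..n + 1}"
    by (rule bij_betw_byWitness[where f' = "\<lambda>i. if i = n + 1 then 1 else i + 1"])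
      (auto simp: long_cycle_def)
qed (auto simp: long_cycle_def)

lemma permutes_funpow: "f permutes S \<Longrightarrow> (f ^^ k) permutes S"
  by (induction k) (auto intro: permutes_compose simp: permutes_id)

lemma long_cycle_pow:
  assumes "1 \<le> p" "p \<le> n + 1" "k \<le> n + 1"
  shows "(long_cycle n ^^ k) p = (if k < p then p - k else p + n + 1 - k)"
  using assms(3)
proof (induction k)
  case (Suc k)
  then show ?case using assms(1,2) by (auto simp: long_cycle_def)
qed (use assms in auto)

lemma long_cycle_pow_Suc: "long_cycle n ^^ (n + 1) = id"
proof
  fix p
  show "(long_cycle n ^^ (n + 1)) p = id p"
  proof (cases "1 \<le> p \<and> p \<le> n + 1")
    case True
    then show ?thesis using long_cycle_pow[of p n "n + 1"] by simp
  next
    case False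
    then show ?thesis
      using permutes_not_in[OF permutes_funpow[OF long_cycle_permutes], of p n "n + 1"] by simp
  qed
qed

lemma funpow_cong_order:
  assumes "\<And>x. x \<in> S \<Longrightarrow> (f ^^ N) x = x" "x \<in> S" "k mod N = l mod N"
  shows "(f ^^ k) x = (f ^^ l) x"
proof -
  have *: "(f ^^ (N * q)) x = x" for q
    using assms(1)[OF assms(2)] by (induction q) (simp_all add: funpow_add)
  have "(f ^^ k) x = (f ^^ (k mod N)) x" for k
    using *[of "k div N"] funpow_add[of "k mod N" "N * (k div N)" f] by simp
  then show ?thesis using assms(3) by metis
qed

lemma long_cycle_pow_last:
  "(long_cycle n ^^ k) (n + 1) = (long_cycle n ^^ l) (n + 1) \<longleftrightarrow> k mod (n + 1) = l mod (n + 1)"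
proof -
  have *: "(long_cycle n ^^ k) (n + 1) = n + 1 - k mod (n + 1)" for k
  proof -
    have "(long_cycle n ^^ k) (n + 1) = (long_cycle n ^^ (k mod (n + 1))) (n + 1)"
      by (rule funpow_cong_order[where S = UNIV and N = "n + 1"])
        (simp_all only: long_cycle_pow_Suc id_apply UNIV_I mod_mod_trivial)
    then show ?thesis
      using long_cycle_pow[of "n + 1" n "k mod (n + 1)"] mod_less_divisor[of "n + 1" k]
      by (simp add: less_imp_le)
  qed
  have "k mod (n + 1) < n + 1" "l mod (n + 1) < n + 1" by simp_all
  then show ?thesis unfolding * by linarith
qed

lemma permutes_fix_last:
  fixes n :: nat
  assumes "\<sigma> permutes {1..n + 1}" "\<sigma> (n + 1) = n + 1"
  shows "\<sigma> permutes {1..n}"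
  by (rule permutes_superset[OF assms(1)]) (use assms(2) in \<open>auto simp: le_Suc_eq\<close>)

lemma permutes_Suc: "\<sigma> permutes {1..n :: nat} \<Longrightarrow> \<sigma> permutes {1..n + 1}"
  by (rule permutes_subset) auto

lemma permutes_last: "\<sigma> permutes {1..n :: nat} \<Longrightarrow> \<sigma> (n + 1) = n + 1"
  by (rule permutes_not_in) auto

text \<open>The stabilizer of \<open>n + 1\<close> and the powers of the long cycle together make up the
  symmetric group.\<close>

lemma permutes_long_cycle_decomp:
  assumes "\<sigma> permutes {1..n + 1}"
  obtains \<rho> k where "\<rho> permutes {1..n}" "\<sigma> = \<rho> \<circ> (long_cycle n ^^ k)"
proof -
  define y where "y = perm_inv \<sigma> (n + 1)"
  have y: "1 \<le> y" "y \<le> n + 1" using perm_inv_bounds[OF assms, of "n + 1"] by (simp_all add: y_def)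
  define c where "c = long_cycle n ^^ y"
  have c: "c permutes {1..n + 1}"
    unfolding c_def by (rule permutes_funpow[OF long_cycle_permutes])
  have "c y = n + 1" using long_cycle_pow[OF y y(2)] by (simp add: c_def)
  then have "perm_inv c (n + 1) = y" using permutes_inv_eq[OF c] by blast
  then have "(\<sigma> \<circ> perm_inv c) (n + 1) = n + 1" using permutes_inverses[OF assms] by (simp add: y_def)
  then have "\<sigma> \<circ> perm_inv c permutes {1..n}"
    by (rule permutes_fix_last[OF permutes_compose[OF permutes_inv[OF c] assms]])
  moreover have "\<sigma> = \<sigma> \<circ> perm_inv c \<circ> c" using permutes_inverses[OF c] by (simp add: fun_eq_iff)
  ultimately show thesis using that unfolding c_def by blast
qed

text \<open>The permutation \<open>\<rho>\<close> in \<open>c \<sigma> = \<rho> c\<^sup>k\<close>, where \<open>c\<close> is the long cycle and \<open>k = \<sigma>\<inverse>(1)\<close>: reading the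
  letters \<open>\<sigma>(1), \<dots>, \<sigma>(n), n + 1\<close> on a circle, \<open>\<rho>\<close> arises by decreasing every letter by one and
  starting to read after the new letter \<open>n + 1\<close>.\<close>

definition rotate_perm :: "nat \<Rightarrow> (nat \<Rightarrow> nat) \<Rightarrow> (nat \<Rightarrow> nat)"
  where "rotate_perm n \<sigma> = long_cycle n \<circ> \<sigma> \<circ> perm_inv (long_cycle n ^^ perm_inv \<sigma> 1)"

lemma rotate_perm:
  assumes "\<sigma> permutes {1..n}" "1 \<le> n"
  shows "long_cycle n \<circ> \<sigma> = rotate_perm n \<sigma> \<circ> (long_cycle n ^^ perm_inv \<sigma> 1)"
    and "rotate_perm n \<sigma> permutes {1..n}"
proof -
  let ?k = "perm_inv \<sigma> 1"
  let ?c = "long_cycle n ^^ ?k"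
  note k = perm_inv_bounds[OF assms(1) order_refl assms(2)]
  have c: "?c permutes {1..n + 1}"
    by (rule permutes_funpow[OF long_cycle_permutes])
  show "long_cycle n \<circ> \<sigma> = rotate_perm n \<sigma> \<circ> ?c"
    using permutes_inverses[OF c] by (simp add: rotate_perm_def fun_eq_iff)
  have "?c ?k = n + 1" using long_cycle_pow[of ?k n ?k] k by simp
  then have "perm_inv ?c (n + 1) = ?k" using permutes_inv_eq[OF c] by blast
  then have "rotate_perm n \<sigma> (n + 1) = n + 1"
    using permutes_inverses[OF assms(1)] by (simp add: rotate_perm_def long_cycle_def)
  moreover have "rotate_perm n \<sigma> permutes {1..n + 1}"
    unfolding rotate_perm_def
    by (intro permutes_compose permutes_inv c long_cycle_permutes permutes_Suc assms(1))
  ultimately show "rotate_perm n \<sigma> permutes {1..n}" by (rule permutes_fix_last[rotated])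
qed

lemma rotate_perm_apply:
  assumes "\<sigma> permutes {1..n}" "1 \<le> n"
  shows "rotate_perm n \<sigma> ((long_cycle n ^^ perm_inv \<sigma> 1) x) = long_cycle n (\<sigma> x)"
  using rotate_perm(1)[OF assms] by (metis comp_apply)

lemma rotate_perm_inv:
  assumes "\<sigma> permutes {1..n}" "1 \<le> n"
  shows "perm_inv (rotate_perm n \<sigma>) (long_cycle n y) = (long_cycle n ^^ perm_inv \<sigma> 1) (perm_inv \<sigma> y)"
  using rotate_perm_apply[OF assms, of "perm_inv \<sigma> y"] permutes_inverses[OF assms(1)]
    permutes_inv_eq[OF rotate_perm(2)[OF assms]] by simp

lemma rotate_perm_surj:
  assumes "\<rho> permutes {1..n}" "1 \<le> n"
  obtains \<sigma> where "\<sigma> permutes {1..n}" "\<rho> = rotate_perm n \<sigma>"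
proof -
  define y where "y = perm_inv \<rho> n"
  have y: "1 \<le> y" "y \<le> n" using perm_inv_bounds[OF assms(1), of n] assms(2) by (simp_all add: y_def)
  define k where "k = n + 1 - y"
  let ?c = "long_cycle n"
  define \<sigma> where "\<sigma> = perm_inv ?c \<circ> \<rho> \<circ> (?c ^^ k)"
  have ck: "(?c ^^ k) permutes {1..n + 1}" by (rule permutes_funpow[OF long_cycle_permutes])
  have "?c (n + 1) = n" using assms(2) by (simp add: long_cycle_def)
  then have inv_n: "perm_inv ?c n = n + 1" using permutes_inv_eq[OF long_cycle_permutes] by blast
  have "(?c ^^ k) (n + 1) = y" using long_cycle_pow[of "n + 1" n k] y by (simp add: k_def)
  then have "\<sigma> (n + 1) = n + 1"
    using inv_n permutes_inverses[OF assms(1)] by (simp add: \<sigma>_def y_def)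
  moreover have "\<sigma> permutes {1..n + 1}"
    unfolding \<sigma>_def
    by (intro permutes_compose ck permutes_inv long_cycle_permutes permutes_Suc[OF assms(1)])
  ultimately have \<sigma>: "\<sigma> permutes {1..n}" by (rule permutes_fix_last[rotated])
  have k: "1 \<le> k" "k \<le> n" using y by (simp_all add: k_def)
  have "(?c ^^ k) k = n + 1" using long_cycle_pow[of k n k] k by simp
  moreover have "perm_inv ?c (n + 1) = 1"
    using permutes_inv_eq[OF long_cycle_permutes, of n "n + 1" 1] by (simp add: long_cycle_def)
  ultimately have "\<sigma> k = 1"
    using permutes_last[OF assms(1)] by (simp add: \<sigma>_def)
  then have "perm_inv \<sigma> 1 = k" using permutes_inv_eq[OF \<sigma>] by blast
  then have "rotate_perm n \<sigma> = ?c \<circ> perm_inv ?c \<circ> \<rho> \<circ> ((?c ^^ k) \<circ> perm_inv (?c ^^ k))"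
    by (simp add: rotate_perm_def \<sigma>_def comp_assoc)
  then have "\<rho> = rotate_perm n \<sigma>"
    using permutes_inv_o(1)[OF long_cycle_permutes] permutes_inv_o(1)[OF ck] by simp
  with \<sigma> that show thesis by blast
qed

lemma permutes_ext_pos:
  assumes j: "1 \<le> j" "j \<le> m" "1 \<le> n"
    and fg: "f permutes {1..m + n}" "g permutes {1..m + n}"
    and outer: "\<And>a. \<lbrakk>1 \<le> a; a \<le> m + 1; a \<noteq> j\<rbrakk> \<Longrightarrow> f (outer_pos n j a) = g (outer_pos n j a)"
    and inner: "\<And>b. \<lbrakk>1 \<le> b; b \<le> n\<rbrakk> \<Longrightarrow> f (inner_pos j b) = g (inner_pos j b)"
  shows "f = g"
proof
  fix p
  show "f p = g p"
  proof (cases "p \<in> {1..m + n}")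
    case True
    then have p: "1 \<le> p" "p \<le> m + 1 + n - 1" by auto
    have "j \<le> m + 1" using j by simp
    then show ?thesis
      by (cases rule: pos_cases[OF j(1) _ j(3) p]) (use outer inner in auto)
  qed (use permutes_not_in[OF fg(1)] permutes_not_in[OF fg(2)] in simp)
qed

text \<open>Away from the first input the long cycle lowers the place of insertion by one. A composition at
  the first input is turned inside out: what was outer becomes inner.\<close>

lemma long_cycle_pos:
  assumes "1 \<le> m" "1 \<le> n"
  shows "\<lbrakk>2 \<le> i; i \<le> m; 1 \<le> v; v \<le> m + 1; v \<noteq> i\<rbrakk> \<Longrightarrow>
      long_cycle (m + n - 1) (outer_pos n i v) = outer_pos n (i - 1) (long_cycle m v)"
    and "\<lbrakk>2 \<le> i; i \<le> m; 1 \<le> b; b \<le> n\<rbrakk> \<Longrightarrow>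
      long_cycle (m + n - 1) (inner_pos i b) = inner_pos (i - 1) b"
    and "\<lbrakk>2 \<le> v; v \<le> m + 1\<rbrakk> \<Longrightarrow>
      long_cycle (m + n - 1) (outer_pos n 1 v) = inner_pos n (long_cycle m v)"
    and "\<lbrakk>1 \<le> b; b \<le> n\<rbrakk> \<Longrightarrow>
      long_cycle (m + n - 1) (inner_pos 1 b) = outer_pos m n (long_cycle n b)"
  using assms by (auto simp: long_cycle_def pos_defs)

lemma long_cycle_pow_pos:
  assumes "1 \<le> a" "a \<le> m" "1 \<le> k" "k \<le> m" "k \<noteq> a" "1 \<le> n"
  shows "\<lbrakk>1 \<le> x; x \<le> m + 1; x \<noteq> a\<rbrakk> \<Longrightarrow>
      (long_cycle (m + n - 1) ^^ outer_pos n a k) (outer_pos n a x) =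
      outer_pos n ((long_cycle m ^^ k) a) ((long_cycle m ^^ k) x)"
    and "\<lbrakk>1 \<le> b; b \<le> n\<rbrakk> \<Longrightarrow>
      (long_cycle (m + n - 1) ^^ outer_pos n a k) (inner_pos a b) =
      inner_pos ((long_cycle m ^^ k) a) b"
proof -
  have k: "outer_pos n a k \<le> m + n - 1 + 1" using assms by (auto simp: pos_defs)
  have ca: "(long_cycle m ^^ k) a = (if k < a then a - k else a + m + 1 - k)"
    by (rule long_cycle_pow) (use assms in auto)
  {
    assume x: "1 \<le> x" "x \<le> m + 1" "x \<noteq> a"
    have cx: "(long_cycle m ^^ k) x = (if k < x then x - k else x + m + 1 - k)"
      by (rule long_cycle_pow) (use assms x in auto)
    have "1 \<le> outer_pos n a x" "outer_pos n a x \<le> m + n - 1 + 1"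
      using assms x by (auto simp: pos_defs)
    note C = long_cycle_pow[OF this k]
    show "(long_cycle (m + n - 1) ^^ outer_pos n a k) (outer_pos n a x) =
        outer_pos n ((long_cycle m ^^ k) a) ((long_cycle m ^^ k) x)"
      unfolding C unfolding ca cx pos_defs
      using assms x by (cases "k < a"; cases "k < x"; cases "x < a"; simp; (intro conjI impI)?; simp?; linarith?)
  next
    assume b: "1 \<le> b" "b \<le> n"
    have "1 \<le> inner_pos a b" "inner_pos a b \<le> m + n - 1 + 1"
      using assms b by (auto simp: pos_defs)
    note C = long_cycle_pow[OF this k]
    show "(long_cycle (m + n - 1) ^^ outer_pos n a k) (inner_pos a b) =
        inner_pos ((long_cycle m ^^ k) a) b"
      unfolding C unfolding ca pos_defs
      using assms b by (cases "k < a"; simp; (intro conjI impI)?; simp?; linarith?)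
  }
qed

lemma long_cycle_pow_pos_first:
  assumes "1 \<le> a" "a \<le> m" "1 \<le> b" "b \<le> n"
  shows "\<lbrakk>1 \<le> x; x \<le> m + 1; x \<noteq> a\<rbrakk> \<Longrightarrow>
      (long_cycle (m + n - 1) ^^ inner_pos a b) (outer_pos n a x) =
      inner_pos (n + 1 - b) ((long_cycle m ^^ a) x)"
    and "\<lbrakk>1 \<le> y; y \<le> n\<rbrakk> \<Longrightarrow>
      (long_cycle (m + n - 1) ^^ inner_pos a b) (inner_pos a y) =
      outer_pos m (n + 1 - b) ((long_cycle n ^^ b) y)"
proof -
  have t: "inner_pos a b \<le> m + n - 1 + 1" using assms by (simp add: pos_defs)
  {
    assume x: "1 \<le> x" "x \<le> m + 1" "x \<noteq> a"
    have cx: "(long_cycle m ^^ a) x = (if a < x then x - a else x + m + 1 - a)"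
      by (rule long_cycle_pow) (use assms x in auto)
    have "1 \<le> outer_pos n a x" "outer_pos n a x \<le> m + n - 1 + 1"
      using assms x by (auto simp: pos_defs)
    note C = long_cycle_pow[OF this t]
    show "(long_cycle (m + n - 1) ^^ inner_pos a b) (outer_pos n a x) =
        inner_pos (n + 1 - b) ((long_cycle m ^^ a) x)"
      unfolding C unfolding cx pos_defs
      using assms x by (cases "x < a"; simp; (intro conjI impI)?; simp?; linarith?)
  next
    assume y: "1 \<le> y" "y \<le> n"
    have cy: "(long_cycle n ^^ b) y = (if b < y then y - b else y + n + 1 - b)"
      by (rule long_cycle_pow) (use assms y in auto)
    have "1 \<le> inner_pos a y" "inner_pos a y \<le> m + n - 1 + 1"
      using assms y by (auto simp: pos_defs)
    note C = long_cycle_pow[OF this t]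
    show "(long_cycle (m + n - 1) ^^ inner_pos a b) (inner_pos a y) =
        outer_pos m (n + 1 - b) ((long_cycle n ^^ b) y)"
      unfolding C unfolding cy pos_defs
      using assms y by (cases "b < y"; simp; (intro conjI impI)?; simp?; linarith?)
  }
qed

text \<open>On circular words: if the letter 1 of \<open>\<sigma>\<close> is not the letter that \<open>\<pi>\<close> replaces, the rotated
  composite is the rotation of \<open>\<sigma>\<close> with \<open>\<pi>\<close> inserted. If it is, the circle is cut open inside the
  inserted word, so that the rotation of \<open>\<sigma>\<close> appears as inserted into the rotation of \<open>\<pi>\<close>.\<close>

lemma long_cycle_perm_pcomp:
  assumes i: "2 \<le> i" "i \<le> m" "1 \<le> n" and p: "\<sigma> permutes {1..m}" "\<pi> permutes {1..n}"
  shows "long_cycle (m + n - 1) \<circ> perm_pcomp m n i \<sigma> \<pi> =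
    perm_pcomp m n (i - 1) (rotate_perm m \<sigma>) \<pi> \<circ>
      (long_cycle (m + n - 1) ^^ perm_inv (perm_pcomp m n i \<sigma> \<pi>) 1)"
proof -
  have i': "1 \<le> i" "1 \<le> m" "1 \<le> i - 1" "i - 1 \<le> m" using i by auto
  let ?a = "perm_inv \<sigma> i" and ?k = "perm_inv \<sigma> 1" and ?C = "long_cycle (m + n - 1)"
  let ?a' = "(long_cycle m ^^ ?k) ?a"
  note a = perm_inv_bounds[OF p(1) i'(1) i(2)] and k = perm_inv_bounds[OF p(1) order_refl i'(2)]
  have ka: "?k \<noteq> ?a" using i injD[OF permutes_inj[OF permutes_inv[OF p(1)]], of 1 i] by auto
  note \<rho> = rotate_perm(2)[OF p(1) i'(2)]
  have 1: "perm_inv (perm_pcomp m n i \<sigma> \<pi>) 1 = outer_pos n ?a ?k"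
    using perm_pcomp_inv_outer[OF i'(1) i(2,3) order_refl i'(2) _ p] i by (simp add: outer_pos_def)
  have a': "perm_inv (rotate_perm m \<sigma>) (i - 1) = ?a'"
    using rotate_perm_inv[OF p(1) i'(2), of i] i by (simp add: long_cycle_def)
  have N: "m + n - 1 + 1 = m + n" using i by simp
  show ?thesis
    unfolding 1
  proof (rule permutes_ext_pos[OF a i(3)])
    show "?C \<circ> perm_pcomp m n i \<sigma> \<pi> permutes {1..m + n}"
      using permutes_compose[OF permutes_Suc[OF perm_pcomp_permutes[OF i'(1) i(2,3) p]] long_cycle_permutes]
      by (simp only: N)
    show "perm_pcomp m n (i - 1) (rotate_perm m \<sigma>) \<pi> \<circ> (?C ^^ outer_pos n ?a ?k) permutes {1..m + n}"
      using permutes_compose[OF permutes_funpow[OF long_cycle_permutes]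
          permutes_Suc[OF perm_pcomp_permutes[OF i'(3,4) i(3) \<rho> p(2)]]]
      by (simp only: N)
  next
    fix x assume x: "1 \<le> x" "x \<le> m + 1" "x \<noteq> ?a"
    have \<sigma>x: "\<sigma> x \<noteq> i" using permutes_neq_iff[OF p(1)] x by blast
    note \<sigma>x' = permutes_nat_bounds[OF permutes_Suc[OF p(1)] x(1,2)]
    have cx: "(long_cycle m ^^ ?k) x \<noteq> ?a'"
      using x(3) injD[OF permutes_inj[OF permutes_funpow[OF long_cycle_permutes]], of ?k m x ?a] by blast
    note cx' = permutes_nat_bounds[OF permutes_funpow[OF long_cycle_permutes] x(1,2)]
    show "(?C \<circ> perm_pcomp m n i \<sigma> \<pi>) (outer_pos n ?a x) =
      (perm_pcomp m n (i - 1) (rotate_perm m \<sigma>) \<pi> \<circ> (?C ^^ outer_pos n ?a ?k)) (outer_pos n ?a x)"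
      using perm_pcomp_outer[OF p(1) i'(1) i(2,3) x] long_cycle_pos(1)[OF i'(2) i(3,1,2) \<sigma>x' \<sigma>x]
        long_cycle_pow_pos(1)[OF a k ka i(3) x]
        perm_pcomp_outer[OF \<rho> i'(3,4) i(3) cx', unfolded a', OF cx]
        rotate_perm_apply[OF p(1) i'(2), of x]
      by simp
  next
    fix b assume b: "1 \<le> b" "b \<le> n"
    show "(?C \<circ> perm_pcomp m n i \<sigma> \<pi>) (inner_pos ?a b) =
      (perm_pcomp m n (i - 1) (rotate_perm m \<sigma>) \<pi> \<circ> (?C ^^ outer_pos n ?a ?k)) (inner_pos ?a b)"
      using perm_pcomp_inner[OF p(1) i'(1) i(2) b] long_cycle_pow_pos(2)[OF a k ka i(3) b]
        long_cycle_pos(2)[OF i'(2) i(3,1,2) permutes_nat_bounds[OF p(2) b]]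
        perm_pcomp_inner[OF \<rho> i'(3,4) b, unfolded a']
      by simp
  qed
qed

lemma long_cycle_perm_pcomp_first:
  assumes m: "1 \<le> m" "1 \<le> n" and p: "\<sigma> permutes {1..m}" "\<pi> permutes {1..n}"
  shows "long_cycle (m + n - 1) \<circ> perm_pcomp m n 1 \<sigma> \<pi> =
    perm_pcomp n m n (rotate_perm n \<pi>) (rotate_perm m \<sigma>) \<circ>
      (long_cycle (m + n - 1) ^^ perm_inv (perm_pcomp m n 1 \<sigma> \<pi>) 1)"
proof -
  let ?a = "perm_inv \<sigma> 1" and ?b = "perm_inv \<pi> 1" and ?C = "long_cycle (m + n - 1)"
  note a = perm_inv_bounds[OF p(1) order_refl m(1)] and b = perm_inv_bounds[OF p(2) order_refl m(2)]
  note \<rho> = rotate_perm(2)[OF p(1) m(1)] and \<rho>' = rotate_perm(2)[OF p(2) m(2)]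
  have 1: "perm_inv (perm_pcomp m n 1 \<sigma> \<pi>) 1 = inner_pos ?a ?b"
    using perm_pcomp_inv_inner[OF order_refl m(1) order_refl m(2) p] by (simp add: inner_pos_def)
  have "long_cycle n (n + 1) = n" using m by (simp add: long_cycle_def)
  moreover have "perm_inv \<pi> (n + 1) = n + 1"
    using permutes_inv_eq[OF p(2)] permutes_last[OF p(2)] by blast
  ultimately have b': "perm_inv (rotate_perm n \<pi>) n = n + 1 - ?b"
    using rotate_perm_inv[OF p(2) m(2), of "n + 1"] long_cycle_pow[of "n + 1" n ?b] b by simp
  have N: "m + n - 1 + 1 = m + n" "n + m = m + n" using m by simp_all
  show ?thesis
    unfolding 1
  proof (rule permutes_ext_pos[OF a m(2)])
    show "?C \<circ> perm_pcomp m n 1 \<sigma> \<pi> permutes {1..m + n}"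
      using permutes_compose[OF permutes_Suc[OF perm_pcomp_permutes[OF order_refl m p]] long_cycle_permutes]
      by (simp only: N)
    show "perm_pcomp n m n (rotate_perm n \<pi>) (rotate_perm m \<sigma>) \<circ> (?C ^^ inner_pos ?a ?b) permutes {1..m + n}"
      using permutes_compose[OF permutes_funpow[OF long_cycle_permutes]
          permutes_Suc[OF perm_pcomp_permutes[OF m(2) order_refl m(1) \<rho>' \<rho>]]]
      by (simp only: N)
  next
    fix x assume x: "1 \<le> x" "x \<le> m + 1" "x \<noteq> ?a"
    have "\<sigma> x \<noteq> 1" using permutes_neq_iff[OF p(1)] x by blast
    then have \<sigma>x: "2 \<le> \<sigma> x" "\<sigma> x \<le> m + 1"
      using permutes_nat_bounds[OF permutes_Suc[OF p(1)] x(1,2)] by auto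
    have cx: "1 \<le> (long_cycle m ^^ ?a) x" "(long_cycle m ^^ ?a) x \<le> m"
      using long_cycle_pow[of x m ?a] x a by auto
    show "(?C \<circ> perm_pcomp m n 1 \<sigma> \<pi>) (outer_pos n ?a x) =
      (perm_pcomp n m n (rotate_perm n \<pi>) (rotate_perm m \<sigma>) \<circ> (?C ^^ inner_pos ?a ?b)) (outer_pos n ?a x)"
      using perm_pcomp_outer[OF p(1) order_refl m x] long_cycle_pos(3)[OF m \<sigma>x]
        long_cycle_pow_pos_first(1)[OF a b x] rotate_perm_apply[OF p(1) m(1), of x]
        perm_pcomp_inner[OF \<rho>' m(2) order_refl cx, unfolded b']
      by simp
  next
    fix y assume y: "1 \<le> y" "y \<le> n"
    have cy: "1 \<le> (long_cycle n ^^ ?b) y" "(long_cycle n ^^ ?b) y \<le> n + 1"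
        "(long_cycle n ^^ ?b) y \<noteq> n + 1 - ?b"
      using long_cycle_pow[of y n ?b] y b by auto
    show "(?C \<circ> perm_pcomp m n 1 \<sigma> \<pi>) (inner_pos ?a y) =
      (perm_pcomp n m n (rotate_perm n \<pi>) (rotate_perm m \<sigma>) \<circ> (?C ^^ inner_pos ?a ?b)) (inner_pos ?a y)"
      using perm_pcomp_inner[OF p(1) order_refl m(1) y] long_cycle_pos(4)[OF m permutes_nat_bounds[OF p(2) y]]
        long_cycle_pow_pos_first(2)[OF a b y] rotate_perm_apply[OF p(2) m(2), of y]
        perm_pcomp_outer[OF \<rho>' m(2) order_refl m(1) cy(1,2), unfolded b', OF cy(3)]
      by simp
  qed
qed

lemma rotate_perm_pcomp:
  assumes i: "2 \<le> i" "i \<le> m" "1 \<le> n" and p: "\<sigma> permutes {1..m}" "\<pi> permutes {1..n}"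
  shows "rotate_perm (m + n - 1) (perm_pcomp m n i \<sigma> \<pi>) = perm_pcomp m n (i - 1) (rotate_perm m \<sigma>) \<pi>"
proof -
  let ?c = "long_cycle (m + n - 1) ^^ perm_inv (perm_pcomp m n i \<sigma> \<pi>) 1"
  have i': "1 \<le> i" "1 \<le> m + n - 1" using i by auto
  note \<sigma>\<pi> = perm_pcomp_permutes[OF i'(1) i(2,3) p]
  have "rotate_perm (m + n - 1) (perm_pcomp m n i \<sigma> \<pi>) \<circ> ?c =
      perm_pcomp m n (i - 1) (rotate_perm m \<sigma>) \<pi> \<circ> ?c"
    using rotate_perm(1)[OF \<sigma>\<pi> i'(2)] long_cycle_perm_pcomp[OF i p] by simp
  then show ?thesis
    by (intro surj_fun_eq[OF permutes_surj[OF permutes_funpow[OF long_cycle_permutes]]] ballI)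
      (rule fun_cong)
qed

lemma rotate_perm_pcomp_first:
  assumes m: "1 \<le> m" "1 \<le> n" and p: "\<sigma> permutes {1..m}" "\<pi> permutes {1..n}"
  shows "rotate_perm (m + n - 1) (perm_pcomp m n 1 \<sigma> \<pi>) =
    perm_pcomp n m n (rotate_perm n \<pi>) (rotate_perm m \<sigma>)"
proof -
  let ?c = "long_cycle (m + n - 1) ^^ perm_inv (perm_pcomp m n 1 \<sigma> \<pi>) 1"
  have N: "1 \<le> m + n - 1" using m by simp
  note \<sigma>\<pi> = perm_pcomp_permutes[OF order_refl m p]
  have "rotate_perm (m + n - 1) (perm_pcomp m n 1 \<sigma> \<pi>) \<circ> ?c =
      perm_pcomp n m n (rotate_perm n \<pi>) (rotate_perm m \<sigma>) \<circ> ?c"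
    using rotate_perm(1)[OF \<sigma>\<pi> N] long_cycle_perm_pcomp_first[OF m p] by simp
  then show ?thesis
    by (intro surj_fun_eq[OF permutes_surj[OF permutes_funpow[OF long_cycle_permutes]]] ballI)
      (rule fun_cong)
qed

section \<open>Quotients of anticyclic operads\<close>

lemma (in anticyclic_operad) cact_id: "\<lbrakk>1 \<le> n; f \<in> elems P n\<rbrakk> \<Longrightarrow> A n id f = f"
  using cact_extends[OF _ permutes_id] sact_id by simp

text \<open>A stable ideal lets the action descend to cosets, and the relations of an anticyclic operad
  descend with it. No other action is possible, because the quotient map is onto.\<close>

lemma anticyclic_quotient:
  assumes P: "anticyclic_operad P A" and I: "sym_ideal P I"
    and stable: "\<And>n \<sigma> f. \<lbrakk>1 \<le> n; \<sigma> permutes {1..n + 1}; f \<in> I n\<rbrakk> \<Longrightarrow> A n \<sigma> f \<in> I n"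
  shows "\<exists>!B. anticyclic_operad (quot_sym_operad P I) B \<and>
    anticyclic_operad_hom P A (quot_sym_operad P I) B (quot_map P I)"
proof -
  define Q where "Q = quot_sym_operad P I"
  define q where "q = quot_map P I"
  interpret P: anticyclic_operad P A by fact
  interpret hom: sym_operad_hom P Q q
    unfolding Q_def q_def by (rule quot_sym_operad_hom[OF P.sym_operad_axioms I])
  have I': "ns_ideal P I" using I by (simp add: sym_ideal_def)
  have surj: "q n ` elems P n = elems Q n" if "1 \<le> n" for n
    using quot_ns_operad_ops(2)[OF P.ns_operad_axioms I' that] by (simp add: Q_def q_def)
  have ex: "\<exists>f\<in>elems P n. U = q n f" if "U \<in> elems Q n" "1 \<le> n" for U n
    using that surj[of n] by blast
  have q_closed: "q n f \<in> elems Q n" if "1 \<le> n" "f \<in> elems P n" for n f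
    using linear_onD(1)[OF hom.hom_linear] that by blast
  have A_closed: "A n \<sigma> f \<in> elems P n" if "1 \<le> n" "\<sigma> permutes {1..n + 1}" "f \<in> elems P n" for n \<sigma> f
    using linear_onD(1)[OF P.cact_linear] that by blast
  define B where "B = (\<lambda>n\<in>{1..}. \<lambda>\<sigma>\<in>{\<sigma>. \<sigma> permutes {1..n + 1}}. \<lambda>U\<in>elems Q n. \<Union>f\<in>U. q n (A n \<sigma> f))"
  have B: "B n \<sigma> (q n f) = q n (A n \<sigma> f)" if n: "1 \<le> n" "\<sigma> permutes {1..n + 1}" "f \<in> elems P n" for n \<sigma> f
  proof -
    have "B n \<sigma> (q n f) = (\<Union>g\<in>q n f. q n (A n \<sigma> g))"
      using n q_closed by (simp add: B_def)
    also have "\<dots> = q n (A n \<sigma> f)"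
      unfolding q_def
      by (rule UN_quot_map[OF P.ns_operad_axioms I' n(1) P.cact_linear[OF n(1,2)] stable[OF n(1,2)] n(3)])
    finally show ?thesis .
  qed
  have q_uminus: "q n (\<ominus>\<^bsub>comps P n\<^esub> f) = \<ominus>\<^bsub>comps Q n\<^esub> q n f" if "1 \<le> n" "f \<in> elems P n" for n f
    using linear_on_uminus[OF P.vector_space hom.Q.vector_space hom.hom_linear] that by blast
  have anticyclic: "anticyclic_operad Q B"
  proof (rule anticyclic_operad.intro[OF hom.Q.sym_operad_axioms], rule anticyclic_operad_axioms.intro)
    have "B n \<sigma> U \<in> elems Q n" if n: "1 \<le> n" and \<sigma>: "\<sigma> permutes {1..n + 1}" and U: "U \<in> elems Q n" for n \<sigma> U
    proof -
      obtain f where "f \<in> elems P n" "U = q n f" using ex[OF U n] by blast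
      then show ?thesis using B[OF n \<sigma>] q_closed[OF n] A_closed[OF n \<sigma>] by simp
    qed
    then show "B \<in> (\<Pi>\<^sub>E n\<in>{1..}. \<Pi>\<^sub>E \<sigma>\<in>{\<sigma>. \<sigma> permutes {1..n + 1}}. elems Q n \<rightarrow>\<^sub>E elems Q n)"
      by (intro PiE_I) (simp_all add: B_def)
  next
    fix n :: nat and \<sigma> assume n: "1 \<le> n" and \<sigma>: "\<sigma> permutes {1..n + 1}"
    note L = linear_onD[OF hom.hom_linear[OF n]] and LA = linear_onD[OF P.cact_linear[OF n \<sigma>]]
    show "linear_on (comps Q n) (comps Q n) (B n \<sigma>)"
    proof (rule linear_onI)
      fix U assume "U \<in> elems Q n"
      then obtain f where f: "f \<in> elems P n" "U = q n f" using ex n by blast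
      show "B n \<sigma> U \<in> elems Q n" using f B[OF n \<sigma>] q_closed[OF n] A_closed[OF n \<sigma>] by simp
      show "B n \<sigma> (c \<odot>\<^bsub>comps Q n\<^esub> U) = c \<odot>\<^bsub>comps Q n\<^esub> B n \<sigma> U" for c
        using f B[OF n \<sigma>] L(3) LA P.comps_closed(5)[OF n] by metis
      fix V assume "V \<in> elems Q n"
      then obtain g where g: "g \<in> elems P n" "V = q n g" using ex n by blast
      show "B n \<sigma> (U \<oplus>\<^bsub>comps Q n\<^esub> V) = B n \<sigma> U \<oplus>\<^bsub>comps Q n\<^esub> B n \<sigma> V"
        using f g B[OF n \<sigma>] L(2) LA P.comps_closed(4)[OF n] by metis
    qed
    fix U assume "U \<in> elems Q n"
    then obtain f where f: "f \<in> elems P n" "U = q n f" using ex n by blast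
    show "B n (\<sigma> \<circ> \<pi>) U = B n \<sigma> (B n \<pi> U)" if \<pi>: "\<pi> permutes {1..n + 1}" for \<pi>
      using f B[OF n] \<sigma> \<pi> permutes_compose[OF \<pi> \<sigma>] P.cact_comp[OF n \<sigma> \<pi>] A_closed[OF n \<pi>] by simp
  next
    fix n :: nat and \<sigma> U assume n: "1 \<le> n" and \<sigma>: "\<sigma> permutes {1..n}" and "U \<in> elems Q n"
    then obtain f where f: "f \<in> elems P n" "U = q n f" using ex by blast
    then show "B n \<sigma> U = sact Q n \<sigma> U"
      using B[OF n permutes_Suc[OF \<sigma>]] P.cact_extends[OF n \<sigma>] hom.hom_sact[OF n \<sigma>] by simp
  next
    note ids = P.cact_identities[unfolded anticyclic_identities_def]
    note Bc = B[OF _ long_cycle_permutes]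
    note Ac = A_closed[OF _ long_cycle_permutes]
    show "anticyclic_identities Q (\<lambda>n. B n (long_cycle n))"
      unfolding anticyclic_identities_def
    proof (intro conjI allI ballI impI)
      show "B 1 (long_cycle 1) (unit Q) = \<ominus>\<^bsub>comps Q 1\<^esub> unit Q"
        using Bc[OF _ P.unit_closed] ids q_uminus[OF _ P.unit_closed] hom.hom_unit by simp
      fix m n :: nat and U V
      assume m: "1 \<le> m" "1 \<le> n" and UV: "U \<in> elems Q m" "V \<in> elems Q n"
      obtain f g where fg: "f \<in> elems P m" "U = q m f" "g \<in> elems P n" "V = q n g"
        using ex[OF UV(1) m(1)] ex[OF UV(2) m(2)] by blast
      have N: "1 \<le> m + n - 1" "n + m - 1 = m + n - 1" using m by auto
      note Af = Ac[OF m(1) fg(1)] and Ag = Ac[OF m(2) fg(3)]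
      {
        fix i assume i: "2 \<le> i \<and> i \<le> m"
        then have i': "1 \<le> i" "i \<le> m" "1 \<le> i - 1" "i - 1 \<le> m" by auto
        have "B (m + n - 1) (long_cycle (m + n - 1)) (pcomp Q m n i U V) =
            q (m + n - 1) (A (m + n - 1) (long_cycle (m + n - 1)) (pcomp P m n i f g))"
          unfolding fg hom.hom_pcomp[OF i'(1,2) m(2) fg(1,3), symmetric]
          by (rule Bc[OF N(1) P.pcomp_closed[OF i'(1,2) m(2) fg(1,3)]])
        also have "\<dots> = q (m + n - 1) (pcomp P m n (i - 1) (A m (long_cycle m) f) g)"
          using ids m fg i by simp
        also have "\<dots> = pcomp Q m n (i - 1) (B m (long_cycle m) U) V"
          unfolding hom.hom_pcomp[OF i'(3,4) m(2) Af fg(3)] fg(2,4) Bc[OF m(1) fg(1)] ..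
        finally show "B (m + n - 1) (long_cycle (m + n - 1)) (pcomp Q m n i U V) =
          pcomp Q m n (i - 1) (B m (long_cycle m) U) V" .
      }
      let ?z = "pcomp P n m n (A n (long_cycle n) g) (A m (long_cycle m) f)"
      have z: "?z \<in> elems P (m + n - 1)"
        using P.pcomp_closed[OF m(2) order_refl m(1) Ag Af] by (simp only: N)
      have "B (m + n - 1) (long_cycle (m + n - 1)) (pcomp Q m n 1 U V) =
          q (m + n - 1) (A (m + n - 1) (long_cycle (m + n - 1)) (pcomp P m n 1 f g))"
        unfolding fg hom.hom_pcomp[OF order_refl m fg(1,3), symmetric]
        by (rule Bc[OF N(1) P.pcomp_closed[OF order_refl m fg(1,3)]])
      also have "\<dots> = q (m + n - 1) (\<ominus>\<^bsub>comps P (m + n - 1)\<^esub> ?z)"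
        using ids m fg by simp
      also have "\<dots> = \<ominus>\<^bsub>comps Q (m + n - 1)\<^esub> q (m + n - 1) ?z"
        by (rule q_uminus[OF N(1) z])
      also have "q (m + n - 1) ?z = pcomp Q n m n (B n (long_cycle n) V) (B m (long_cycle m) U)"
        using hom.hom_pcomp[OF m(2) order_refl m(1) Ag Af] fg Bc[OF m(1) fg(1)] Bc[OF m(2) fg(3)]
        by (simp only: N)
      finally show "B (m + n - 1) (long_cycle (m + n - 1)) (pcomp Q m n 1 U V) =
        \<ominus>\<^bsub>comps Q (m + n - 1)\<^esub> pcomp Q n m n (B n (long_cycle n) V) (B m (long_cycle m) U)" .
    qed
  qed
  have hom_B: "anticyclic_operad_hom P A Q B q"
    by (intro anticyclic_operad_hom.intro anticyclic_operad_hom_axioms.intro P anticyclic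
        hom.sym_operad_hom_axioms) (simp add: B)
  have "B' = B" if B': "anticyclic_operad Q B'" "anticyclic_operad_hom P A Q B' q" for B'
  proof -
    have eq: "B' n \<sigma> U = B n \<sigma> U" if n: "1 \<le> n" and \<sigma>: "\<sigma> permutes {1..n + 1}" and U: "U \<in> elems Q n" for n \<sigma> U
    proof -
      obtain f where f: "f \<in> elems P n" "U = q n f" using ex[OF U n] by blast
      then show ?thesis
        using anticyclic_operad_hom.hom_cact[OF B'(2) n \<sigma> f(1)] B[OF n \<sigma> f(1)] by simp
    qed
    note T' = anticyclic_operad.cact_typed[OF B'(1)] and T = anticyclic_operad.cact_typed[OF anticyclic]
    show ?thesis
    proof (rule PiE_ext[OF T' T])
      fix n :: nat assume n: "n \<in> {1..}"
      show "B' n = B n"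
      proof (rule PiE_ext[OF PiE_mem[OF T' n] PiE_mem[OF T n]])
        fix \<sigma> :: "nat \<Rightarrow> nat" assume \<sigma>: "\<sigma> \<in> {\<sigma>. \<sigma> permutes {1..n + 1}}"
        show "B' n \<sigma> = B n \<sigma>"
          by (rule PiE_ext[OF PiE_mem[OF PiE_mem[OF T' n] \<sigma>] PiE_mem[OF PiE_mem[OF T n] \<sigma>]])
            (use eq n \<sigma> in simp)
      qed
    qed
  qed
  then show ?thesis
    using anticyclic hom_B unfolding Q_def[symmetric] q_def[symmetric] by blast
qed

lemma ns_ideal_elems: "ns_operad P \<Longrightarrow> ns_ideal P (elems P)"
  by (auto simp: ns_ideal_def simp del: One_nat_def
      intro: module.carrier_is_submodule ns_operad.vector_space ns_operad.pcomp_closed)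

lemma submodule_Inter:
  assumes V: "module rat_field V" and "\<S> \<noteq> {}" "\<And>H. H \<in> \<S> \<Longrightarrow> submodule H rat_field V"
  shows "submodule (\<Inter>\<S>) rat_field V"
proof (rule submodule_ratI[OF V])
  note E = submodule_facts[OF V assms(3)]
  show "\<Inter>\<S> \<subseteq> carrier V" using assms(2) E(1) by blast
  show "\<zero>\<^bsub>V\<^esub> \<in> \<Inter>\<S>" using E(2) by simp
  show "a \<oplus>\<^bsub>V\<^esub> b \<in> \<Inter>\<S>" if "a \<in> \<Inter>\<S>" "b \<in> \<Inter>\<S>" for a b using that E(3) by simp
  show "c \<odot>\<^bsub>V\<^esub> a \<in> \<Inter>\<S>" if "a \<in> \<Inter>\<S>" for c a using that E(4) by simp
qed

lemma ns_ideal_Inter: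
  assumes P: "ns_operad P" and \<I>: "\<I> \<noteq> {}" "\<And>I. I \<in> \<I> \<Longrightarrow> ns_ideal P I"
  shows "ns_ideal P (\<lambda>n. \<Inter>{I n | I. I \<in> \<I>})"
  unfolding ns_ideal_def
proof (intro conjI allI impI ballI)
  fix n :: nat assume n: "1 \<le> n"
  show "submodule (\<Inter>{I n | I. I \<in> \<I>}) rat_field (comps P n)"
    by (rule submodule_Inter[OF ns_operad.vector_space[OF P n]])
      (use \<I> n in \<open>auto simp: ns_ideal_def\<close>)
next
  fix m n i f g assume "f \<in> elems P m" "g \<in> elems P n"
    "1 \<le> i \<and> i \<le> m \<and> 1 \<le> n \<and> (f \<in> \<Inter>{I m | I. I \<in> \<I>} \<or> g \<in> \<Inter>{I n | I. I \<in> \<I>})"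
  then have "pcomp P m n i f g \<in> I (m + n - 1)" if "I \<in> \<I>" for I
    using \<I>(2)[OF that] that unfolding ns_ideal_def by blast
  then show "pcomp P m n i f g \<in> \<Inter>{I (m + n - 1) | I. I \<in> \<I>}" by blast
qed

lemma gen_ns_ideal:
  assumes P: "ns_operad P" and S: "\<And>k. S k \<subseteq> elems P k"
  shows "ns_ideal P (gen_ns_ideal P S)" "S k \<subseteq> gen_ns_ideal P S k"
    and "\<lbrakk>ns_ideal P I; \<And>k. S k \<subseteq> I k\<rbrakk> \<Longrightarrow> gen_ns_ideal P S n \<subseteq> I n"
proof -
  let ?\<I> = "{I. ns_ideal P I \<and> (\<forall>k. S k \<subseteq> I k)}"
  have eq: "gen_ns_ideal P S = (\<lambda>n. \<Inter>{I n | I. I \<in> ?\<I>})" by (simp add: gen_ns_ideal_def fun_eq_iff)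
  have "?\<I> \<noteq> {}" using ns_ideal_elems[OF P] S by blast
  then show "ns_ideal P (gen_ns_ideal P S)" unfolding eq by (rule ns_ideal_Inter[OF P]) simp
  show "S k \<subseteq> gen_ns_ideal P S k" unfolding gen_ns_ideal_def by blast
  show "gen_ns_ideal P S n \<subseteq> I n" if "ns_ideal P I" "\<And>k. S k \<subseteq> I k"
    unfolding gen_ns_ideal_def by (rule Inter_lower) (use that in blast)
qed

lemma gen_sym_ideal:
  assumes P: "sym_operad P" and S: "\<And>k. S k \<subseteq> elems P k"
  shows "sym_ideal P (gen_sym_ideal P S)" "S k \<subseteq> gen_sym_ideal P S k"
    and "\<lbrakk>sym_ideal P I; \<And>k. S k \<subseteq> I k\<rbrakk> \<Longrightarrow> gen_sym_ideal P S n \<subseteq> I n"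
proof -
  let ?\<I> = "{I. sym_ideal P I \<and> (\<forall>k. S k \<subseteq> I k)}"
  interpret P: sym_operad P by fact
  have eq: "gen_sym_ideal P S = (\<lambda>n. \<Inter>{I n | I. I \<in> ?\<I>})" by (simp add: gen_sym_ideal_def fun_eq_iff)
  have "sym_ideal P (elems P)"
    unfolding sym_ideal_def using ns_ideal_elems[OF P.ns_operad_axioms] linear_onD(1)[OF P.sact_linear] by blast
  then have "?\<I> \<noteq> {}" using S by blast
  then have "ns_ideal P (gen_sym_ideal P S)"
    unfolding eq by (rule ns_ideal_Inter[OF P.ns_operad_axioms]) (simp add: sym_ideal_def)
  then show "sym_ideal P (gen_sym_ideal P S)"
    unfolding sym_ideal_def gen_sym_ideal_def by blast
  show "S k \<subseteq> gen_sym_ideal P S k" unfolding gen_sym_ideal_def by blast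
  show "gen_sym_ideal P S n \<subseteq> I n" if "sym_ideal P I" "\<And>k. S k \<subseteq> I k"
    unfolding gen_sym_ideal_def by (rule Inter_lower) (use that in blast)
qed

text \<open>The elements of the ideal whose whole orbit lies in the ideal again form an ideal, because
  the long cycle sends a composite \<open>f \<circ>\<^sub>i g\<close>, up to sign, to a composite of an element of the orbit
  of \<open>f\<close> and an element of the orbit of \<open>g\<close>. So the orbits of the generators decide.\<close>

lemma gen_sym_ideal_stable:
  assumes P: "anticyclic_operad P A" and S: "\<And>k. S k \<subseteq> elems P k"
    and orbit: "\<And>n s \<sigma>. \<lbrakk>s \<in> S n; \<sigma> permutes {1..n + 1}\<rbrakk> \<Longrightarrow> A n \<sigma> s \<in> gen_sym_ideal P S n"
    and n: "1 \<le> n" and \<sigma>: "\<sigma> permutes {1..n + 1}" and f: "f \<in> gen_sym_ideal P S n"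
  shows "A n \<sigma> f \<in> gen_sym_ideal P S n"
proof -
  interpret P: anticyclic_operad P A by fact
  define I where "I = gen_sym_ideal P S"
  note ideal = gen_sym_ideal[OF P.sym_operad_axioms S, folded I_def]
  have I: "ns_ideal P I" using ideal(1) by (simp add: sym_ideal_def)
  have sub: "submodule (I n) rat_field (comps P n)" if "1 \<le> n" for n
    using I that by (simp add: ns_ideal_def)
  note I_sub = submodule_facts[OF P.vector_space sub]
  have I_elems: "f \<in> elems P n" if "1 \<le> n" "f \<in> I n" for n f
    using I_sub(1) that by blast
  have I_pcomp: "pcomp P m n i f g \<in> I (m + n - 1)"
    if "1 \<le> i" "i \<le> m" "1 \<le> n" "f \<in> elems P m" "g \<in> elems P n" "f \<in> I m \<or> g \<in> I n" for m n i f g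
    using I that unfolding ns_ideal_def by blast
  have A_closed: "A n \<sigma> f \<in> elems P n" if "1 \<le> n" "\<sigma> permutes {1..n + 1}" "f \<in> elems P n" for n \<sigma> f
    using linear_onD(1)[OF P.cact_linear] that by blast
  define J where "J n = {f \<in> I n. \<forall>\<sigma>. \<sigma> permutes {1..n + 1} \<longrightarrow> A n \<sigma> f \<in> I n}" for n
  have J_A: "A n \<sigma> f \<in> J n" if n: "1 \<le> n" and \<sigma>: "\<sigma> permutes {1..n + 1}" and f: "f \<in> J n" for n \<sigma> f
  proof -
    have fI: "f \<in> I n" "\<And>\<sigma>. \<sigma> permutes {1..n + 1} \<Longrightarrow> A n \<sigma> f \<in> I n"
      using f by (auto simp: J_def)
    have "A n \<pi> (A n \<sigma> f) \<in> I n" if \<pi>: "\<pi> permutes {1..n + 1}" for \<pi>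
      unfolding P.cact_comp[OF n \<pi> \<sigma> I_elems[OF n fI(1)], symmetric]
      by (rule fI(2)[OF permutes_compose[OF \<sigma> \<pi>]])
    then show ?thesis using f \<sigma> by (simp add: J_def)
  qed
  \<comment> \<open>Both places for the element of \<open>J\<close> and both signs are admitted, so that the long cycle
    preserves the set.\<close>
  define G where "G N = {x. \<exists>m n i f g. N = m + n - 1 \<and> 1 \<le> i \<and> i \<le> m \<and> 1 \<le> n \<and>
      f \<in> elems P m \<and> g \<in> elems P n \<and> (f \<in> J m \<or> g \<in> J n) \<and>
      (x = pcomp P m n i f g \<or> x = \<ominus>\<^bsub>comps P N\<^esub> pcomp P m n i f g)}" for N
  have G_intro: "pcomp P m n i f g \<in> G N" "\<ominus>\<^bsub>comps P N\<^esub> pcomp P m n i f g \<in> G N"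
    if "N = m + n - 1" "1 \<le> i" "i \<le> m" "1 \<le> n" "f \<in> elems P m" "g \<in> elems P n" "f \<in> J m \<or> g \<in> J n"
    for N m n i f g
    using that unfolding G_def by blast+
  have G_I: "x \<in> I N" if xG: "x \<in> G N" for x N
  proof -
    obtain m n i f g where x: "N = m + n - 1" "1 \<le> i" "i \<le> m" "1 \<le> n" "f \<in> elems P m" "g \<in> elems P n"
      "f \<in> J m \<or> g \<in> J n" "x = pcomp P m n i f g \<or> x = \<ominus>\<^bsub>comps P N\<^esub> pcomp P m n i f g"
      using xG unfolding G_def by blast
    have "pcomp P m n i f g \<in> I N" using I_pcomp[OF x(2-6)] x(1,7) by (auto simp: J_def)
    moreover have "1 \<le> N" using x by simp
    ultimately show ?thesis using x(8) I_sub(5) by blast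
  qed
  have G_cycle: "A N (long_cycle N) x \<in> G N" if xG: "x \<in> G N" for x N
  proof -
    obtain m n i f g where x: "N = m + n - 1" "1 \<le> i" "i \<le> m" "1 \<le> n" "f \<in> elems P m" "g \<in> elems P n"
      "f \<in> J m \<or> g \<in> J n" "x = pcomp P m n i f g \<or> x = \<ominus>\<^bsub>comps P N\<^esub> pcomp P m n i f g"
      using xG unfolding G_def by blast
    have m: "1 \<le> m" "1 \<le> N" and N: "N = n + m - 1" using x by auto
    interpret V: module rat_field "comps P N" using P.vector_space[OF m(2)] .
    have fg: "pcomp P m n i f g \<in> elems P N" using P.pcomp_closed[OF x(2-6)] x(1) by simp
    let ?f = "A m (long_cycle m) f" and ?g = "A n (long_cycle n) g"
    have f': "?f \<in> elems P m" "f \<in> J m \<Longrightarrow> ?f \<in> J m"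
      using A_closed[OF m(1) long_cycle_permutes x(5)] J_A[OF m(1) long_cycle_permutes] by auto
    have g': "?g \<in> elems P n" "g \<in> J n \<Longrightarrow> ?g \<in> J n"
      using A_closed[OF x(4) long_cycle_permutes x(6)] J_A[OF x(4) long_cycle_permutes] by auto
    note ids = P.cact_identities[unfolded anticyclic_identities_def]
    have pos: "A N (long_cycle N) (pcomp P m n i f g) \<in> G N \<and>
        \<ominus>\<^bsub>comps P N\<^esub> A N (long_cycle N) (pcomp P m n i f g) \<in> G N"
    proof (cases "i = 1")
      case True
      have eq: "A N (long_cycle N) (pcomp P m n i f g) = \<ominus>\<^bsub>comps P N\<^esub> pcomp P n m n ?g ?f"
        using ids m x(4,5,6) True unfolding x(1) by blast
      have "pcomp P n m n ?g ?f \<in> elems P N"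
        using P.pcomp_closed[OF x(4) order_refl m(1) g'(1) f'(1)] N by simp
      then have "\<ominus>\<^bsub>comps P N\<^esub> A N (long_cycle N) (pcomp P m n i f g) = pcomp P n m n ?g ?f"
        unfolding eq by (rule V.minus_minus)
      then show ?thesis
        using G_intro[OF N x(4) order_refl m(1) g'(1) f'(1)] x(7) f'(2) g'(2) eq by auto
    next
      case False
      then have i: "2 \<le> i" "1 \<le> i - 1" "i - 1 \<le> m" using x by auto
      have "A N (long_cycle N) (pcomp P m n i f g) = pcomp P m n (i - 1) ?f g"
        using ids m x(3-6) i unfolding x(1) by blast
      then show ?thesis
        using G_intro[OF x(1) i(2,3) x(4) f'(1) x(6)] x(7) f'(2) by auto
    qed
    have "A N (long_cycle N) (\<ominus>\<^bsub>comps P N\<^esub> pcomp P m n i f g) =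
        \<ominus>\<^bsub>comps P N\<^esub> A N (long_cycle N) (pcomp P m n i f g)"
      by (rule linear_on_uminus[OF P.vector_space[OF m(2)] P.vector_space[OF m(2)]
          P.cact_linear[OF m(2) long_cycle_permutes] fg])
    then show ?thesis using pos x(8) by metis
  qed
  have G_pow: "A N (long_cycle N ^^ k) x \<in> G N" if "x \<in> G N" "1 \<le> N" for x N k
  proof (induction k)
    case 0
    then show ?case using P.cact_id[OF that(2) I_elems[OF that(2) G_I[OF that(1)]]] that(1) by (simp only: funpow.simps)
  next
    case (Suc k)
    have "A N (long_cycle N ^^ Suc k) x = A N (long_cycle N) (A N (long_cycle N ^^ k) x)"
      using P.cact_comp[OF that(2) long_cycle_permutes permutes_funpow[OF long_cycle_permutes]
          I_elems[OF that(2) G_I[OF that(1)]]] by (simp only: funpow.simps)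
    then show ?case using G_cycle[OF Suc.IH] by (simp only:)
  qed
  have G_J: "x \<in> J N" if x: "x \<in> G N" and N: "1 \<le> N" for x N
  proof -
    note xe = I_elems[OF N G_I[OF x]]
    have "A N \<sigma> x \<in> I N" if \<sigma>: "\<sigma> permutes {1..N + 1}" for \<sigma>
    proof -
      obtain \<rho> k where \<rho>: "\<rho> permutes {1..N}" "\<sigma> = \<rho> \<circ> (long_cycle N ^^ k)"
        using permutes_long_cycle_decomp[OF \<sigma>] by blast
      note y = G_I[OF G_pow[OF x N, of k]]
      have "A N \<sigma> x = sact P N \<rho> (A N (long_cycle N ^^ k) x)"
        unfolding \<rho>(2) P.cact_comp[OF N permutes_Suc[OF \<rho>(1)] permutes_funpow[OF long_cycle_permutes] xe]
        by (rule P.cact_extends[OF N \<rho>(1) I_elems[OF N y]])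
      then show ?thesis using ideal(1) N \<rho>(1) y unfolding sym_ideal_def by simp
    qed
    then show ?thesis using G_I[OF x] by (simp add: J_def)
  qed
  have "sym_ideal P J"
    unfolding sym_ideal_def ns_ideal_def
  proof (intro conjI allI impI ballI)
    fix n :: nat assume n: "1 \<le> n"
    note E = I_sub[OF n n]
    note L = linear_onD(2,3)[OF P.cact_linear[OF n]]
    have z: "A n \<sigma> \<zero>\<^bsub>comps P n\<^esub> = \<zero>\<^bsub>comps P n\<^esub>" if "\<sigma> permutes {1..n + 1}" for \<sigma>
      by (rule linear_on_zero[OF P.vector_space[OF n] P.vector_space[OF n] P.cact_linear[OF n that]])
    show "submodule (J n) rat_field (comps P n)"
    proof (rule submodule_ratI[OF P.vector_space[OF n]])
      show "J n \<subseteq> elems P n" using E(1) by (auto simp: J_def)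
      show "\<zero>\<^bsub>comps P n\<^esub> \<in> J n" using E(2) z by (simp add: J_def)
      show "a \<oplus>\<^bsub>comps P n\<^esub> b \<in> J n" if "a \<in> J n" "b \<in> J n" for a b
        using that E(3) L(1) I_elems[OF n] by (simp add: J_def)
      show "c \<odot>\<^bsub>comps P n\<^esub> a \<in> J n" if "a \<in> J n" for c a
        using that E(4) L(2) I_elems[OF n] by (simp add: J_def)
    qed
    fix \<sigma> f assume \<sigma>: "\<sigma> permutes {1..n}" and f: "f \<in> J n"
    then have "f \<in> elems P n" using I_elems[OF n] by (simp add: J_def)
    then show "sact P n \<sigma> f \<in> J n"
      using J_A[OF n permutes_Suc[OF \<sigma>] f] P.cact_extends[OF n \<sigma>] by simp
  next
    fix m n i f g assume fg: "f \<in> elems P m" "g \<in> elems P n"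
      and i: "1 \<le> i \<and> i \<le> m \<and> 1 \<le> n \<and> (f \<in> J m \<or> g \<in> J n)"
    then have "pcomp P m n i f g \<in> G (m + n - 1)" by (intro G_intro(1)) auto
    then show "pcomp P m n i f g \<in> J (m + n - 1)" by (rule G_J) (use i in auto)
  qed
  moreover have "S k \<subseteq> J k" for k
    using ideal(2)[of k] orbit unfolding J_def I_def by blast
  ultimately have "I n \<subseteq> J n" by (rule ideal(3))
  then show ?thesis using f \<sigma> by (auto simp: J_def I_def)
qed

section \<open>The symmetrization of a non-symmetric operad\<close>

lemma mem_perms [simp]: "\<sigma> \<in> perms n \<longleftrightarrow> \<sigma> permutes {1..n}"
  by (simp add: perms_def)

lemma perms_1: "\<sigma> permutes {1..1 :: nat} \<longleftrightarrow> \<sigma> = id"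
  by auto

lemma symmetrization_sel [simp]:
  "elems (symmetrization P) n = perms n \<rightarrow>\<^sub>E elems P n"
  "\<zero>\<^bsub>comps (symmetrization P) n\<^esub> = (\<lambda>\<rho>\<in>perms n. \<zero>\<^bsub>comps P n\<^esub>)"
  "u \<oplus>\<^bsub>comps (symmetrization P) n\<^esub> v = (\<lambda>\<rho>\<in>perms n. u \<rho> \<oplus>\<^bsub>comps P n\<^esub> v \<rho>)"
  "c \<odot>\<^bsub>comps (symmetrization P) n\<^esub> u = (\<lambda>\<rho>\<in>perms n. c \<odot>\<^bsub>comps P n\<^esub> u \<rho>)"
  "unit (symmetrization P) = pure_tensor P 1 (unit P) id"
  "sact (symmetrization P) n \<sigma> u = (\<lambda>\<rho>\<in>perms n. u (perm_inv \<sigma> \<circ> \<rho>))"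
  by (simp_all add: symmetrization_def)

lemma symmetrization_pcomp_def:
  "pcomp (symmetrization P) m n i u v = (\<lambda>\<rho>\<in>perms (m + n - 1).
    finsum (comps P (m + n - 1)) (\<lambda>(\<sigma>, \<pi>). pcomp P m n (perm_inv \<sigma> i) (u \<sigma>) (v \<pi>))
      {(\<sigma>, \<pi>) \<in> perms m \<times> perms n. perm_pcomp m n i \<sigma> \<pi> = \<rho>})"
  by (simp add: symmetrization_def)

context ns_operad
begin

abbreviation S :: "((nat \<Rightarrow> nat) \<Rightarrow> 'a) sym_operad"
  where "S \<equiv> symmetrization P"

lemma pcomp_zero:
  assumes "1 \<le> i" "i \<le> m" "1 \<le> n"
  shows "g \<in> elems P n \<Longrightarrow> pcomp P m n i \<zero>\<^bsub>comps P m\<^esub> g = \<zero>\<^bsub>comps P (m + n - 1)\<^esub>"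
    and "f \<in> elems P m \<Longrightarrow> pcomp P m n i f \<zero>\<^bsub>comps P n\<^esub> = \<zero>\<^bsub>comps P (m + n - 1)\<^esub>"
proof -
  have N: "1 \<le> m" "1 \<le> m + n - 1" using assms by auto
  show "g \<in> elems P n \<Longrightarrow> pcomp P m n i \<zero>\<^bsub>comps P m\<^esub> g = \<zero>\<^bsub>comps P (m + n - 1)\<^esub>"
    by (rule linear_on_zero[OF vector_space[OF N(1)] vector_space[OF N(2)] pcomp_linear_left[OF assms]])
  show "f \<in> elems P m \<Longrightarrow> pcomp P m n i f \<zero>\<^bsub>comps P n\<^esub> = \<zero>\<^bsub>comps P (m + n - 1)\<^esub>"
    by (rule linear_on_zero[OF vector_space[OF assms(3)] vector_space[OF N(2)] pcomp_linear_right[OF assms]])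
qed

lemma symmetrization_module:
  assumes n: "1 \<le> n"
  shows "module rat_field (comps S n)"
proof -
  interpret V: module rat_field "comps P n" using vector_space[OF n] .
  note closed = V.smult_closed[simplified]
  have neg: "(-1) \<odot>\<^bsub>comps P n\<^esub> x \<oplus>\<^bsub>comps P n\<^esub> x = \<zero>\<^bsub>comps P n\<^esub>" if "x \<in> elems P n" for x
    using uminus_smult_rat[OF vector_space[OF n] that] V.l_neg[OF that] by simp
  show ?thesis
  proof (rule module_ratI, unfold symmetrization_sel)
    fix u v w c d
    assume u: "u \<in> perms n \<rightarrow>\<^sub>E elems P n"
    have up: "u \<rho> \<in> elems P n" if "\<rho> \<in> perms n" for \<rho> using u that by (rule PiE_mem)
    show "(\<lambda>\<rho>\<in>perms n. c \<odot>\<^bsub>comps P n\<^esub> u \<rho>) \<in> perms n \<rightarrow>\<^sub>E elems P n"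
      using up closed by auto
    show "(\<lambda>\<rho>\<in>perms n. (\<lambda>\<rho>\<in>perms n. \<zero>\<^bsub>comps P n\<^esub>) \<rho> \<oplus>\<^bsub>comps P n\<^esub> u \<rho>) = u"
      using u up by (intro ext) (auto simp: PiE_def extensional_def)
    show "(\<lambda>\<rho>\<in>perms n. (\<lambda>\<rho>\<in>perms n. (-1) \<odot>\<^bsub>comps P n\<^esub> u \<rho>) \<rho> \<oplus>\<^bsub>comps P n\<^esub> u \<rho>) =
      (\<lambda>\<rho>\<in>perms n. \<zero>\<^bsub>comps P n\<^esub>)"
      using up neg by (intro restrict_ext) simp
    show "(\<lambda>\<rho>\<in>perms n. (c + d) \<odot>\<^bsub>comps P n\<^esub> u \<rho>) =
      (\<lambda>\<rho>\<in>perms n. (\<lambda>\<rho>\<in>perms n. c \<odot>\<^bsub>comps P n\<^esub> u \<rho>) \<rho> \<oplus>\<^bsub>comps P n\<^esub>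
        (\<lambda>\<rho>\<in>perms n. d \<odot>\<^bsub>comps P n\<^esub> u \<rho>) \<rho>)"
      using up V.smult_l_distr[of c d] by (intro restrict_ext) simp
    show "(\<lambda>\<rho>\<in>perms n. (c * d) \<odot>\<^bsub>comps P n\<^esub> u \<rho>) =
      (\<lambda>\<rho>\<in>perms n. c \<odot>\<^bsub>comps P n\<^esub> (\<lambda>\<rho>\<in>perms n. d \<odot>\<^bsub>comps P n\<^esub> u \<rho>) \<rho>)"
      using up V.smult_assoc1[of c d] by (intro restrict_ext) simp
    show "(\<lambda>\<rho>\<in>perms n. 1 \<odot>\<^bsub>comps P n\<^esub> u \<rho>) = u"
      using u up V.smult_one by (intro ext) (auto simp: PiE_def extensional_def)
    assume v: "v \<in> perms n \<rightarrow>\<^sub>E elems P n"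
    have vp: "v \<rho> \<in> elems P n" if "\<rho> \<in> perms n" for \<rho> using v that by (rule PiE_mem)
    show "(\<lambda>\<rho>\<in>perms n. u \<rho> \<oplus>\<^bsub>comps P n\<^esub> v \<rho>) \<in> perms n \<rightarrow>\<^sub>E elems P n"
      using up vp by auto
    show "(\<lambda>\<rho>\<in>perms n. u \<rho> \<oplus>\<^bsub>comps P n\<^esub> v \<rho>) = (\<lambda>\<rho>\<in>perms n. v \<rho> \<oplus>\<^bsub>comps P n\<^esub> u \<rho>)"
      using up vp V.a_comm by (intro restrict_ext) simp
    show "(\<lambda>\<rho>\<in>perms n. c \<odot>\<^bsub>comps P n\<^esub> (\<lambda>\<rho>\<in>perms n. u \<rho> \<oplus>\<^bsub>comps P n\<^esub> v \<rho>) \<rho>) =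
      (\<lambda>\<rho>\<in>perms n. (\<lambda>\<rho>\<in>perms n. c \<odot>\<^bsub>comps P n\<^esub> u \<rho>) \<rho> \<oplus>\<^bsub>comps P n\<^esub>
        (\<lambda>\<rho>\<in>perms n. c \<odot>\<^bsub>comps P n\<^esub> v \<rho>) \<rho>)"
      using up vp V.smult_r_distr[of c] by (intro restrict_ext) simp
    assume w: "w \<in> perms n \<rightarrow>\<^sub>E elems P n"
    have wp: "w \<rho> \<in> elems P n" if "\<rho> \<in> perms n" for \<rho> using w that by (rule PiE_mem)
    show "(\<lambda>\<rho>\<in>perms n. (\<lambda>\<rho>\<in>perms n. u \<rho> \<oplus>\<^bsub>comps P n\<^esub> v \<rho>) \<rho> \<oplus>\<^bsub>comps P n\<^esub> w \<rho>) =
      (\<lambda>\<rho>\<in>perms n. u \<rho> \<oplus>\<^bsub>comps P n\<^esub> (\<lambda>\<rho>\<in>perms n. v \<rho> \<oplus>\<^bsub>comps P n\<^esub> w \<rho>) \<rho>)"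
      using up vp wp V.a_assoc by (intro restrict_ext) simp
  qed auto
qed

text \<open>Since \<^const>\<open>perm_pcomp\<close> is injective, the coefficient of a composite in the symmetrization
  at a permutation \<open>\<rho>\<close> has at most one summand.\<close>

lemma symmetrization_pcomp:
  assumes i: "1 \<le> i" "i \<le> m" "1 \<le> n" and p: "\<sigma> permutes {1..m}" "\<pi> permutes {1..n}"
    and u: "u \<in> elems S m" and v: "v \<in> elems S n"
  shows "pcomp S m n i u v (perm_pcomp m n i \<sigma> \<pi>) =
    pcomp P m n (perm_inv \<sigma> i) (u \<sigma>) (v \<pi>)"
proof -
  have "1 \<le> m + n - 1" using i by simp
  then interpret V: module rat_field "comps P (m + n - 1)" by (rule vector_space)
  let ?h = "\<lambda>(\<sigma>, \<pi>). pcomp P m n (perm_inv \<sigma> i) (u \<sigma>) (v \<pi>)"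
  have fib: "{(\<sigma>', \<pi>') \<in> perms m \<times> perms n. perm_pcomp m n i \<sigma>' \<pi>' = perm_pcomp m n i \<sigma> \<pi>} = {(\<sigma>, \<pi>)}"
    using perm_pcomp_inject[OF i] p by auto
  have "?h (\<sigma>, \<pi>) \<in> elems P (m + n - 1)"
    using pcomp_closed[OF perm_inv_bounds[OF p(1) i(1,2)] i(3)] u v p by (auto simp: PiE_iff)
  then have "finsum (comps P (m + n - 1)) ?h {(\<sigma>, \<pi>)} = ?h (\<sigma>, \<pi>)"
    by (subst V.finsum_insert) (auto simp: V.finsum_empty simp del: One_nat_def)
  moreover have "perm_pcomp m n i \<sigma> \<pi> \<in> perms (m + n - 1)" using perm_pcomp_permutes[OF i p] by simp
  ultimately show ?thesis
    unfolding symmetrization_pcomp_def by (simp only: fib restrict_apply if_True case_prod_conv)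
qed

lemma symmetrization_pcomp_zero:
  assumes "1 \<le> i" "i \<le> m" "\<rho> permutes {1..m + n - 1}"
    and "\<And>\<sigma> \<pi>. \<lbrakk>\<sigma> permutes {1..m}; \<pi> permutes {1..n}\<rbrakk> \<Longrightarrow> \<rho> \<noteq> perm_pcomp m n i \<sigma> \<pi>"
  shows "pcomp S m n i u v \<rho> = \<zero>\<^bsub>comps P (m + n - 1)\<^esub>"
proof (cases "1 \<le> m + n - 1")
  case True
  then interpret V: module rat_field "comps P (m + n - 1)" by (rule vector_space)
  have fib: "{(\<sigma>', \<pi>') \<in> perms m \<times> perms n. perm_pcomp m n i \<sigma>' \<pi>' = \<rho>} = {}"
    using assms(4) by fastforce
  have "\<rho> \<in> perms (m + n - 1)" using assms(3) by simp
  then show ?thesis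
    unfolding symmetrization_pcomp_def by (simp only: fib restrict_apply if_True V.finsum_empty)
next
  case False
  then have "m = 1" "n = 0" using assms by auto
  then have "\<rho> = perm_pcomp m n i id id"
    using assms by (auto simp: perm_pcomp_def fun_eq_iff permutes_empty)
  then show ?thesis using assms(4) permutes_id by blast
qed

lemma symmetrization_pcomp_closed:
  assumes i: "1 \<le> i" "i \<le> m" "1 \<le> n"
    and u: "u \<in> elems S m" and v: "v \<in> elems S n"
  shows "pcomp S m n i u v \<in> perms (m + n - 1) \<rightarrow>\<^sub>E elems P (m + n - 1)"
proof (rule PiE_I)
  fix \<rho> assume \<rho>: "\<rho> \<in> perms (m + n - 1)"
  show "pcomp S m n i u v \<rho> \<in> elems P (m + n - 1)"
  proof (cases "\<exists>\<sigma> \<pi>. \<sigma> permutes {1..m} \<and> \<pi> permutes {1..n} \<and> \<rho> = perm_pcomp m n i \<sigma> \<pi>")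
    case True
    then show ?thesis
      using symmetrization_pcomp[OF i _ _ u v] pcomp_closed[OF perm_inv_bounds[OF _ i(1,2)] i(3)] u v
      by (auto simp: PiE_iff)
  next
    case False
    then show ?thesis
      using symmetrization_pcomp_zero[OF i(1,2)] \<rho> comps_closed(1)[of "m + n - 1"] i by auto
  qed
qed (simp add: symmetrization_def)

lemma symmetrization_pcomp_eqI:
  assumes i: "1 \<le> i" "i \<le> m" "1 \<le> n"
    and u: "u \<in> elems S m" and v: "v \<in> elems S n"
    and w: "w \<in> extensional (perms (m + n - 1))"
    and comp: "\<And>\<sigma> \<pi>. \<lbrakk>\<sigma> permutes {1..m}; \<pi> permutes {1..n}\<rbrakk> \<Longrightarrow>
      w (perm_pcomp m n i \<sigma> \<pi>) = pcomp P m n (perm_inv \<sigma> i) (u \<sigma>) (v \<pi>)"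
    and zero: "\<And>\<rho>. \<lbrakk>\<rho> permutes {1..m + n - 1};
        \<And>\<sigma> \<pi>. \<lbrakk>\<sigma> permutes {1..m}; \<pi> permutes {1..n}\<rbrakk> \<Longrightarrow> \<rho> \<noteq> perm_pcomp m n i \<sigma> \<pi>\<rbrakk> \<Longrightarrow>
      w \<rho> = \<zero>\<^bsub>comps P (m + n - 1)\<^esub>"
  shows "pcomp S m n i u v = w"
proof
  fix \<rho>
  show "pcomp S m n i u v \<rho> = w \<rho>"
  proof (cases "\<rho> \<in> perms (m + n - 1)")
    case False
    show ?thesis
      by (simp only: PiE_arb[OF symmetrization_pcomp_closed[OF i u v] False] extensional_arb[OF w False])
  next
    case True
    then have \<rho>: "\<rho> permutes {1..m + n - 1}" by simp
    show ?thesis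
    proof (cases "\<exists>\<sigma> \<pi>. \<sigma> permutes {1..m} \<and> \<pi> permutes {1..n} \<and> \<rho> = perm_pcomp m n i \<sigma> \<pi>")
      case True
      then obtain \<sigma> \<pi> where p: "\<sigma> permutes {1..m}" "\<pi> permutes {1..n}"
        "\<rho> = perm_pcomp m n i \<sigma> \<pi>" by blast
      show ?thesis unfolding p(3) symmetrization_pcomp[OF i p(1,2) u v] comp[OF p(1,2)] ..
    next
      case False
      then have no: "\<rho> \<noteq> perm_pcomp m n i \<sigma> \<pi>" if "\<sigma> permutes {1..m}" "\<pi> permutes {1..n}" for \<sigma> \<pi>
        using that by blast
      show ?thesis
        by (rule trans[OF symmetrization_pcomp_zero[OF i(1,2) \<rho> no] zero[OF \<rho> no, symmetric]])
    qed
  qed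
qed

lemma symmetrization_linear_left:
  assumes i: "1 \<le> i" "i \<le> m" "1 \<le> n" and v: "v \<in> elems S n"
  shows "linear_on (comps S m) (comps S (m + n - 1))
    (\<lambda>u. pcomp S m n i u v)"
proof (rule linear_onI)
  have N: "1 \<le> m" "1 \<le> m + n - 1" using i by auto
  interpret V: module rat_field "comps P (m + n - 1)" by (rule vector_space[OF N(2)])
  fix u assume u: "u \<in> elems S m"
  show "pcomp S m n i u v \<in> elems S (m + n - 1)"
    using symmetrization_pcomp_closed[OF i u v] by simp
  have vp: "v \<pi> \<in> elems P n" if "\<pi> permutes {1..n}" for \<pi> using v that by (auto simp: PiE_iff)
  have up: "u \<sigma> \<in> elems P m" if "\<sigma> permutes {1..m}" for \<sigma> using u that by (auto simp: PiE_iff)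
  note L = pcomp_linear_left[OF perm_inv_bounds[OF _ i(1,2)] i(3) vp]
  show "pcomp S m n i (c \<odot>\<^bsub>comps S m\<^esub> u) v =
    c \<odot>\<^bsub>comps S (m + n - 1)\<^esub> pcomp S m n i u v" for c
  proof (rule symmetrization_pcomp_eqI[OF i _ v])
    show "c \<odot>\<^bsub>comps S m\<^esub> u \<in> elems S m"
      using up comps_closed(5)[OF N(1)] by auto
  qed (use up linear_onD(3)[OF L] V.smult_r_null in \<open>simp_all add: symmetrization_pcomp[OF i _ _ u v]
      symmetrization_pcomp_zero[OF i(1,2)] perm_pcomp_permutes[OF i] del: One_nat_def\<close>)
  fix u' assume u': "u' \<in> elems S m"
  have up': "u' \<sigma> \<in> elems P m" if "\<sigma> permutes {1..m}" for \<sigma> using u' that by (auto simp: PiE_iff)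
  show "pcomp S m n i (u \<oplus>\<^bsub>comps S m\<^esub> u') v =
    pcomp S m n i u v \<oplus>\<^bsub>comps S (m + n - 1)\<^esub>
    pcomp S m n i u' v"
  proof (rule symmetrization_pcomp_eqI[OF i _ v])
    show "u \<oplus>\<^bsub>comps S m\<^esub> u' \<in> elems S m"
      using up up' comps_closed(4)[OF N(1)] by auto
  qed (use up up' linear_onD(2)[OF L] in \<open>simp_all add: symmetrization_pcomp[OF i _ _ u v]
      symmetrization_pcomp[OF i _ _ u' v]
      symmetrization_pcomp_zero[OF i(1,2)] perm_pcomp_permutes[OF i] del: One_nat_def\<close>)
qed

lemma symmetrization_linear_right:
  assumes i: "1 \<le> i" "i \<le> m" "1 \<le> n" and u: "u \<in> elems S m"
  shows "linear_on (comps S n) (comps S (m + n - 1))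
    (\<lambda>v. pcomp S m n i u v)"
proof (rule linear_onI)
  have N: "1 \<le> m + n - 1" using i by auto
  interpret V: module rat_field "comps P (m + n - 1)" by (rule vector_space[OF N])
  fix v assume v: "v \<in> elems S n"
  show "pcomp S m n i u v \<in> elems S (m + n - 1)"
    using symmetrization_pcomp_closed[OF i u v] by simp
  have vp: "v \<pi> \<in> elems P n" if "\<pi> permutes {1..n}" for \<pi> using v that by (auto simp: PiE_iff)
  have up: "u \<sigma> \<in> elems P m" if "\<sigma> permutes {1..m}" for \<sigma> using u that by (auto simp: PiE_iff)
  note L = pcomp_linear_right[OF perm_inv_bounds[OF _ i(1,2)] i(3) up]
  show "pcomp S m n i u (c \<odot>\<^bsub>comps S n\<^esub> v) =
    c \<odot>\<^bsub>comps S (m + n - 1)\<^esub> pcomp S m n i u v" for c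
  proof (rule symmetrization_pcomp_eqI[OF i u])
    show "c \<odot>\<^bsub>comps S n\<^esub> v \<in> elems S n"
      using vp comps_closed(5)[OF i(3)] by auto
  qed (use vp linear_onD(3)[OF L] V.smult_r_null in \<open>simp_all add: symmetrization_pcomp[OF i _ _ u v]
      symmetrization_pcomp_zero[OF i(1,2)] perm_pcomp_permutes[OF i] del: One_nat_def\<close>)
  fix v' assume v': "v' \<in> elems S n"
  have vp': "v' \<pi> \<in> elems P n" if "\<pi> permutes {1..n}" for \<pi> using v' that by (auto simp: PiE_iff)
  show "pcomp S m n i u (v \<oplus>\<^bsub>comps S n\<^esub> v') =
    pcomp S m n i u v \<oplus>\<^bsub>comps S (m + n - 1)\<^esub>
    pcomp S m n i u v'"
  proof (rule symmetrization_pcomp_eqI[OF i u])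
    show "v \<oplus>\<^bsub>comps S n\<^esub> v' \<in> elems S n"
      using vp vp' comps_closed(4)[OF i(3)] by auto
  qed (use vp vp' linear_onD(2)[OF L] in \<open>simp_all add: symmetrization_pcomp[OF i _ _ u v]
      symmetrization_pcomp[OF i _ _ u v']
      symmetrization_pcomp_zero[OF i(1,2)] perm_pcomp_permutes[OF i] del: One_nat_def\<close>)
qed

text \<open>An iterated composite can only have a non-zero coefficient at an iterated composite of
  permutations. So the two sides of an associativity axiom have to be compared at those only.\<close>

lemma symmetrization_pcomp_left_zero:
  assumes i: "1 \<le> i" "i \<le> l" "1 \<le> m" "1 \<le> k" "k \<le> l + m - 1" "1 \<le> n"
    and u: "u \<in> elems S l" and v: "v \<in> elems S m"
    and w: "w \<in> elems S n" and \<rho>: "\<rho> permutes {1..l + m - 1 + n - 1}"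
    and no: "\<And>\<sigma> \<pi> \<kappa>. \<lbrakk>\<sigma> permutes {1..l}; \<pi> permutes {1..m}; \<kappa> permutes {1..n}\<rbrakk> \<Longrightarrow>
      \<rho> \<noteq> perm_pcomp (l + m - 1) n k (perm_pcomp l m i \<sigma> \<pi>) \<kappa>"
  shows "pcomp S (l + m - 1) n k (pcomp S l m i u v) w \<rho> =
    \<zero>\<^bsub>comps P (l + m - 1 + n - 1)\<^esub>"
proof (cases "\<exists>\<theta> \<kappa>. \<theta> permutes {1..l + m - 1} \<and> \<kappa> permutes {1..n} \<and> \<rho> = perm_pcomp (l + m - 1) n k \<theta> \<kappa>")
  case True
  then obtain \<theta> \<kappa> where \<theta>: "\<theta> permutes {1..l + m - 1}" "\<kappa> permutes {1..n}"
    "\<rho> = perm_pcomp (l + m - 1) n k \<theta> \<kappa>" by blast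
  have "pcomp S l m i u v \<theta> = \<zero>\<^bsub>comps P (l + m - 1)\<^esub>"
    using no \<theta> by (intro symmetrization_pcomp_zero[OF i(1,2)]) blast+
  moreover have "w \<kappa> \<in> elems P n" using w \<theta>(2) by (auto simp: PiE_iff)
  moreover have "pcomp S l m i u v \<in> elems S (l + m - 1)"
    using symmetrization_pcomp_closed[OF i(1-3) u v] by simp
  ultimately show ?thesis
    using symmetrization_pcomp[OF i(4,5,6) \<theta>(1,2) _ w] \<theta>(3)
      pcomp_zero(1)[OF perm_inv_bounds[OF \<theta>(1) i(4,5)] i(6)] by (simp del: One_nat_def)
next
  case False
  then show ?thesis
    by (intro symmetrization_pcomp_zero[OF i(4,5) \<rho>]) blast
qed

lemma symmetrization_pcomp_right_zero:
  assumes i: "1 \<le> i" "i \<le> l" "1 \<le> j" "j \<le> m" "1 \<le> n"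
    and u: "u \<in> elems S l" and v: "v \<in> elems S m"
    and w: "w \<in> elems S n" and \<rho>: "\<rho> permutes {1..l + (m + n - 1) - 1}"
    and no: "\<And>\<sigma> \<pi> \<kappa>. \<lbrakk>\<sigma> permutes {1..l}; \<pi> permutes {1..m}; \<kappa> permutes {1..n}\<rbrakk> \<Longrightarrow>
      \<rho> \<noteq> perm_pcomp l (m + n - 1) i \<sigma> (perm_pcomp m n j \<pi> \<kappa>)"
  shows "pcomp S l (m + n - 1) i u (pcomp S m n j v w) \<rho> =
    \<zero>\<^bsub>comps P (l + (m + n - 1) - 1)\<^esub>"
proof (cases "\<exists>\<sigma> \<theta>. \<sigma> permutes {1..l} \<and> \<theta> permutes {1..m + n - 1} \<and> \<rho> = perm_pcomp l (m + n - 1) i \<sigma> \<theta>")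
  case True
  then obtain \<sigma> \<theta> where \<theta>: "\<sigma> permutes {1..l}" "\<theta> permutes {1..m + n - 1}"
    "\<rho> = perm_pcomp l (m + n - 1) i \<sigma> \<theta>" by blast
  have mn: "1 \<le> m + n - 1" using i by simp
  have "pcomp S m n j v w \<theta> = \<zero>\<^bsub>comps P (m + n - 1)\<^esub>"
    using no \<theta> by (intro symmetrization_pcomp_zero[OF i(3,4)]) blast+
  moreover have "u \<sigma> \<in> elems P l" using u \<theta>(1) by (auto simp: PiE_iff)
  moreover have "pcomp S m n j v w \<in> elems S (m + n - 1)"
    using symmetrization_pcomp_closed[OF i(3-5) v w] by simp
  ultimately show ?thesis
    using symmetrization_pcomp[OF i(1,2) mn \<theta>(1,2) u] \<theta>(3)
      pcomp_zero(2)[OF perm_inv_bounds[OF \<theta>(1) i(1,2)] mn] by (simp del: One_nat_def)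
next
  case False
  then show ?thesis
    by (intro symmetrization_pcomp_zero[OF i(1,2) \<rho>]) blast
qed


lemma symmetrization_assoc_sequential:
  assumes i: "1 \<le> i" "i \<le> l" "1 \<le> j" "j \<le> m" "1 \<le> n"
    and u: "u \<in> elems S l" and v: "v \<in> elems S m"
    and w: "w \<in> elems S n"
  shows "pcomp S (l + m - 1) n (i + j - 1) (pcomp S l m i u v) w =
    pcomp S l (m + n - 1) i u (pcomp S m n j v w)"
    (is "?L = ?R")
proof
  fix \<rho>
  have m: "1 \<le> m" "1 \<le> m + n - 1" and N: "l + (m + n - 1) - 1 = l + m - 1 + n - 1" using i by auto
  have ij: "1 \<le> i + j - 1" "i + j - 1 \<le> l + m - 1" using i by auto
  have uv: "pcomp S l m i u v \<in> elems S (l + m - 1)"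
    using symmetrization_pcomp_closed[OF i(1,2) m(1) u v] by simp
  have vw: "pcomp S m n j v w \<in> elems S (m + n - 1)"
    using symmetrization_pcomp_closed[OF i(3-5) v w] by simp
  note triple = perm_pcomp_sequential[OF i]
  show "?L \<rho> = ?R \<rho>"
  proof (cases "\<rho> \<in> perms (l + m - 1 + n - 1)")
    case False
    then have False': "\<rho> \<notin> perms (l + (m + n - 1) - 1)" by (simp only: N not_False_eq_True)
    show ?thesis
      by (simp only: PiE_arb[OF symmetrization_pcomp_closed[OF ij i(5) uv w] False]
          PiE_arb[OF symmetrization_pcomp_closed[OF i(1,2) m(2) u vw] False'])
  next
    case True
    then have \<rho>: "\<rho> permutes {1..l + m - 1 + n - 1}" by simp
    then have \<rho>': "\<rho> permutes {1..l + (m + n - 1) - 1}" by (simp only: N)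
    show ?thesis
    proof (cases "\<exists>\<sigma> \<pi> \<kappa>. \<sigma> permutes {1..l} \<and> \<pi> permutes {1..m} \<and> \<kappa> permutes {1..n} \<and>
        \<rho> = perm_pcomp (l + m - 1) n (i + j - 1) (perm_pcomp l m i \<sigma> \<pi>) \<kappa>")
      case True
      then obtain \<sigma> \<pi> \<kappa> where p: "\<sigma> permutes {1..l}" "\<pi> permutes {1..m}" "\<kappa> permutes {1..n}"
        and eq: "\<rho> = perm_pcomp (l + m - 1) n (i + j - 1) (perm_pcomp l m i \<sigma> \<pi>) \<kappa>" by blast
      note \<sigma>\<pi> = perm_pcomp_permutes[OF i(1,2) m(1) p(1,2)] and \<pi>\<kappa> = perm_pcomp_permutes[OF i(3-5) p(2,3)]
      have el: "u \<sigma> \<in> elems P l" "v \<pi> \<in> elems P m" "w \<kappa> \<in> elems P n"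
        using u v w p by (auto simp: PiE_iff)
      have inv: "perm_inv (perm_pcomp l m i \<sigma> \<pi>) (i + j - 1) = perm_inv \<sigma> i + perm_inv \<pi> j - 1"
        using perm_pcomp_inv_inner[OF i(1-4) p(1,2)] by (simp add: inner_pos_def)
      have "?L \<rho> = pcomp P (l + m - 1) n (perm_inv \<sigma> i + perm_inv \<pi> j - 1)
          (pcomp P l m (perm_inv \<sigma> i) (u \<sigma>) (v \<pi>)) (w \<kappa>)"
        unfolding eq symmetrization_pcomp[OF ij i(5) \<sigma>\<pi> p(3) uv w] inv
          symmetrization_pcomp[OF i(1,2) m(1) p(1,2) u v] ..
      also have "\<dots> = pcomp P l (m + n - 1) (perm_inv \<sigma> i) (u \<sigma>)
          (pcomp P m n (perm_inv \<pi> j) (v \<pi>) (w \<kappa>))"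
        by (intro assoc_sequential perm_inv_bounds[OF p(1) i(1,2)] perm_inv_bounds[OF p(2) i(3,4)] i(5) el)
      also have "\<dots> = ?R \<rho>"
        unfolding eq triple[OF p] symmetrization_pcomp[OF i(1,2) m(2) p(1) \<pi>\<kappa> u vw]
          symmetrization_pcomp[OF i(3-5) p(2,3) v w] ..
      finally show ?thesis .
    next
      case False
      have "?L \<rho> = \<zero>\<^bsub>comps P (l + m - 1 + n - 1)\<^esub>"
        by (rule symmetrization_pcomp_left_zero[OF i(1,2) m(1) ij i(5) u v w \<rho>]) (use False in blast)
      moreover have "?R \<rho> = \<zero>\<^bsub>comps P (l + (m + n - 1) - 1)\<^esub>"
      proof (rule symmetrization_pcomp_right_zero[OF i u v w \<rho>'])
        fix \<sigma> \<pi> \<kappa> assume p: "\<sigma> permutes {1..l}" "\<pi> permutes {1..m}" "\<kappa> permutes {1..n}"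
        show "\<rho> \<noteq> perm_pcomp l (m + n - 1) i \<sigma> (perm_pcomp m n j \<pi> \<kappa>)"
          unfolding triple[OF p, symmetric] using False p by blast
      qed
      ultimately show ?thesis by (simp only: N)
    qed
  qed
qed

lemma symmetrization_assoc_parallel:
  assumes i: "1 \<le> i" "i < k" "k \<le> l" "1 \<le> m" "1 \<le> n"
    and u: "u \<in> elems S l" and v: "v \<in> elems S m"
    and w: "w \<in> elems S n"
  shows "pcomp S (l + m - 1) n (k + m - 1) (pcomp S l m i u v) w =
    pcomp S (l + n - 1) m i (pcomp S l n k u w) v"
    (is "?L = ?R")
proof
  fix \<rho>
  have i': "i \<le> l" "1 \<le> k" "i \<noteq> k" and N: "l + n - 1 + m - 1 = l + m - 1 + n - 1" using i by auto
  have k': "1 \<le> k + m - 1" "k + m - 1 \<le> l + m - 1" "i \<le> l + n - 1" using i by auto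
  have out: "outer_pos m i k = k + m - 1" "outer_pos n k i = i" using i by (auto simp: outer_pos_def)
  have uv: "pcomp S l m i u v \<in> elems S (l + m - 1)"
    using symmetrization_pcomp_closed[OF i(1) i'(1) i(4) u v] by simp
  have uw: "pcomp S l n k u w \<in> elems S (l + n - 1)"
    using symmetrization_pcomp_closed[OF i'(2) i(3,5) u w] by simp
  note triple = perm_pcomp_parallel[OF i(1) i'(1,2) i(3) i'(3) i(4,5), unfolded out]
  show "?L \<rho> = ?R \<rho>"
  proof (cases "\<rho> \<in> perms (l + m - 1 + n - 1)")
    case False
    then have False': "\<rho> \<notin> perms (l + n - 1 + m - 1)" by (simp only: N not_False_eq_True)
    show ?thesis
      by (simp only: PiE_arb[OF symmetrization_pcomp_closed[OF k'(1,2) i(5) uv w] False]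
          PiE_arb[OF symmetrization_pcomp_closed[OF i(1) k'(3) i(4) uw v] False'])
  next
    case True
    then have \<rho>: "\<rho> permutes {1..l + m - 1 + n - 1}" by simp
    then have \<rho>': "\<rho> permutes {1..l + n - 1 + m - 1}" by (simp only: N)
    show ?thesis
    proof (cases "\<exists>\<sigma> \<pi> \<kappa>. \<sigma> permutes {1..l} \<and> \<pi> permutes {1..m} \<and> \<kappa> permutes {1..n} \<and>
        \<rho> = perm_pcomp (l + m - 1) n (k + m - 1) (perm_pcomp l m i \<sigma> \<pi>) \<kappa>")
      case True
      then obtain \<sigma> \<pi> \<kappa> where p: "\<sigma> permutes {1..l}" "\<pi> permutes {1..m}" "\<kappa> permutes {1..n}"
        and eq: "\<rho> = perm_pcomp (l + m - 1) n (k + m - 1) (perm_pcomp l m i \<sigma> \<pi>) \<kappa>" by blast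
      note \<sigma>\<pi> = perm_pcomp_permutes[OF i(1) i'(1) i(4) p(1,2)]
        and \<sigma>\<kappa> = perm_pcomp_permutes[OF i'(2) i(3,5) p(1,3)]
      have el: "u \<sigma> \<in> elems P l" "v \<pi> \<in> elems P m" "w \<kappa> \<in> elems P n"
        using u v w p by (auto simp: PiE_iff)
      let ?a = "perm_inv \<sigma> i" and ?c = "perm_inv \<sigma> k"
      note a = perm_inv_bounds[OF p(1) i(1) i'(1)] and c = perm_inv_bounds[OF p(1) i'(2) i(3)]
      have ac: "?a \<noteq> ?c" using i'(3) injD[OF permutes_inj[OF permutes_inv[OF p(1)]], of i k] by blast
      have inv: "perm_inv (perm_pcomp l m i \<sigma> \<pi>) (k + m - 1) = outer_pos m ?a ?c"
          "perm_inv (perm_pcomp l n k \<sigma> \<kappa>) i = outer_pos n ?c ?a"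
        using perm_pcomp_inv_outer[OF i(1) i'(1) i(4) i'(2) i(3) i'(3)[symmetric] p(1,2)]
          perm_pcomp_inv_outer[OF i'(2) i(3,5,1) i'(1) i'(3) p(1,3)] by (simp_all only: out)
      have "?L \<rho> = pcomp P (l + m - 1) n (outer_pos m ?a ?c) (pcomp P l m ?a (u \<sigma>) (v \<pi>)) (w \<kappa>)"
        unfolding eq symmetrization_pcomp[OF k'(1,2) i(5) \<sigma>\<pi> p(3) uv w] inv
          symmetrization_pcomp[OF i(1) i'(1) i(4) p(1,2) u v] ..
      also have "\<dots> = pcomp P (l + n - 1) m (outer_pos n ?c ?a) (pcomp P l n ?c (u \<sigma>) (w \<kappa>)) (v \<pi>)"
      proof (cases "?a < ?c")
        case True
        then show ?thesis
          using assoc_parallel[OF a(1) True c(2) i(4,5) el] by (simp add: outer_pos_def)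
      next
        case False
        then have "?c < ?a" using ac by simp
        then show ?thesis
          using assoc_parallel[OF c(1) _ a(2) i(5,4) el(1,3,2)] by (simp add: outer_pos_def)
      qed
      also have "\<dots> = ?R \<rho>"
        unfolding eq triple[OF p] symmetrization_pcomp[OF i(1) k'(3) i(4) \<sigma>\<kappa> p(2) uw v] inv
          symmetrization_pcomp[OF i'(2) i(3,5) p(1,3) u w] ..
      finally show ?thesis .
    next
      case False
      have "?L \<rho> = \<zero>\<^bsub>comps P (l + m - 1 + n - 1)\<^esub>"
        by (rule symmetrization_pcomp_left_zero[OF i(1) i'(1) i(4) k'(1,2) i(5) u v w \<rho>]) (use False in blast)
      moreover have "?R \<rho> = \<zero>\<^bsub>comps P (l + n - 1 + m - 1)\<^esub>"
      proof (rule symmetrization_pcomp_left_zero[OF i'(2) i(3,5,1) k'(3) i(4) u w v \<rho>'])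
        fix \<sigma> \<kappa> \<pi> assume p: "\<sigma> permutes {1..l}" "\<kappa> permutes {1..n}" "\<pi> permutes {1..m}"
        show "\<rho> \<noteq> perm_pcomp (l + n - 1) m i (perm_pcomp l n k \<sigma> \<kappa>) \<pi>"
          unfolding triple[OF p(1,3,2), symmetric] using False p by blast
      qed
      ultimately show ?thesis by (simp only: N)
    qed
  qed
qed

lemma symmetrization_equivariant:
  assumes i: "1 \<le> i" "i \<le> m" "1 \<le> n" and p: "\<sigma> permutes {1..m}" "\<pi> permutes {1..n}"
    and u: "u \<in> elems S m" and v: "v \<in> elems S n"
  shows "pcomp S m n i (sact S m \<sigma> u) (sact S n \<pi> v) =
    sact S (m + n - 1) (perm_pcomp m n i \<sigma> \<pi>)
      (pcomp S m n (perm_inv \<sigma> i) u v)"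
proof (rule symmetrization_pcomp_eqI[OF i])
  let ?\<theta> = "perm_pcomp m n i \<sigma> \<pi>" and ?j = "perm_inv \<sigma> i"
  note \<theta> = perm_pcomp_permutes[OF i p] and j = perm_inv_bounds[OF p(1) i(1,2)]
  note inv = permutes_inv[OF p(1)] permutes_inv[OF p(2)] permutes_inv[OF \<theta>]
  show "sact S m \<sigma> u \<in> elems S m"
    using u permutes_compose[OF _ inv(1)] by (auto simp: PiE_iff)
  show "sact S n \<pi> v \<in> elems S n"
    using v permutes_compose[OF _ inv(2)] by (auto simp: PiE_iff)
  show "sact S (m + n - 1) ?\<theta> (pcomp S m n ?j u v) \<in>
      extensional (perms (m + n - 1))"
    by simp
  {
    fix \<sigma>' \<pi>' assume p': "\<sigma>' permutes {1..m}" "\<pi>' permutes {1..n}"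
    note \<theta>' = perm_pcomp_permutes[OF i p']
    let ?\<sigma> = "perm_inv \<sigma> \<circ> \<sigma>'" and ?\<pi> = "perm_inv \<pi> \<circ> \<pi>'"
    note q = permutes_compose[OF p'(1) inv(1)] permutes_compose[OF p'(2) inv(2)]
    have canc: "\<sigma> \<circ> ?\<sigma> = \<sigma>'" "\<pi> \<circ> ?\<pi> = \<pi>'"
      using permutes_inverses[OF p(1)] permutes_inverses[OF p(2)] by (simp_all add: fun_eq_iff)
    have "perm_pcomp m n i \<sigma>' \<pi>' = ?\<theta> \<circ> perm_pcomp m n ?j ?\<sigma> ?\<pi>"
      using perm_pcomp_compose[OF i p q] by (simp only: canc)
    then have eq: "perm_inv ?\<theta> \<circ> perm_pcomp m n i \<sigma>' \<pi>' = perm_pcomp m n ?j ?\<sigma> ?\<pi>"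
      using permutes_inverses[OF \<theta>] by (simp add: fun_eq_iff)
    have "?\<sigma> (perm_inv \<sigma>' i) = ?j" using permutes_inverses[OF p'(1)] by simp
    then have inv': "perm_inv ?\<sigma> ?j = perm_inv \<sigma>' i" using permutes_inv_eq[OF q(1)] by blast
    show "sact S (m + n - 1) ?\<theta> (pcomp S m n ?j u v)
        (perm_pcomp m n i \<sigma>' \<pi>') =
      pcomp P m n (perm_inv \<sigma>' i) (sact S m \<sigma> u \<sigma>') (sact S n \<pi> v \<pi>')"
      using p' \<theta>' symmetrization_pcomp[OF j i(3) q u v] by (simp add: eq inv' del: One_nat_def)
  }
  fix \<rho> assume \<rho>: "\<rho> permutes {1..m + n - 1}"
    and no: "\<And>\<sigma> \<pi>. \<lbrakk>\<sigma> permutes {1..m}; \<pi> permutes {1..n}\<rbrakk> \<Longrightarrow> \<rho> \<noteq> perm_pcomp m n i \<sigma> \<pi>"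
  have "pcomp S m n ?j u v (perm_inv ?\<theta> \<circ> \<rho>) = \<zero>\<^bsub>comps P (m + n - 1)\<^esub>"
  proof (rule symmetrization_pcomp_zero[OF j permutes_compose[OF \<rho> inv(3)]])
    fix \<sigma>' \<pi>' assume p': "\<sigma>' permutes {1..m}" "\<pi>' permutes {1..n}"
    show "perm_inv ?\<theta> \<circ> \<rho> \<noteq> perm_pcomp m n ?j \<sigma>' \<pi>'"
    proof
      assume "perm_inv ?\<theta> \<circ> \<rho> = perm_pcomp m n ?j \<sigma>' \<pi>'"
      then have "?\<theta> \<circ> (perm_inv ?\<theta> \<circ> \<rho>) = perm_pcomp m n i (\<sigma> \<circ> \<sigma>') (\<pi> \<circ> \<pi>')"
        using perm_pcomp_compose[OF i p p'] by simp
      moreover have "?\<theta> \<circ> (perm_inv ?\<theta> \<circ> \<rho>) = \<rho>"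
        using permutes_inverses[OF \<theta>] by (simp add: fun_eq_iff)
      ultimately show False
        using no[OF permutes_compose[OF p'(1) p(1)] permutes_compose[OF p'(2) p(2)]] by simp
    qed
  qed
  then show "sact S (m + n - 1) ?\<theta> (pcomp S m n ?j u v) \<rho> =
      \<zero>\<^bsub>comps P (m + n - 1)\<^esub>"
    using \<rho> by (simp del: One_nat_def)
qed

lemma symmetrization_unit_closed: "unit S \<in> elems S 1"
  using unit_closed comps_closed(1)[of 1] by (auto simp: pure_tensor_def)

lemma symmetrization_ns_operad: "ns_operad S"
proof (rule ns_operad.intro)
  show "unit S \<in> elems S 1" by (rule symmetrization_unit_closed)
  show "pcomp S 1 n 1 (unit S) u = u"
    if n: "1 \<le> n" and u: "u \<in> elems S n" for n u
  proof (rule symmetrization_pcomp_eqI[OF order_refl order_refl n symmetrization_unit_closed u])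
    show "u \<in> extensional (perms (1 + n - 1))" using u by (simp add: PiE_iff)
    fix \<sigma> \<pi> :: "nat \<Rightarrow> nat" assume p: "\<sigma> permutes {1..1}" "\<pi> permutes {1..n}"
    then have "\<sigma> = id" using perms_1 by blast
    moreover have "u \<pi> \<in> elems P n" using u p(2) by (auto simp: PiE_iff)
    ultimately show "u (perm_pcomp 1 n 1 \<sigma> \<pi>) =
        pcomp P 1 n (perm_inv \<sigma> 1) (unit S \<sigma>) (u \<pi>)"
      using perm_pcomp_id_left[OF n p(2)] unit_left[OF n]
      by (simp add: pure_tensor_def permutes_id inv_id del: One_nat_def)
  next
    fix \<rho> :: "nat \<Rightarrow> nat" assume "\<rho> permutes {1..1 + n - 1}"
      and no: "\<And>\<sigma> \<pi>. \<lbrakk>\<sigma> permutes {1..1 :: nat}; \<pi> permutes {1..n}\<rbrakk> \<Longrightarrow> \<rho> \<noteq> perm_pcomp 1 n 1 \<sigma> \<pi>"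
    then have "\<rho> permutes {1..n}" by simp
    then show "u \<rho> = \<zero>\<^bsub>comps P (1 + n - 1)\<^esub>"
      using no[OF permutes_id] perm_pcomp_id_left[OF n] by metis
  qed
  show "pcomp S n 1 i u (unit S) = u"
    if i: "1 \<le> i" "i \<le> n" and u: "u \<in> elems S n" for i n u
  proof (rule symmetrization_pcomp_eqI[OF i order_refl u symmetrization_unit_closed])
    show "u \<in> extensional (perms (n + 1 - 1))" using u by (simp add: PiE_iff)
    fix \<sigma> \<pi> :: "nat \<Rightarrow> nat" assume p: "\<sigma> permutes {1..n}" "\<pi> permutes {1..1}"
    then have "\<pi> = id" using perms_1 by blast
    moreover have "u \<sigma> \<in> elems P n" using u p(1) by (auto simp: PiE_iff)
    ultimately show "u (perm_pcomp n 1 i \<sigma> \<pi>) =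
        pcomp P n 1 (perm_inv \<sigma> i) (u \<sigma>) (unit S \<pi>)"
      using perm_pcomp_id_right[OF i p(1)] unit_right[OF perm_inv_bounds[OF p(1) i]]
      by (simp add: pure_tensor_def permutes_id del: One_nat_def)
  next
    fix \<rho> :: "nat \<Rightarrow> nat" assume "\<rho> permutes {1..n + 1 - 1}"
      and no: "\<And>\<sigma> \<pi>. \<lbrakk>\<sigma> permutes {1..n}; \<pi> permutes {1..1 :: nat}\<rbrakk> \<Longrightarrow> \<rho> \<noteq> perm_pcomp n 1 i \<sigma> \<pi>"
    then have "\<rho> permutes {1..n}" by simp
    then show "u \<rho> = \<zero>\<^bsub>comps P (n + 1 - 1)\<^esub>"
      using no[OF _ permutes_id] perm_pcomp_id_right[OF i] by metis
  qed
qed (fact symmetrization_module symmetrization_linear_left symmetrization_linear_right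
    symmetrization_assoc_sequential symmetrization_assoc_parallel)+

lemma symmetrization_sym_operad: "sym_operad S"
proof (rule sym_operad.intro[OF symmetrization_ns_operad], rule sym_operad_axioms.intro)
  fix n :: nat assume n: "1 \<le> n"
  show "linear_on (comps S n) (comps S n) (sact S n \<sigma>)"
    if \<sigma>: "\<sigma> permutes {1..n}" for \<sigma>
  proof -
    note inv = permutes_compose[OF _ permutes_inv[OF \<sigma>]]
    show ?thesis
      by (rule linear_onI) (auto simp: PiE_iff inv simp del: One_nat_def cong: restrict_cong)
  qed
  fix u assume u: "u \<in> elems S n"
  show "sact S n id u = u"
    using u by (intro ext) (auto simp: PiE_def extensional_def)
  show "sact S n (\<sigma> \<circ> \<pi>) u = sact S n \<sigma> (sact S n \<pi> u)"
    if p: "\<sigma> permutes {1..n}" "\<pi> permutes {1..n}" for \<sigma> \<pi>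
  proof -
    have "perm_inv (\<sigma> \<circ> \<pi>) = perm_inv \<pi> \<circ> perm_inv \<sigma>"
      using p by (intro o_inv_distrib permutes_bij)
    then show ?thesis
      using permutes_compose[OF _ permutes_inv[OF p(1)]]
      by (simp add: comp_assoc cong: restrict_cong)
  qed
qed (fact symmetrization_equivariant)

end

section \<open>The induced action of the symmetric groups\<close>

lemma (in ns_operad) uminus_uminus:
  assumes "1 \<le> n" "x \<in> elems P n"
  shows "\<ominus>\<^bsub>comps P n\<^esub> (\<ominus>\<^bsub>comps P n\<^esub> x) = x"
proof -
  interpret V: module rat_field "comps P n" using vector_space[OF assms(1)] .
  show ?thesis using assms(2) by simp
qed

context ns_anticyclic_operad
begin

abbreviation act :: "nat \<Rightarrow> (nat \<Rightarrow> nat) \<Rightarrow> ((nat \<Rightarrow> nat) \<Rightarrow> 'a) \<Rightarrow> ((nat \<Rightarrow> nat) \<Rightarrow> 'a)"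
  where "act \<equiv> induced_action P \<tau>"

lemma tau_pow_closed: "\<lbrakk>1 \<le> n; x \<in> elems P n\<rbrakk> \<Longrightarrow> (\<tau> n ^^ k) x \<in> elems P n"
  using linear_onD(1)[OF linear_on_funpow[OF tau_linear]] by blast

lemma tau_pow_uminus:
  "\<lbrakk>1 \<le> n; x \<in> elems P n\<rbrakk> \<Longrightarrow> (\<tau> n ^^ k) (\<ominus>\<^bsub>comps P n\<^esub> x) = \<ominus>\<^bsub>comps P n\<^esub> (\<tau> n ^^ k) x"
  by (rule linear_on_uminus[OF vector_space vector_space linear_on_funpow[OF tau_linear]])

lemma tau_pcomp:
  assumes "1 \<le> m" "1 \<le> n" "f \<in> elems P m" "g \<in> elems P n"
  shows "\<lbrakk>2 \<le> i; i \<le> m\<rbrakk> \<Longrightarrow>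
      \<tau> (m + n - 1) (pcomp P m n i f g) = pcomp P m n (i - 1) (\<tau> m f) g"
    and "\<tau> (m + n - 1) (pcomp P m n 1 f g) =
      \<ominus>\<^bsub>comps P (m + n - 1)\<^esub> pcomp P n m n (\<tau> n g) (\<tau> m f)"
  using tau_identities assms unfolding anticyclic_identities_def by blast+

text \<open>Iterating the two identities, the powers of \<open>\<tau>\<close> first move the place of insertion down to the
  first input, then pass to the inner operation, and finally return to the outer one.\<close>

lemma tau_pow_pcomp_below:
  assumes mn: "1 \<le> n" "f \<in> elems P m" "g \<in> elems P n" and a: "k < a" "a \<le> m"
  shows "(\<tau> (m + n - 1) ^^ k) (pcomp P m n a f g) = pcomp P m n (a - k) ((\<tau> m ^^ k) f) g"
  using a(1)
proof (induction k)
  case (Suc k)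
  have m: "1 \<le> m" using a by simp
  have "2 \<le> a - k" "a - k \<le> m" using Suc.prems a by auto
  then have "\<tau> (m + n - 1) (pcomp P m n (a - k) ((\<tau> m ^^ k) f) g) =
      pcomp P m n (a - k - 1) (\<tau> m ((\<tau> m ^^ k) f)) g"
    by (rule tau_pcomp(1)[OF m mn(1) tau_pow_closed[OF m mn(2)] mn(3)])
  then show ?case using Suc by simp
qed simp

lemma tau_pow_pcomp_inner:
  assumes mn: "f \<in> elems P m" "g \<in> elems P n" and a: "1 \<le> a" "a \<le> m" and b: "1 \<le> b" "b \<le> n"
  shows "(\<tau> (m + n - 1) ^^ (a + b - 1)) (pcomp P m n a f g) =
    \<ominus>\<^bsub>comps P (m + n - 1)\<^esub> pcomp P n m (n + 1 - b) ((\<tau> n ^^ b) g) ((\<tau> m ^^ a) f)"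
proof -
  have m: "1 \<le> m" and n: "1 \<le> n" and N: "1 \<le> m + n - 1" using a b by auto
  let ?\<tau> = "\<tau> (m + n - 1)" and ?neg = "\<lambda>x. \<ominus>\<^bsub>comps P (m + n - 1)\<^esub> x"
  note cf = tau_pow_closed[OF m mn(1)] and cg = tau_pow_closed[OF n mn(2)]
  have comm: "n + m - 1 = m + n - 1" by simp
  have "(?\<tau> ^^ (a - 1)) (pcomp P m n a f g) = pcomp P m n 1 ((\<tau> m ^^ (a - 1)) f) g"
    using tau_pow_pcomp_below[OF n mn, of "a - 1" a] a by simp
  then have "(?\<tau> ^^ Suc (a - 1)) (pcomp P m n a f g) = ?\<tau> (pcomp P m n 1 ((\<tau> m ^^ (a - 1)) f) g)"
    by simp
  also have "\<dots> = ?neg (pcomp P n m n (\<tau> n g) (\<tau> m ((\<tau> m ^^ (a - 1)) f)))"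
    by (rule tau_pcomp(2)[OF m n cf mn(2)])
  also have "\<tau> m ((\<tau> m ^^ (a - 1)) f) = (\<tau> m ^^ a) f"
    using a by (cases a) simp_all
  finally have A: "(?\<tau> ^^ a) (pcomp P m n a f g) = ?neg (pcomp P n m n (\<tau> n g) ((\<tau> m ^^ a) f))"
    using a by simp
  have \<tau>g: "\<tau> n g \<in> elems P n" using cg[of 1] by simp
  have cl: "pcomp P n m n (\<tau> n g) ((\<tau> m ^^ a) f) \<in> elems P (m + n - 1)"
    using pcomp_closed[OF n order_refl m \<tau>g cf, of a] by (simp only: comm)
  have "a + b - 1 = (b - 1) + a" using b by simp
  then have "(?\<tau> ^^ (a + b - 1)) (pcomp P m n a f g) =
      (?\<tau> ^^ (b - 1)) ((?\<tau> ^^ a) (pcomp P m n a f g))"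
    by (simp only: funpow_add comp_apply)
  also have "\<dots> = ?neg ((?\<tau> ^^ (b - 1)) (pcomp P n m n (\<tau> n g) ((\<tau> m ^^ a) f)))"
    unfolding A by (rule tau_pow_uminus[OF N cl])
  also have "(?\<tau> ^^ (b - 1)) (pcomp P n m n (\<tau> n g) ((\<tau> m ^^ a) f)) =
      pcomp P n m (n - (b - 1)) ((\<tau> n ^^ (b - 1)) (\<tau> n g)) ((\<tau> m ^^ a) f)"
    using tau_pow_pcomp_below[OF m \<tau>g cf, of "b - 1" n a] b by (simp only: comm)
  also have "(\<tau> n ^^ (b - 1)) (\<tau> n g) = (\<tau> n ^^ b) g"
    using b funpow_swap1[of "\<tau> n" "b - 1" g] by (cases b) simp_all
  also have "n - (b - 1) = n + 1 - b" using b by simp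
  finally show ?thesis .
qed

lemma tau_pow_pcomp_above:
  assumes mn: "1 \<le> n" "f \<in> elems P m" "g \<in> elems P n" and a: "1 \<le> a" "a < k" "k \<le> m"
  shows "(\<tau> (m + n - 1) ^^ (k + n - 1)) (pcomp P m n a f g) =
    pcomp P m n (a + m + 1 - k) ((\<tau> m ^^ k) f) g"
proof -
  have m: "1 \<le> m" "a \<le> m" and N: "1 \<le> m + n - 1" using a by auto
  let ?\<tau> = "\<tau> (m + n - 1)" and ?neg = "\<lambda>x. \<ominus>\<^bsub>comps P (m + n - 1)\<^esub> x"
  note cf = tau_pow_closed[OF m(1) mn(2)] and cg = tau_pow_closed[OF mn(1,3)]
  have comm: "n + m - 1 = m + n - 1" by simp
  have cl: "pcomp P n m 1 ((\<tau> n ^^ n) g) ((\<tau> m ^^ a) f) \<in> elems P (m + n - 1)"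
    using pcomp_closed[OF order_refl mn(1) m(1) cg cf, of n a] by (simp only: comm)
  have cl': "pcomp P m n m (\<tau> m ((\<tau> m ^^ a) f)) g \<in> elems P (m + n - 1)"
    using pcomp_closed[OF m(1) order_refl mn(1) cf mn(3), of "Suc a"] by simp
  have "?\<tau> ((?\<tau> ^^ (a + n - 1)) (pcomp P m n a f g)) =
      ?\<tau> (?neg (pcomp P n m 1 ((\<tau> n ^^ n) g) ((\<tau> m ^^ a) f)))"
    using tau_pow_pcomp_inner[OF mn(2,3) a(1) m(2) mn(1) order_refl] by simp
  also have "\<dots> = ?neg (?\<tau> (pcomp P n m 1 ((\<tau> n ^^ n) g) ((\<tau> m ^^ a) f)))"
    using tau_pow_uminus[OF N cl, of 1] by simp
  also have "?\<tau> (pcomp P n m 1 ((\<tau> n ^^ n) g) ((\<tau> m ^^ a) f)) =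
      ?neg (pcomp P m n m (\<tau> m ((\<tau> m ^^ a) f)) (\<tau> n ((\<tau> n ^^ n) g)))"
    using tau_pcomp(2)[OF mn(1) m(1) cg cf, of n a] by (simp only: comm)
  also have "\<tau> n ((\<tau> n ^^ n) g) = g"
    using tau_power[OF mn(1,3)] by simp
  also have "?neg (?neg (pcomp P m n m (\<tau> m ((\<tau> m ^^ a) f)) g)) = pcomp P m n m ((\<tau> m ^^ Suc a) f) g"
    using uminus_uminus[OF N cl'] by simp
  finally have A: "(?\<tau> ^^ Suc (a + n - 1)) (pcomp P m n a f g) = pcomp P m n m ((\<tau> m ^^ Suc a) f) g"
    by simp
  have "k + n - 1 = (k - Suc a) + Suc (a + n - 1)" using a mn(1) by simp
  then have "(?\<tau> ^^ (k + n - 1)) (pcomp P m n a f g) =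
      (?\<tau> ^^ (k - Suc a)) (pcomp P m n m ((\<tau> m ^^ Suc a) f) g)"
    by (simp only: funpow_add comp_apply A)
  also have "\<dots> = pcomp P m n (m - (k - Suc a)) ((\<tau> m ^^ (k - Suc a)) ((\<tau> m ^^ Suc a) f)) g"
    by (rule tau_pow_pcomp_below[OF mn(1) cf mn(3)]) (use a in auto)
  also have "(\<tau> m ^^ (k - Suc a)) ((\<tau> m ^^ Suc a) f) = (\<tau> m ^^ k) f"
    using a funpow_add[of "k - Suc a" "Suc a" "\<tau> m"] by (simp del: funpow.simps)
  also have "m - (k - Suc a) = a + m + 1 - k" using a by simp
  finally show ?thesis .
qed

lemma tau_pow_pcomp_outer:
  assumes mn: "1 \<le> n" "f \<in> elems P m" "g \<in> elems P n"
    and a: "1 \<le> a" "a \<le> m" and k: "1 \<le> k" "k \<le> m" "k \<noteq> a"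
  shows "(\<tau> (m + n - 1) ^^ outer_pos n a k) (pcomp P m n a f g) =
    pcomp P m n ((long_cycle m ^^ k) a) ((\<tau> m ^^ k) f) g"
proof (cases "k < a")
  case True
  then show ?thesis
    using tau_pow_pcomp_below[OF mn True a(2)] long_cycle_pow[of a m k] a k by (simp add: outer_pos_def)
next
  case False
  then have "a < k" using k by simp
  then show ?thesis
    using tau_pow_pcomp_above[OF mn a(1) _ k(2)] long_cycle_pow[of a m k] a k
    by (simp add: outer_pos_def)
qed

text \<open>The induced action is defined by one exponent \<open>k\<close> with \<open>\<sigma> \<chi> = \<rho> c\<^sup>k\<close>. Every exponent gives the
  same result, as the \<open>(n + 1)\<close>-st powers of \<open>\<tau>\<close> and of the long cycle are trivial. This freedom
  makes the action multiplicative.\<close>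

lemma induced_action_exists:
  assumes "\<sigma> permutes {1..n + 1}" "\<rho> permutes {1..n}"
  obtains \<chi> where "\<chi> permutes {1..n}"
    "\<sigma> \<circ> \<chi> = \<rho> \<circ> (long_cycle n ^^ (n + 1 - perm_inv \<rho> (\<sigma> (n + 1))))"
proof -
  let ?k = "n + 1 - perm_inv \<rho> (\<sigma> (n + 1))"
  let ?c = "long_cycle n ^^ ?k"
  define \<chi> where "\<chi> = perm_inv \<sigma> \<circ> \<rho> \<circ> ?c"
  note \<rho> = permutes_Suc[OF assms(2)]
  have c: "?c permutes {1..n + 1}" by (rule permutes_funpow[OF long_cycle_permutes])
  have s: "1 \<le> \<sigma> (n + 1)" "\<sigma> (n + 1) \<le> n + 1"
    using permutes_nat_bounds[OF assms(1), of "n + 1"] by simp_all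
  have y: "1 \<le> perm_inv \<rho> (\<sigma> (n + 1))" "perm_inv \<rho> (\<sigma> (n + 1)) \<le> n + 1"
    using perm_inv_bounds[OF \<rho> s] by simp_all
  have "?c (n + 1) = perm_inv \<rho> (\<sigma> (n + 1))"
    using long_cycle_pow[of "n + 1" n ?k] y by simp
  then have "\<chi> (n + 1) = n + 1"
    using permutes_inverses[OF assms(2)] permutes_inverses[OF assms(1)] by (simp add: \<chi>_def)
  then have "\<chi> permutes {1..n}"
    unfolding \<chi>_def
    by (intro permutes_fix_last[OF permutes_compose[OF c permutes_compose[OF \<rho> permutes_inv[OF assms(1)]]]])
  moreover have "\<sigma> \<circ> \<chi> = \<rho> \<circ> ?c"
    using permutes_inverses[OF assms(1)] by (simp add: \<chi>_def fun_eq_iff)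
  ultimately show thesis using that by blast
qed

lemma induced_action_apply:
  assumes n: "1 \<le> n" and u: "u \<in> elems S n"
    and p: "\<sigma> permutes {1..n + 1}" "\<rho> permutes {1..n}" "\<chi> permutes {1..n}"
    and eq: "\<sigma> \<circ> \<chi> = \<rho> \<circ> (long_cycle n ^^ k)"
  shows "act n \<sigma> u \<rho> = (\<tau> n ^^ k) (u \<chi>)"
proof -
  define l where "l = n + 1 - perm_inv \<rho> (\<sigma> (n + 1))"
  have "\<sigma> (n + 1) = \<rho> ((long_cycle n ^^ k) (n + 1))"
    using fun_cong[OF eq, of "n + 1"] permutes_last[OF p(3)] by simp
  moreover
  obtain \<chi>' where \<chi>': "\<chi>' permutes {1..n}" "\<sigma> \<circ> \<chi>' = \<rho> \<circ> (long_cycle n ^^ l)"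
    using induced_action_exists[OF p(1,2)] unfolding l_def by blast
  have "\<sigma> (n + 1) = \<rho> ((long_cycle n ^^ l) (n + 1))"
    using fun_cong[OF \<chi>'(2), of "n + 1"] permutes_last[OF \<chi>'(1)] by simp
  ultimately have kl: "k mod (n + 1) = l mod (n + 1)"
    using injD[OF permutes_inj[OF p(2)]] long_cycle_pow_last by metis
  have "long_cycle n ^^ k = long_cycle n ^^ l"
    by (rule ext, rule funpow_cong_order[where S = UNIV and N = "n + 1"])
      (simp_all only: long_cycle_pow_Suc id_apply UNIV_I kl)
  then have "\<sigma> \<circ> \<chi> = \<rho> \<circ> (long_cycle n ^^ l)" using eq by simp
  then have \<chi>: "perm_inv \<sigma> \<circ> \<rho> \<circ> (long_cycle n ^^ l) = \<chi>"
    using permutes_inverses[OF p(1)] by (metis comp_assoc fun.map_id permutes_inv_o(2)[OF p(1)] id_comp)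
  have "u \<chi> \<in> elems P n" using u p(3) by (auto simp: PiE_iff)
  then have "(\<tau> n ^^ l) (u \<chi>) = (\<tau> n ^^ k) (u \<chi>)"
    by (intro funpow_cong_order[where N = "n + 1" and S = "elems P n"])
      (simp_all only: tau_power[OF n] kl)
  moreover have "act n \<sigma> u \<rho> = (\<tau> n ^^ l) (u (perm_inv \<sigma> \<circ> \<rho> \<circ> (long_cycle n ^^ l)))"
    using n u p(1,2) by (simp add: induced_action_def Let_def l_def)
  ultimately show ?thesis by (simp only: \<chi>)
qed

lemma induced_action_closed:
  assumes n: "1 \<le> n" and u: "u \<in> elems S n" and p: "\<sigma> permutes {1..n + 1}"
  shows "act n \<sigma> u \<in> perms n \<rightarrow>\<^sub>E elems P n"
proof (rule PiE_I)
  fix \<rho> assume "\<rho> \<in> perms n"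
  then have \<rho>: "\<rho> permutes {1..n}" by simp
  obtain \<chi> k where \<chi>: "\<chi> permutes {1..n}" "\<sigma> \<circ> \<chi> = \<rho> \<circ> (long_cycle n ^^ k)"
    using induced_action_exists[OF p \<rho>] by metis
  show "act n \<sigma> u \<rho> \<in> elems P n"
    unfolding induced_action_apply[OF n u p \<rho> \<chi>]
    using u \<chi>(1) by (intro tau_pow_closed[OF n]) (auto simp: PiE_iff)
next
  fix \<rho> assume "\<rho> \<notin> perms n"
  then show "act n \<sigma> u \<rho> = undefined"
    using n u p by (simp add: induced_action_def)
qed

lemma induced_action_eqI:
  assumes n: "1 \<le> n" and u: "u \<in> elems S n" and p: "\<sigma> permutes {1..n + 1}"
    and w: "w \<in> extensional (perms n)"
    and eq: "\<And>\<rho> \<chi> k. \<lbrakk>\<rho> permutes {1..n}; \<chi> permutes {1..n}; \<sigma> \<circ> \<chi> = \<rho> \<circ> (long_cycle n ^^ k)\<rbrakk> \<Longrightarrow>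
      w \<rho> = (\<tau> n ^^ k) (u \<chi>)"
  shows "act n \<sigma> u = w"
proof
  fix \<rho>
  show "act n \<sigma> u \<rho> = w \<rho>"
  proof (cases "\<rho> \<in> perms n")
    case True
    then have \<rho>: "\<rho> permutes {1..n}" by simp
    obtain \<chi> k where \<chi>: "\<chi> permutes {1..n}" "\<sigma> \<circ> \<chi> = \<rho> \<circ> (long_cycle n ^^ k)"
      using induced_action_exists[OF p \<rho>] by metis
    show ?thesis unfolding induced_action_apply[OF n u p \<rho> \<chi>] eq[OF \<rho> \<chi>] ..
  next
    case False
    show ?thesis
      by (simp only: PiE_arb[OF induced_action_closed[OF n u p] False] extensional_arb[OF w False])
  qed
qed

lemma induced_action_long_cycle:
  assumes n: "1 \<le> n" and u: "u \<in> elems S n" and p: "\<sigma> permutes {1..n}"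
  shows "act n (long_cycle n) u (rotate_perm n \<sigma>) = (\<tau> n ^^ perm_inv \<sigma> 1) (u \<sigma>)"
  by (rule induced_action_apply[OF n u long_cycle_permutes rotate_perm(2)[OF p n] p rotate_perm(1)[OF p n]])

lemma symmetrization_uminus:
  assumes "1 \<le> n" "u \<in> elems S n"
  shows "\<ominus>\<^bsub>comps S n\<^esub> u = (\<lambda>\<rho>\<in>perms n. \<ominus>\<^bsub>comps P n\<^esub> u \<rho>)"
  unfolding uminus_smult_rat[OF symmetrization_module[OF assms(1)] assms(2)] symmetrization_sel
proof (rule restrict_ext)
  fix \<rho> assume "\<rho> \<in> perms n"
  then have "u \<rho> \<in> elems P n" using assms(2) by (auto simp: PiE_iff)
  then show "(-1) \<odot>\<^bsub>comps P n\<^esub> u \<rho> = \<ominus>\<^bsub>comps P n\<^esub> u \<rho>"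
    using uminus_smult_rat[OF vector_space[OF assms(1)]] by simp
qed

lemma tau_pow_zero: "1 \<le> n \<Longrightarrow> (\<tau> n ^^ k) \<zero>\<^bsub>comps P n\<^esub> = \<zero>\<^bsub>comps P n\<^esub>"
  by (rule linear_on_zero[OF vector_space vector_space linear_on_funpow[OF tau_linear]])

text \<open>At a composite of permutations the two identities for \<open>S\<close> are instances of the iterated
  identities for \<open>\<tau>\<close>: the position of the letter 1 in the composite is the number of steps.\<close>

lemma induced_action_pcomp:
  assumes i: "2 \<le> i" "i \<le> m" "1 \<le> n"
    and u: "u \<in> elems S m" and v: "v \<in> elems S n"
  shows "act (m + n - 1) (long_cycle (m + n - 1)) (pcomp S m n i u v) =
    pcomp S m n (i - 1) (act m (long_cycle m) u) v"
proof (rule symmetrization_pcomp_eqI[symmetric])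
  let ?A = "act (m + n - 1) (long_cycle (m + n - 1))"
    and ?w = "pcomp S m n i u v" and ?u = "act m (long_cycle m) u"
  show i': "1 \<le> i - 1" "i - 1 \<le> m" "1 \<le> n" using i by auto
  have m: "1 \<le> i" "1 \<le> m" "1 \<le> m + n - 1" using i by auto
  have w: "?w \<in> elems S (m + n - 1)"
    using symmetrization_pcomp_closed[OF m(1) i(2,3) u v] by simp
  show uA: "?u \<in> elems S m"
    using induced_action_closed[OF m(2) u long_cycle_permutes] by simp
  show "v \<in> elems S n" by (rule v)
  show "?A ?w \<in> extensional (perms (m + n - 1))"
    using induced_action_closed[OF m(3) w long_cycle_permutes] by (simp add: PiE_iff)
  {
    fix \<rho> \<pi> assume p: "\<rho> permutes {1..m}" "\<pi> permutes {1..n}"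
    obtain \<sigma> where \<sigma>: "\<sigma> permutes {1..m}" "\<rho> = rotate_perm m \<sigma>"
      using rotate_perm_surj[OF p(1) m(2)] by blast
    note \<sigma>\<pi> = perm_pcomp_permutes[OF m(1) i(2,3) \<sigma>(1) p(2)]
    have el: "u \<sigma> \<in> elems P m" "v \<pi> \<in> elems P n" using u v \<sigma>(1) p(2) by (auto simp: PiE_iff)
    let ?a = "perm_inv \<sigma> i" and ?k = "perm_inv \<sigma> 1"
    note a = perm_inv_bounds[OF \<sigma>(1) m(1) i(2)] and k = perm_inv_bounds[OF \<sigma>(1) order_refl m(2)]
    have ka: "?k \<noteq> ?a" using i injD[OF permutes_inj[OF permutes_inv[OF \<sigma>(1)]], of 1 i] by auto
    have k': "perm_inv (perm_pcomp m n i \<sigma> \<pi>) 1 = outer_pos n ?a ?k"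
      using perm_pcomp_inv_outer[OF m(1) i(2,3) order_refl m(2) _ \<sigma>(1) p(2)] i
      by (simp add: outer_pos_def)
    have a': "perm_inv (rotate_perm m \<sigma>) (i - 1) = (long_cycle m ^^ ?k) ?a"
      using rotate_perm_inv[OF \<sigma>(1) m(2), of i] i by (simp add: long_cycle_def)
    have "?A ?w (perm_pcomp m n (i - 1) \<rho> \<pi>) =
        (\<tau> (m + n - 1) ^^ outer_pos n ?a ?k) (pcomp P m n ?a (u \<sigma>) (v \<pi>))"
      unfolding \<sigma>(2) rotate_perm_pcomp[OF i \<sigma>(1) p(2), symmetric]
        induced_action_long_cycle[OF m(3) w \<sigma>\<pi>] k'
        symmetrization_pcomp[OF m(1) i(2,3) \<sigma>(1) p(2) u v] ..
    also have "\<dots> = pcomp P m n ((long_cycle m ^^ ?k) ?a) ((\<tau> m ^^ ?k) (u \<sigma>)) (v \<pi>)"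
      by (rule tau_pow_pcomp_outer[OF i(3) el a k ka])
    also have "\<dots> = pcomp P m n (perm_inv \<rho> (i - 1)) (?u \<rho>) (v \<pi>)"
      unfolding \<sigma>(2) a' induced_action_long_cycle[OF m(2) u \<sigma>(1)] ..
    finally show "?A ?w (perm_pcomp m n (i - 1) \<rho> \<pi>) =
      pcomp P m n (perm_inv \<rho> (i - 1)) (?u \<rho>) (v \<pi>)" .
  }
  fix \<rho> assume \<rho>: "\<rho> permutes {1..m + n - 1}"
    and no: "\<And>\<sigma> \<pi>. \<lbrakk>\<sigma> permutes {1..m}; \<pi> permutes {1..n}\<rbrakk> \<Longrightarrow> \<rho> \<noteq> perm_pcomp m n (i - 1) \<sigma> \<pi>"
  obtain \<theta> where \<theta>: "\<theta> permutes {1..m + n - 1}" "\<rho> = rotate_perm (m + n - 1) \<theta>"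
    using rotate_perm_surj[OF \<rho> m(3)] by blast
  have "?w \<theta> = \<zero>\<^bsub>comps P (m + n - 1)\<^esub>"
  proof (rule symmetrization_pcomp_zero[OF m(1) i(2) \<theta>(1)])
    fix \<sigma> \<pi> assume p: "\<sigma> permutes {1..m}" "\<pi> permutes {1..n}"
    show "\<theta> \<noteq> perm_pcomp m n i \<sigma> \<pi>"
      using no[OF rotate_perm(2)[OF p(1) m(2)] p(2)] rotate_perm_pcomp[OF i p] \<theta>(2) by metis
  qed
  then show "?A ?w \<rho> = \<zero>\<^bsub>comps P (m + n - 1)\<^esub>"
    unfolding \<theta>(2) induced_action_long_cycle[OF m(3) w \<theta>(1)] by (simp only: tau_pow_zero[OF m(3)])
qed

lemma induced_action_pcomp_first:
  assumes m: "1 \<le> m" "1 \<le> n"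
    and u: "u \<in> elems S m" and v: "v \<in> elems S n"
  shows "act (m + n - 1) (long_cycle (m + n - 1)) (pcomp S m n 1 u v) =
    \<ominus>\<^bsub>comps S (m + n - 1)\<^esub> pcomp S n m n
      (act n (long_cycle n) v) (act m (long_cycle m) u)"
proof -
  let ?A = "act (m + n - 1) (long_cycle (m + n - 1))"
    and ?w = "pcomp S m n 1 u v"
    and ?u = "act m (long_cycle m) u" and ?v = "act n (long_cycle n) v"
  have N: "1 \<le> m + n - 1" and comm: "n + m - 1 = m + n - 1" using m by auto
  have w: "?w \<in> elems S (m + n - 1)"
    using symmetrization_pcomp_closed[OF order_refl m u v] by simp
  have uA: "?u \<in> elems S m"
    using induced_action_closed[OF m(1) u long_cycle_permutes] by simp
  have vA: "?v \<in> elems S n"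
    using induced_action_closed[OF m(2) v long_cycle_permutes] by simp
  have Aw: "?A ?w \<in> elems S (m + n - 1)"
    using induced_action_closed[OF N w long_cycle_permutes] by simp
  have Aw\<rho>: "?A ?w \<rho> \<in> elems P (m + n - 1)" if "\<rho> permutes {1..m + n - 1}" for \<rho>
    using Aw that by (auto simp: PiE_iff)
  have "pcomp S n m n ?v ?u = \<ominus>\<^bsub>comps S (m + n - 1)\<^esub> ?A ?w"
    unfolding symmetrization_uminus[OF N Aw]
  proof (rule symmetrization_pcomp_eqI[OF m(2) order_refl m(1) vA uA], unfold comm)
    show "(\<lambda>\<rho>\<in>perms (m + n - 1). \<ominus>\<^bsub>comps P (m + n - 1)\<^esub> ?A ?w \<rho>) \<in> extensional (perms (m + n - 1))"
      by simp
    {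
      fix \<rho>' \<rho> assume p: "\<rho>' permutes {1..n}" "\<rho> permutes {1..m}"
      obtain \<sigma> where \<sigma>: "\<sigma> permutes {1..m}" "\<rho> = rotate_perm m \<sigma>"
        using rotate_perm_surj[OF p(2) m(1)] by blast
      obtain \<pi> where \<pi>: "\<pi> permutes {1..n}" "\<rho>' = rotate_perm n \<pi>"
        using rotate_perm_surj[OF p(1) m(2)] by blast
      note \<sigma>\<pi> = perm_pcomp_permutes[OF order_refl m \<sigma>(1) \<pi>(1)]
      have el: "u \<sigma> \<in> elems P m" "v \<pi> \<in> elems P n" using u v \<sigma>(1) \<pi>(1) by (auto simp: PiE_iff)
      let ?a = "perm_inv \<sigma> 1" and ?b = "perm_inv \<pi> 1"
      note a = perm_inv_bounds[OF \<sigma>(1) order_refl m(1)] and b = perm_inv_bounds[OF \<pi>(1) order_refl m(2)]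
      have t: "perm_inv (perm_pcomp m n 1 \<sigma> \<pi>) 1 = ?a + ?b - 1"
        using perm_pcomp_inv_inner[OF order_refl m(1) order_refl m(2) \<sigma>(1) \<pi>(1)]
        by (simp add: inner_pos_def)
      have "long_cycle n (n + 1) = n" using m by (simp add: long_cycle_def)
      moreover have "perm_inv \<pi> (n + 1) = n + 1"
        using permutes_inv_eq[OF \<pi>(1)] permutes_last[OF \<pi>(1)] by blast
      ultimately have b': "perm_inv (rotate_perm n \<pi>) n = n + 1 - ?b"
        using rotate_perm_inv[OF \<pi>(1) m(2), of "n + 1"] long_cycle_pow[of "n + 1" n ?b] b by simp
      have \<rho>\<rho>: "perm_pcomp n m n \<rho>' \<rho> permutes {1..m + n - 1}"
        using perm_pcomp_permutes[OF m(2) order_refl m(1) p] by (simp only: comm)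
      let ?z = "pcomp P n m (n + 1 - ?b) ((\<tau> n ^^ ?b) (v \<pi>)) ((\<tau> m ^^ ?a) (u \<sigma>))"
      have "1 \<le> n + 1 - ?b" "n + 1 - ?b \<le> n" using b by auto
      then have z: "?z \<in> elems P (m + n - 1)"
        using pcomp_closed[OF _ _ m(1) tau_pow_closed[OF m(2) el(2)] tau_pow_closed[OF m(1) el(1)]]
        unfolding comm by blast
      have "?A ?w (perm_pcomp n m n \<rho>' \<rho>) =
          (\<tau> (m + n - 1) ^^ (?a + ?b - 1)) (pcomp P m n ?a (u \<sigma>) (v \<pi>))"
        unfolding \<sigma>(2) \<pi>(2) rotate_perm_pcomp_first[OF m \<sigma>(1) \<pi>(1), symmetric]
          induced_action_long_cycle[OF N w \<sigma>\<pi>] t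
          symmetrization_pcomp[OF order_refl m \<sigma>(1) \<pi>(1) u v] ..
      also have "\<dots> = \<ominus>\<^bsub>comps P (m + n - 1)\<^esub> ?z"
        by (rule tau_pow_pcomp_inner[OF el a b])
      finally have "\<ominus>\<^bsub>comps P (m + n - 1)\<^esub> ?A ?w (perm_pcomp n m n \<rho>' \<rho>) = ?z"
        using uminus_uminus[OF N z] by simp
      also have "?z = pcomp P n m (perm_inv \<rho>' n) (?v \<rho>') (?u \<rho>)"
        unfolding \<sigma>(2) \<pi>(2) b' induced_action_long_cycle[OF m(1) u \<sigma>(1)]
          induced_action_long_cycle[OF m(2) v \<pi>(1)] ..
      finally show "(\<lambda>\<rho>\<in>perms (m + n - 1). \<ominus>\<^bsub>comps P (m + n - 1)\<^esub> ?A ?w \<rho>) (perm_pcomp n m n \<rho>' \<rho>) =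
          pcomp P n m (perm_inv \<rho>' n) (?v \<rho>') (?u \<rho>)"
        using \<rho>\<rho> by (simp del: One_nat_def)
    }
    fix \<rho> assume \<rho>: "\<rho> permutes {1..m + n - 1}"
      and no: "\<And>\<pi> \<sigma>. \<lbrakk>\<pi> permutes {1..n}; \<sigma> permutes {1..m}\<rbrakk> \<Longrightarrow> \<rho> \<noteq> perm_pcomp n m n \<pi> \<sigma>"
    obtain \<theta> where \<theta>: "\<theta> permutes {1..m + n - 1}" "\<rho> = rotate_perm (m + n - 1) \<theta>"
      using rotate_perm_surj[OF \<rho> N] by blast
    have "?w \<theta> = \<zero>\<^bsub>comps P (m + n - 1)\<^esub>"
    proof (rule symmetrization_pcomp_zero[OF order_refl m(1) \<theta>(1)])
      fix \<sigma> \<pi> assume p: "\<sigma> permutes {1..m}" "\<pi> permutes {1..n}"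
      show "\<theta> \<noteq> perm_pcomp m n 1 \<sigma> \<pi>"
        using no[OF rotate_perm(2)[OF p(2) m(2)] rotate_perm(2)[OF p(1) m(1)]]
          rotate_perm_pcomp_first[OF m p] \<theta>(2) by metis
    qed
    then have "?A ?w \<rho> = \<zero>\<^bsub>comps P (m + n - 1)\<^esub>"
      unfolding \<theta>(2) induced_action_long_cycle[OF N w \<theta>(1)] by (simp only: tau_pow_zero[OF N])
    moreover have "\<ominus>\<^bsub>comps P (m + n - 1)\<^esub> \<zero>\<^bsub>comps P (m + n - 1)\<^esub> = \<zero>\<^bsub>comps P (m + n - 1)\<^esub>"
    proof -
      interpret V: module rat_field "comps P (m + n - 1)" using vector_space[OF N] .
      show ?thesis
        using uminus_smult_rat[OF vector_space[OF N] comps_closed(1)[OF N]] V.smult_r_null[of "-1"]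
        by (simp del: One_nat_def)
    qed
    ultimately show "(\<lambda>\<rho>\<in>perms (m + n - 1). \<ominus>\<^bsub>comps P (m + n - 1)\<^esub> ?A ?w \<rho>) \<rho> = \<zero>\<^bsub>comps P (m + n - 1)\<^esub>"
      using \<rho> by (simp del: One_nat_def)
  qed
  then show ?thesis
    using ns_operad.uminus_uminus[OF symmetrization_ns_operad N Aw] by simp
qed

theorem induced_action_anticyclic: "anticyclic_operad S act"
proof (rule anticyclic_operad.intro[OF symmetrization_sym_operad], rule anticyclic_operad_axioms.intro)
  show "act \<in> (\<Pi>\<^sub>E n\<in>{1..}. \<Pi>\<^sub>E \<sigma>\<in>{\<sigma>. \<sigma> permutes {1..n + 1}}.
      elems S n \<rightarrow>\<^sub>E elems S n)"
  proof (intro PiE_I)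
    fix n \<sigma> u assume a: "n \<in> {1..}" "\<sigma> \<in> {\<sigma>. \<sigma> permutes {1..n + 1}}" "u \<in> elems S n"
    show "act n \<sigma> u \<in> elems S n"
      using a induced_action_closed[of n u \<sigma>] by simp
  next
    fix n \<sigma> u assume a: "n \<in> {1..}" "\<sigma> \<in> {\<sigma>. \<sigma> permutes {1..n + 1}}" "u \<notin> elems S n"
    then show "act n \<sigma> u = undefined" by (simp add: induced_action_def)
  next
    fix n and \<sigma> :: "nat \<Rightarrow> nat" assume a: "n \<in> {1..}" "\<sigma> \<notin> {\<sigma>. \<sigma> permutes {1..n + 1}}"
    then show "act n \<sigma> = undefined" by (simp add: induced_action_def)
  next
    fix n :: nat assume a: "n \<notin> {1..}"
    then show "act n = undefined" by (simp add: induced_action_def)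
  qed
next
  fix n :: nat and \<sigma> assume n: "1 \<le> n" and \<sigma>: "\<sigma> permutes {1..n + 1}"
  note S = ns_operad.comps_closed[OF symmetrization_ns_operad n]
  note L = linear_on_funpow[OF tau_linear[OF n]]
  show "linear_on (comps S n) (comps S n) (act n \<sigma>)"
  proof (rule linear_onI)
    fix u assume u: "u \<in> elems S n"
    have up: "u \<chi> \<in> elems P n" if "\<chi> permutes {1..n}" for \<chi> using u that by (auto simp: PiE_iff)
    show "act n \<sigma> u \<in> elems S n"
      using induced_action_closed[OF n u \<sigma>] by simp
    show "act n \<sigma> (c \<odot>\<^bsub>comps S n\<^esub> u) =
      c \<odot>\<^bsub>comps S n\<^esub> act n \<sigma> u" for c
    proof (rule induced_action_eqI[OF n S(5)[OF u] \<sigma>])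
      fix \<rho> \<chi> k assume p: "\<rho> permutes {1..n}" "\<chi> permutes {1..n}" "\<sigma> \<circ> \<chi> = \<rho> \<circ> (long_cycle n ^^ k)"
      show "(c \<odot>\<^bsub>comps S n\<^esub> act n \<sigma> u) \<rho> =
        (\<tau> n ^^ k) ((c \<odot>\<^bsub>comps S n\<^esub> u) \<chi>)"
        using p linear_onD(3)[OF L up] induced_action_apply[OF n u \<sigma> p] by simp
    qed simp
    fix v assume v: "v \<in> elems S n"
    have vp: "v \<chi> \<in> elems P n" if "\<chi> permutes {1..n}" for \<chi> using v that by (auto simp: PiE_iff)
    show "act n \<sigma> (u \<oplus>\<^bsub>comps S n\<^esub> v) =
      act n \<sigma> u \<oplus>\<^bsub>comps S n\<^esub> act n \<sigma> v"
    proof (rule induced_action_eqI[OF n S(4)[OF u v] \<sigma>])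
      fix \<rho> \<chi> k assume p: "\<rho> permutes {1..n}" "\<chi> permutes {1..n}" "\<sigma> \<circ> \<chi> = \<rho> \<circ> (long_cycle n ^^ k)"
      show "(act n \<sigma> u \<oplus>\<^bsub>comps S n\<^esub> act n \<sigma> v) \<rho> =
        (\<tau> n ^^ k) ((u \<oplus>\<^bsub>comps S n\<^esub> v) \<chi>)"
        using p linear_onD(2)[OF L up vp] induced_action_apply[OF n u \<sigma> p] induced_action_apply[OF n v \<sigma> p]
        by simp
    qed simp
  qed
  fix u assume u: "u \<in> elems S n"
  show "act n (\<sigma> \<circ> \<pi>) u = act n \<sigma> (act n \<pi> u)"
    if \<pi>: "\<pi> permutes {1..n + 1}" for \<pi>
  proof -
    have \<pi>u: "act n \<pi> u \<in> elems S n"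
      using induced_action_closed[OF n u \<pi>] by simp
    have "act n \<sigma> (act n \<pi> u) = act n (\<sigma> \<circ> \<pi>) u"
    proof (rule induced_action_eqI[OF n \<pi>u \<sigma>])
      show "act n (\<sigma> \<circ> \<pi>) u \<in> extensional (perms n)"
        using induced_action_closed[OF n u permutes_compose[OF \<pi> \<sigma>]] by (simp add: PiE_iff)
      fix \<rho> \<chi> k assume p: "\<rho> permutes {1..n}" "\<chi> permutes {1..n}" "\<sigma> \<circ> \<chi> = \<rho> \<circ> (long_cycle n ^^ k)"
      obtain \<chi>' l where \<chi>': "\<chi>' permutes {1..n}" "\<pi> \<circ> \<chi>' = \<chi> \<circ> (long_cycle n ^^ l)"
        using induced_action_exists[OF \<pi> p(2)] by metis
      have "(\<sigma> \<circ> \<pi>) \<circ> \<chi>' = \<sigma> \<circ> \<chi> \<circ> (long_cycle n ^^ l)" using \<chi>'(2) by (simp add: comp_assoc)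
      also have "\<dots> = \<rho> \<circ> (long_cycle n ^^ (k + l))" using p(3) by (simp add: comp_assoc funpow_add)
      finally have "act n (\<sigma> \<circ> \<pi>) u \<rho> = (\<tau> n ^^ (k + l)) (u \<chi>')"
        by (rule induced_action_apply[OF n u permutes_compose[OF \<pi> \<sigma>] p(1) \<chi>'(1)])
      then show "act n (\<sigma> \<circ> \<pi>) u \<rho> = (\<tau> n ^^ k) (act n \<pi> u \<chi>)"
        using induced_action_apply[OF n u \<pi> p(2) \<chi>'] by (simp add: funpow_add)
    qed
    then show ?thesis ..
  qed
next
  fix n :: nat and \<sigma> u assume n: "1 \<le> n" and \<sigma>: "\<sigma> permutes {1..n}" and u: "u \<in> elems S n"
  show "act n \<sigma> u = sact S n \<sigma> u"
  proof
    fix \<rho>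
    show "act n \<sigma> u \<rho> = sact S n \<sigma> u \<rho>"
    proof (cases "\<rho> \<in> perms n")
      case True
      then have \<rho>: "\<rho> permutes {1..n}" by simp
      have "\<sigma> \<circ> (perm_inv \<sigma> \<circ> \<rho>) = \<rho> \<circ> (long_cycle n ^^ 0)"
        using permutes_inverses[OF \<sigma>] by (simp add: fun_eq_iff)
      from induced_action_apply[OF n u permutes_Suc[OF \<sigma>] \<rho> permutes_compose[OF \<rho> permutes_inv[OF \<sigma>]] this]
      show ?thesis using \<rho> by simp
    next
      case False
      then show ?thesis
        using PiE_arb[OF induced_action_closed[OF n u permutes_Suc[OF \<sigma>]]] by simp
    qed
  qed
next
  have unit: "act 1 (long_cycle 1) (unit S) =
      \<ominus>\<^bsub>comps S 1\<^esub> unit S"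
  proof
    note U = symmetrization_unit_closed
    fix \<rho>
    show "act 1 (long_cycle 1) (unit S) \<rho> =
      (\<ominus>\<^bsub>comps S 1\<^esub> unit S) \<rho>"
    proof (cases "\<rho> \<in> perms 1")
      case True
      then have \<rho>: "\<rho> = id" using perms_1 by simp
      have "long_cycle 1 \<circ> id = id \<circ> (long_cycle 1 ^^ 1)" by simp
      from induced_action_apply[OF order_refl U long_cycle_permutes permutes_id permutes_id this]
      have "act 1 (long_cycle 1) (unit S) id = \<ominus>\<^bsub>comps P 1\<^esub> unit P"
        using tau_identities
        by (simp add: pure_tensor_def permutes_id anticyclic_identities_def)
      then show ?thesis
        unfolding \<rho> symmetrization_uminus[OF order_refl U] by (simp add: pure_tensor_def permutes_id)
    next
      case False
      then show ?thesis
        unfolding symmetrization_uminus[OF order_refl U]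
        using PiE_arb[OF induced_action_closed[OF order_refl U long_cycle_permutes] False] by simp
    qed
  qed
  then show "anticyclic_identities S (\<lambda>n. act n (long_cycle n))"
    unfolding anticyclic_identities_def
    using induced_action_pcomp induced_action_pcomp_first by blast
qed

end

section \<open>Free operads on binary operations\<close>

abbreviation keys :: "('a \<Rightarrow>\<^sub>0 'b :: zero) \<Rightarrow> 'a set"
  where "keys \<equiv> Poly_Mapping.keys"

abbreviation lookup :: "('a \<Rightarrow>\<^sub>0 'b :: zero) \<Rightarrow> 'a \<Rightarrow> 'b"
  where "lookup \<equiv> Poly_Mapping.lookup"

abbreviation single :: "'a \<Rightarrow> 'b \<Rightarrow> ('a \<Rightarrow>\<^sub>0 'b :: zero)"
  where "single \<equiv> Poly_Mapping.single"

lemma size1_graft: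
  "\<lbrakk>1 \<le> i; i \<le> size1 s\<rbrakk> \<Longrightarrow> size1 (graft s i t) = size1 s + size1 t - 1"
proof (induction s arbitrary: i)
  case (Node l a r)
  show ?case
  proof (cases "i \<le> size1 l")
    case True
    then show ?thesis using Node size1_ge0[of l] by (simp del: size1_ge0)
  next
    case False
    then have "size1 (graft r (i - size1 l) t) = size1 r + size1 t - 1"
      using Node.prems by (intro Node.IH(2)) auto
    then show ?thesis using False size1_ge0[of r] by (simp del: size1_ge0)
  qed
qed simp

lemma graft_Leaf: "\<lbrakk>1 \<le> i; i \<le> size1 s\<rbrakk> \<Longrightarrow> graft s i Leaf = s"
  by (induction s arbitrary: i) auto

lemma graft_sequential:
  "\<lbrakk>1 \<le> i; i \<le> size1 s; 1 \<le> j; j \<le> size1 t\<rbrakk> \<Longrightarrow>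
    graft (graft s i t) (i + j - 1) u = graft s i (graft t j u)"
proof (induction s arbitrary: i)
  case (Node l a r)
  show ?case
  proof (cases "i \<le> size1 l")
    case True
    moreover have "i + j - 1 \<le> size1 l + size1 t - 1" using True Node.prems by linarith
    ultimately show ?thesis using Node.prems Node.IH(1)[of i] size1_graft[of i l t] by simp
  next
    case False
    then have "graft (graft r (i - size1 l) t) (i - size1 l + j - 1) u = graft r (i - size1 l) (graft t j u)"
      using Node.prems by (intro Node.IH(2)) auto
    moreover have "\<not> i + j - 1 \<le> size1 l" "i + j - 1 - size1 l = i - size1 l + j - 1"
      using False Node.prems by linarith+
    ultimately show ?thesis using False Node.prems by simp
  qed
qed simp

lemma graft_parallel:
  "\<lbrakk>1 \<le> i; i < k; k \<le> size1 s\<rbrakk> \<Longrightarrow>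
    graft (graft s i t) (k + size1 t - 1) u = graft (graft s k u) i t"
proof (induction s arbitrary: i k)
  case (Node l a r)
  consider "k \<le> size1 l" | "i \<le> size1 l" "size1 l < k" | "size1 l < i" using Node.prems by linarith
  then show ?case
  proof cases
    case 1
    then have i: "i \<le> size1 l" "1 \<le> k" using Node.prems by auto
    have "k + size1 t - 1 \<le> size1 l + size1 t - 1" using 1 by linarith
    moreover have "i \<le> size1 l + size1 u - 1" using i(1) size1_ge0[of u] by linarith
    ultimately show ?thesis
      using 1 i Node.prems Node.IH(1)[of i k] size1_graft[of i l t] size1_graft[of k l u] by simp
  next
    case 2
    then have "k + size1 t - 1 - (size1 l + size1 t - 1) = k - size1 l"
        "\<not> k + size1 t - 1 \<le> size1 l + size1 t - 1"
      using size1_ge0[of t] by linarith+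
    then show ?thesis using 2 Node.prems size1_graft[of i l t] by simp
  next
    case 3
    have "graft (graft r (i - size1 l) t) (k - size1 l + size1 t - 1) u =
        graft (graft r (k - size1 l) u) (i - size1 l) t"
      using 3 Node.prems by (intro Node.IH(2)) auto
    moreover have "k + size1 t - 1 - size1 l = k - size1 l + size1 t - 1"
        "\<not> k + size1 t - 1 \<le> size1 l" "\<not> k \<le> size1 l"
      using 3 Node.prems size1_ge0[of t] by linarith+
    ultimately show ?thesis using 3 Node.prems by simp
  qed
qed simp

lemma free_ns_operad_sel [simp]:
  "elems free_ns_operad n = {f. \<forall>t\<in>keys f. size1 t = n}"
  "\<zero>\<^bsub>comps free_ns_operad n\<^esub> = 0"
  "f \<oplus>\<^bsub>comps free_ns_operad n\<^esub> g = f + g"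
  "c \<odot>\<^bsub>comps free_ns_operad n\<^esub> f = Poly_Mapping.map ((*) c) f"
  "unit free_ns_operad = single Leaf 1"
  by (simp_all add: free_ns_operad_def)

lemma lookup_smult [simp]:
  "lookup (Poly_Mapping.map ((*) c) f) t = c * lookup f t" for c :: rat
  by (simp add: Poly_Mapping.map.rep_eq when_def)

lemma keys_smult_subset: "keys (Poly_Mapping.map ((*) (c :: rat)) f) \<subseteq> keys f"
  by (auto simp: in_keys_iff)

lemma smult_single [simp]:
  "Poly_Mapping.map ((*) c) (single t a) = single t (c * a)" for c :: rat
  by (rule poly_mapping_eqI) (simp add: lookup_single when_def)

lemma sum_singles: "(\<Sum>t\<in>keys f. single t (lookup f t)) = f"
  by (rule poly_mapping_eqI)
    (auto simp: lookup_sum lookup_single when_def in_keys_iff sum.delta)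

lemma free_module: "module rat_field (comps free_ns_operad n)"
proof (rule module_ratI, unfold free_ns_operad_sel)
  fix f g :: "'a tree \<Rightarrow>\<^sub>0 rat" and c
  assume f: "f \<in> {f. \<forall>t\<in>keys f. size1 t = n}"
  show "Poly_Mapping.map ((*) c) f \<in> {f. \<forall>t\<in>keys f. size1 t = n}"
    using f keys_smult_subset[of c f] by auto
  show "f + g \<in> {f. \<forall>t\<in>keys f. size1 t = n}"
    if "g \<in> {f. \<forall>t\<in>keys f. size1 t = n}"
    using f that keys_add[of f g] by auto
qed (auto intro!: poly_mapping_eqI simp: lookup_add algebra_simps)

lemma free_uminus:
  assumes "f \<in> elems free_ns_operad n"
  shows "\<ominus>\<^bsub>comps free_ns_operad n\<^esub> f = - f"
  unfolding uminus_smult_rat[OF free_module assms] free_ns_operad_sel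
  by (rule poly_mapping_eqI) simp

lemma free_minus:
  assumes "g \<in> elems free_ns_operad n"
  shows "f \<ominus>\<^bsub>comps free_ns_operad n\<^esub> g = f - g"
  unfolding a_minus_def free_uminus[OF assms] by simp

text \<open>The composition of the free operad. It does not depend on the arities, which makes its
  bilinearity a statement about all combinations of trees.\<close>

definition graft_prod :: "nat \<Rightarrow> ('g tree \<Rightarrow>\<^sub>0 rat) \<Rightarrow> ('g tree \<Rightarrow>\<^sub>0 rat) \<Rightarrow> ('g tree \<Rightarrow>\<^sub>0 rat)"
  where "graft_prod i f g = (\<Sum>s\<in>keys f. \<Sum>t\<in>keys g.
    single (graft s i t) (lookup f s * lookup g t))"

lemma free_pcomp [simp]: "pcomp free_ns_operad m n i = graft_prod i"
  by (simp add: free_ns_operad_def graft_prod_def fun_eq_iff)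

lemma graft_prod_superset:
  assumes "finite S" "keys f \<subseteq> S" "finite T" "keys g \<subseteq> T"
  shows "graft_prod i f g =
    (\<Sum>s\<in>S. \<Sum>t\<in>T. single (graft s i t) (lookup f s * lookup g t))"
proof -
  have "graft_prod i f g = (\<Sum>s\<in>keys f. \<Sum>t\<in>T.
      single (graft s i t) (lookup f s * lookup g t))"
    unfolding graft_prod_def
    by (intro sum.cong refl sum.mono_neutral_left assms) (simp add: in_keys_iff)
  also have "\<dots> = (\<Sum>s\<in>S. \<Sum>t\<in>T.
      single (graft s i t) (lookup f s * lookup g t))"
    by (intro sum.mono_neutral_left assms) (simp add: in_keys_iff)
  finally show ?thesis .
qed

lemma graft_prod_add:
  "graft_prod i (f + f') g = graft_prod i f g + graft_prod i f' g"
  "graft_prod i f (g + g') = graft_prod i f g + graft_prod i f g'"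
proof -
  let ?S = "keys f \<union> keys f'" and ?T = "keys g \<union> keys g'"
  have k: "finite ?S" "finite ?T" "keys (f + f') \<subseteq> ?S" "keys (g + g') \<subseteq> ?T"
    using keys_add[of f f'] keys_add[of g g'] by auto
  show "graft_prod i (f + f') g = graft_prod i f g + graft_prod i f' g"
    using k by (subst (1 2 3) graft_prod_superset[where S = ?S and T = "keys g"])
      (simp_all add: lookup_add distrib_right single_add sum.distrib)
  show "graft_prod i f (g + g') = graft_prod i f g + graft_prod i f g'"
    using k by (subst (1 2 3) graft_prod_superset[where S = "keys f" and T = ?T])
      (simp_all add: lookup_add distrib_left single_add sum.distrib)
qed

lemma graft_prod_zero [simp]: "graft_prod i 0 g = 0" "graft_prod i f 0 = 0"
  by (simp_all add: graft_prod_def)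

lemma graft_prod_sum:
  "graft_prod i (\<Sum>x\<in>B. F x) g = (\<Sum>x\<in>B. graft_prod i (F x) g)"
  "graft_prod i f (\<Sum>x\<in>B. F x) = (\<Sum>x\<in>B. graft_prod i f (F x))"
  by (induction B rule: infinite_finite_induct) (simp_all add: graft_prod_add)

lemma graft_prod_single_left:
  "graft_prod i (single s a) g =
    (\<Sum>t\<in>keys g. single (graft s i t) (a * lookup g t))"
  by (subst graft_prod_superset[where S = "{s}" and T = "keys g"]) simp_all

lemma graft_prod_single_right:
  "graft_prod i f (single t b) =
    (\<Sum>s\<in>keys f. single (graft s i t) (lookup f s * b))"
  by (subst graft_prod_superset[where S = "keys f" and T = "{t}"]) simp_all

lemma graft_prod_single:
  "graft_prod i (single s a) (single t b) =
    single (graft s i t) (a * b)"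
  by (subst graft_prod_superset[where S = "{s}" and T = "{t}"]) simp_all

lemma graft_prod_smult:
  "graft_prod i (Poly_Mapping.map ((*) c) f) g = Poly_Mapping.map ((*) c) (graft_prod i f g)"
  "graft_prod i f (Poly_Mapping.map ((*) c) g) = Poly_Mapping.map ((*) c) (graft_prod i f g)"
proof -
  have sum: "Poly_Mapping.map ((*) c) (\<Sum>x\<in>B. F x) = (\<Sum>x\<in>B. Poly_Mapping.map ((*) c) (F x))"
    for F :: "'a tree \<Rightarrow> 'a tree \<Rightarrow>\<^sub>0 rat" and B
    by (rule poly_mapping_eqI) (simp add: lookup_sum sum_distrib_left)
  show "graft_prod i (Poly_Mapping.map ((*) c) f) g = Poly_Mapping.map ((*) c) (graft_prod i f g)"
    by (subst (1 2) graft_prod_superset[where S = "keys f" and T = "keys g"])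
      (simp_all add: keys_smult_subset sum mult.assoc)
  show "graft_prod i f (Poly_Mapping.map ((*) c) g) = Poly_Mapping.map ((*) c) (graft_prod i f g)"
    by (subst (1 2) graft_prod_superset[where S = "keys f" and T = "keys g"])
      (simp_all add: keys_smult_subset sum mult.left_commute)
qed

lemma graft_prod_closed:
  assumes "1 \<le> i" "i \<le> m" "f \<in> elems free_ns_operad m" "g \<in> elems free_ns_operad n"
  shows "graft_prod i f g \<in> elems free_ns_operad (m + n - 1)"
proof -
  have "keys (graft_prod i f g) \<subseteq>
      (\<Union>s\<in>keys f. \<Union>t\<in>keys g. {graft s i t})"
    unfolding graft_prod_def
    by (rule order_trans[OF keys_sum], rule UN_mono[OF order_refl], rule order_trans[OF keys_sum])
      (auto intro!: UN_mono split: if_splits)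
  then show ?thesis using assms size1_graft[OF assms(1)] by fastforce
qed

lemma free_ns_operad: "ns_operad free_ns_operad"
proof (rule ns_operad.intro)
  show "unit free_ns_operad \<in> elems free_ns_operad 1" by simp
next
  fix i l j m n :: nat and f g h :: "'a tree \<Rightarrow>\<^sub>0 rat"
  assume i: "1 \<le> i" "i \<le> l" "1 \<le> j" "j \<le> m" "1 \<le> n"
    and f: "f \<in> elems free_ns_operad l" and g: "g \<in> elems free_ns_operad m"
  have "graft_prod (i + j - 1) (graft_prod i f g) h =
      (\<Sum>s\<in>keys f. \<Sum>t\<in>keys g. \<Sum>u\<in>keys h.
        single (graft (graft s i t) (i + j - 1) u)
          (lookup f s * lookup g t * lookup h u))"
    unfolding graft_prod_def[of i f g] graft_prod_sum graft_prod_single_left ..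
  also have "\<dots> = (\<Sum>s\<in>keys f. \<Sum>t\<in>keys g. \<Sum>u\<in>keys h.
        single (graft s i (graft t j u))
          (lookup f s * (lookup g t * lookup h u)))"
  proof (intro sum.cong refl)
    fix s t u assume "s \<in> keys f" "t \<in> keys g"
    then have "size1 s = l" "size1 t = m" using f g by auto
    then show "single (graft (graft s i t) (i + j - 1) u)
          (lookup f s * lookup g t * lookup h u) =
        single (graft s i (graft t j u))
          (lookup f s * (lookup g t * lookup h u))"
      using graft_sequential[of i s j t u] i by (simp add: mult.assoc)
  qed
  also have "\<dots> = graft_prod i f (graft_prod j g h)"
    unfolding graft_prod_def[of j g h] graft_prod_sum graft_prod_single_right
    by (rule trans[OF sum.swap]) (intro sum.cong refl sum.swap)
  finally show "pcomp free_ns_operad (l + m - 1) n (i + j - 1) (pcomp free_ns_operad l m i f g) h =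
      pcomp free_ns_operad l (m + n - 1) i f (pcomp free_ns_operad m n j g h)"
    by simp
next
  fix i k l m n :: nat and f g h :: "'a tree \<Rightarrow>\<^sub>0 rat"
  assume i: "1 \<le> i" "i < k" "k \<le> l" and f: "f \<in> elems free_ns_operad l"
    and g: "g \<in> elems free_ns_operad m"
  have "graft_prod (k + m - 1) (graft_prod i f g) h =
      (\<Sum>s\<in>keys f. \<Sum>t\<in>keys g. \<Sum>u\<in>keys h.
        single (graft (graft s i t) (k + m - 1) u)
          (lookup f s * lookup g t * lookup h u))"
    unfolding graft_prod_def[of i f g] graft_prod_sum graft_prod_single_left ..
  also have "\<dots> = (\<Sum>s\<in>keys f. \<Sum>t\<in>keys g. \<Sum>u\<in>keys h.
        single (graft (graft s k u) i t)
          (lookup f s * lookup h u * lookup g t))"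
  proof (intro sum.cong refl)
    fix s t u assume "s \<in> keys f" "t \<in> keys g"
    then have "size1 s = l" "size1 t = m" using f g by auto
    then show "single (graft (graft s i t) (k + m - 1) u)
          (lookup f s * lookup g t * lookup h u) =
        single (graft (graft s k u) i t)
          (lookup f s * lookup h u * lookup g t)"
      using graft_parallel[of i k s t u] i by (simp add: mult_ac)
  qed
  also have "\<dots> = (\<Sum>s\<in>keys f. \<Sum>u\<in>keys h. \<Sum>t\<in>keys g.
        single (graft (graft s k u) i t)
          (lookup f s * lookup h u * lookup g t))"
    by (intro sum.cong refl sum.swap)
  also have "\<dots> = graft_prod i (graft_prod k f h) g"
    unfolding graft_prod_def[of k f h] graft_prod_sum graft_prod_single_left ..
  finally show "pcomp free_ns_operad (l + m - 1) n (k + m - 1) (pcomp free_ns_operad l m i f g) h =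
      pcomp free_ns_operad (l + n - 1) m i (pcomp free_ns_operad l n k f h) g"
    by simp
next
  fix n :: nat and f :: "'a tree \<Rightarrow>\<^sub>0 rat" assume f: "f \<in> elems free_ns_operad n"
  show "pcomp free_ns_operad 1 n 1 (unit free_ns_operad) f = f"
    by (simp add: graft_prod_single_left sum_singles)
  show "pcomp free_ns_operad n 1 i f (unit free_ns_operad) = f" if "1 \<le> i" "i \<le> n" for i
  proof -
    have "graft_prod i f (single Leaf 1) =
        (\<Sum>s\<in>keys f. single s (lookup f s))"
      unfolding graft_prod_single_right using f that by (intro sum.cong) (auto simp: graft_Leaf)
    then show ?thesis by (simp add: sum_singles)
  qed
next
  fix i m n :: nat and g :: "'a tree \<Rightarrow>\<^sub>0 rat" assume "1 \<le> i" "i \<le> m" "g \<in> elems free_ns_operad n"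
  then show "linear_on (comps free_ns_operad m) (comps free_ns_operad (m + n - 1))
      (\<lambda>f. pcomp free_ns_operad m n i f g)"
    using graft_prod_closed[of i m _ g n]
    by (intro linear_onI) (simp_all add: graft_prod_add graft_prod_smult)
next
  fix i m n :: nat and f :: "'a tree \<Rightarrow>\<^sub>0 rat" assume "1 \<le> i" "i \<le> m" "f \<in> elems free_ns_operad m"
  then show "linear_on (comps free_ns_operad n) (comps free_ns_operad (m + n - 1))
      (\<lambda>g. pcomp free_ns_operad m n i f g)"
    using graft_prod_closed[of i m f _ n]
    by (intro linear_onI) (simp_all add: graft_prod_add graft_prod_smult)
qed (rule free_module)

section \<open>The operad Dias\<close>

text \<open>By the relations of \<open>Dias\<close>, a monomial in \<open>n\<close> variables depends only on the one variable to
  which all operation signs point. Its number is the center of the corresponding tree.\<close>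

primrec center :: "dias_op tree \<Rightarrow> nat"
  where
    "center Leaf = 1"
  | "center (Node l a r) = (case a of Dashv \<Rightarrow> center l | Vdash \<Rightarrow> size1 l + center r)"

lemma center_bounds: "1 \<le> center t" "center t \<le> size1 t"
  by (induction t) (auto split: dias_op.split)

lemma center_graft:
  "\<lbrakk>1 \<le> i; i \<le> size1 s\<rbrakk> \<Longrightarrow> center (graft s i t) =
    (if center s = i then inner_pos i (center t) else outer_pos (size1 t) i (center s))"
proof (induction s arbitrary: i)
  case (Node l a r)
  have l: "1 \<le> center l" "center l \<le> size1 l" and r: "1 \<le> center r" "center r \<le> size1 r"
    and t: "1 \<le> center t" "center t \<le> size1 t" "1 \<le> size1 t"
    using center_bounds size1_ge0[of t] by (auto simp del: size1_ge0)
  show ?case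
  proof (cases "i \<le> size1 l")
    case True
    then show ?thesis
      using Node.IH(1)[of i] Node.prems size1_graft[of i l t] l r t
      by (cases a) (auto simp: pos_defs)
  next
    case False
    then have "1 \<le> i - size1 l" "i - size1 l \<le> size1 r" using Node.prems by auto
    then show ?thesis
      using Node.IH(2)[of "i - size1 l"] False l r t
      by (cases a) (auto simp: pos_defs)
  qed
qed (simp add: pos_defs)

text \<open>A monomial with center \<open>j\<close> is represented by the vector \<open>e\<^sub>j - e\<^bsub>n+1\<^esub>\<close>, where \<open>e\<^sub>1, \<dots>, e\<^bsub>n+1\<^esub>\<close> is a
  basis permuted by the symmetric group on \<open>n + 1\<close> letters. The additional basis vector is there
  because it turns \<open>\<tau>\<close> into the rotation of the basis.\<close>

definition weight :: "dias_op tree \<Rightarrow> nat \<Rightarrow> rat"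
  where "weight t p = (if p = center t then 1 else 0) - (if p = size1 t + 1 then 1 else 0)"

definition coords :: "(dias_op tree \<Rightarrow>\<^sub>0 rat) \<Rightarrow> nat \<Rightarrow> rat"
  where "coords f p = (\<Sum>t\<in>keys f. lookup f t * weight t p)"

lemma coords_superset:
  assumes "finite T" "keys f \<subseteq> T"
  shows "coords f p = (\<Sum>t\<in>T. lookup f t * weight t p)"
  unfolding coords_def using assms by (intro sum.mono_neutral_left) (auto simp: in_keys_iff)

lemma coords_add: "coords (f + g) p = coords f p + coords g p"
  using keys_add[of f g]
  by (subst (1 2 3) coords_superset[where T = "keys f \<union> keys g"])
    (auto simp: lookup_add distrib_right sum.distrib)

lemma coords_smult: "coords (Poly_Mapping.map ((*) c) f) p = c * coords f p"
  using keys_smult_subset[of c f]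
  by (subst (1 2) coords_superset[where T = "keys f"])
    (auto simp: sum_distrib_left mult.assoc)

lemma coords_uminus: "coords (- f) p = - coords f p"
  unfolding coords_def by (simp add: sum_negf)

lemma coords_diff: "coords (f - g) p = coords f p - coords g p"
  using coords_add[of f "- g" p] by (simp add: coords_uminus)

lemma coords_zero [simp]: "coords 0 p = 0"
  by (simp add: coords_def)

lemma coords_single [simp]: "coords (single t a) p = a * weight t p"
  by (subst coords_superset[where T = "{t}"]) auto

lemma coords_sum: "coords (\<Sum>x\<in>B. F x) p = (\<Sum>x\<in>B. coords (F x) p)"
  by (induction B rule: infinite_finite_induct) (simp_all add: coords_add)

definition sum_zero :: "nat \<Rightarrow> (nat \<Rightarrow> rat) \<Rightarrow> bool"
  where "sum_zero n v \<longleftrightarrow> (\<forall>p. p < 1 \<or> n + 1 < p \<longrightarrow> v p = 0) \<and> (\<Sum>p=1..n + 1. v p) = 0"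

lemma sum_zero_weight: "sum_zero (size1 t) (weight t)"
  using center_bounds[of t] by (auto simp: sum_zero_def weight_def sum_subtractf sum.delta)

lemma sum_zero_coords:
  assumes "f \<in> elems free_ns_operad n"
  shows "sum_zero n (coords f)"
proof -
  have w: "sum_zero n (weight t)" if "t \<in> keys f" for t
    using sum_zero_weight[of t] assms that by auto
  have "(\<Sum>p=1..n + 1. coords f p) = (\<Sum>t\<in>keys f. lookup f t * (\<Sum>p=1..n + 1. weight t p))"
    unfolding coords_def sum_distrib_left by (rule sum.swap)
  also have "\<dots> = 0" using w by (simp add: sum_zero_def)
  finally show ?thesis using w by (auto simp: sum_zero_def coords_def)
qed

text \<open>Composition in coordinates. The last coordinate \<open>w (n + 1)\<close> is minus the sum of the others, so
  that \<open>- w (n + 1)\<close> is the total weight of the monomials that are inserted.\<close>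

definition coord_comp :: "nat \<Rightarrow> nat \<Rightarrow> (nat \<Rightarrow> rat) \<Rightarrow> (nat \<Rightarrow> rat) \<Rightarrow> nat \<Rightarrow> rat"
  where "coord_comp n i v w p =
    (if p < i then - w (n + 1) * v p
     else if p < i + n then v i * w (p + 1 - i)
     else - w (n + 1) * v (p + 1 - n))"

lemma weight_graft:
  assumes "1 \<le> i" "i \<le> size1 s"
  shows "weight (graft s i t) p = coord_comp (size1 t) i (weight s) (weight t) p"
proof -
  have b: "1 \<le> center s" "center s \<le> size1 s" "1 \<le> center t" "center t \<le> size1 t"
    using center_bounds by auto
  have wt: "weight t (size1 t + 1) = -1" using b by (simp add: weight_def)
  have wi: "weight s i = (if i = center s then 1 else 0)" using assms by (simp add: weight_def)
  have sz: "size1 s + size1 t - 1 + 1 = size1 s + size1 t" using b by simp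
  have lhs: "weight (graft s i t) p =
      (if p = (if center s = i then i + center t - 1 else if center s < i then center s
        else center s + size1 t - 1) then 1 else 0) - (if p = size1 s + size1 t then 1 else 0)"
    unfolding weight_def center_graft[OF assms] size1_graft[OF assms] pos_defs sz ..
  consider "p < i" | "i \<le> p" "p < i + size1 t" | "i + size1 t \<le> p" by linarith
  then show ?thesis
  proof cases
    case 1
    then have p: "p \<noteq> i + center t - 1" "p \<noteq> size1 s + size1 t" "p \<noteq> size1 s + 1"
      "i < center s \<Longrightarrow> p \<noteq> center s + size1 t - 1" "i < center s \<Longrightarrow> p \<noteq> center s"
      "i = center s \<Longrightarrow> p \<noteq> center s"
      using assms b by linarith+
    have "weight s p = (if p = center s then 1 else 0)"
      using p(3) by (simp add: weight_def)
    then show ?thesis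
      using 1 p unfolding lhs coord_comp_def wt
      by (cases "center s" i rule: linorder_cases) simp_all
  next
    case 2
    then have p: "p = i + center t - 1 \<longleftrightarrow> p + 1 - i = center t" "p + 1 - i \<noteq> size1 t + 1"
      "p \<noteq> size1 s + size1 t" "center s < i \<Longrightarrow> p \<noteq> center s"
      "i < center s \<Longrightarrow> p \<noteq> center s + size1 t - 1"
      using assms b by linarith+
    have "weight t (p + 1 - i) = (if p + 1 - i = center t then 1 else 0)"
      using p(2) by (simp add: weight_def)
    then show ?thesis
      using 2 p unfolding lhs coord_comp_def wi
      by (cases "center s" i rule: linorder_cases) simp_all
  next
    case 3
    then have p: "p \<noteq> i + center t - 1" "p = size1 s + size1 t \<longleftrightarrow> p + 1 - size1 t = size1 s + 1"
      "p = center s + size1 t - 1 \<longleftrightarrow> p + 1 - size1 t = center s"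
      "p + 1 - size1 t = center s \<Longrightarrow> i < center s" "center s < i \<Longrightarrow> p \<noteq> center s"
      using assms b by linarith+
    have "weight s (p + 1 - size1 t) = (if p + 1 - size1 t = center s then 1 else 0) -
        (if p = size1 s + size1 t then 1 else 0)"
      unfolding weight_def p(2) ..
    then show ?thesis
      using 3 p(1,3,4,5) unfolding lhs coord_comp_def wt
      by (cases "center s" i rule: linorder_cases) simp_all
  qed
qed

lemma coord_comp_sum:
  "coord_comp n i (\<lambda>p. \<Sum>s\<in>B. a s * v s p) (\<lambda>p. \<Sum>t\<in>C. b t * w t p) p =
    (\<Sum>s\<in>B. \<Sum>t\<in>C. a s * b t * coord_comp n i (v s) (w t) p)"
  unfolding coord_comp_def
  by (auto simp: sum_product sum_negf[symmetric] mult_ac sum.swap[of _ C B])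

lemma coords_graft_prod:
  assumes "1 \<le> i" "i \<le> m" "f \<in> elems free_ns_operad m" "g \<in> elems free_ns_operad n"
  shows "coords (graft_prod i f g) = coord_comp n i (coords f) (coords g)"
proof
  fix p
  have "coords (graft_prod i f g) p = (\<Sum>s\<in>keys f. \<Sum>t\<in>keys g.
      lookup f s * lookup g t * weight (graft s i t) p)"
    unfolding graft_prod_def coords_sum coords_single ..
  also have "\<dots> = (\<Sum>s\<in>keys f. \<Sum>t\<in>keys g.
      lookup f s * lookup g t * coord_comp n i (weight s) (weight t) p)"
    using assms by (intro sum.cong refl) (auto simp: weight_graft)
  also have "\<dots> = coord_comp n i (coords f) (coords g) p"
    unfolding coord_comp_sum[symmetric] coords_def ..
  finally show "coords (graft_prod i f g) p = coord_comp n i (coords f) (coords g) p" .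
qed

text \<open>The normal form \<open>x\<^sub>1 \<turnstile> (\<dots> (x\<^bsub>j-1\<^esub> \<turnstile> ((x\<^sub>j \<stileturn> x\<^bsub>j+1\<^esub>) \<stileturn> \<dots> \<stileturn> x\<^sub>n)))\<close>.\<close>

primrec add_right :: "dias_op tree \<Rightarrow> nat \<Rightarrow> dias_op tree"
  where "add_right t 0 = t" | "add_right t (Suc k) = add_right t k \<stileturn> Leaf"

primrec add_left :: "nat \<Rightarrow> dias_op tree \<Rightarrow> dias_op tree"
  where "add_left 0 t = t" | "add_left (Suc k) t = Leaf \<turnstile> add_left k t"

definition normal_form :: "nat \<Rightarrow> nat \<Rightarrow> dias_op tree"
  where "normal_form n j = add_left (j - 1) (add_right Leaf (n - j))"

lemma size1_add [simp]:
  "size1 (add_right t k) = size1 t + k" "size1 (add_left k t) = k + size1 t"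
  by (induction k) auto

lemma center_add [simp]:
  "center (add_right t k) = center t" "center (add_left k t) = k + center t"
  by (induction k) auto

lemma normal_form_sel:
  assumes "1 \<le> j" "j \<le> n"
  shows "size1 (normal_form n j) = n" "center (normal_form n j) = j"
  using assms by (simp_all add: normal_form_def)

lemma dias_relations_closed: "dias_relations k \<subseteq> elems free_ns_operad k"
proof
  fix f assume "f \<in> dias_relations k"
  then show "f \<in> elems free_ns_operad k"
    unfolding dias_relations_def Let_def
    by (auto split: if_splits dest!: subsetD[OF keys_diff])
qed

lemmas dias_gen = gen_ns_ideal[OF free_ns_operad dias_relations_closed, folded dias_ideal_def]

lemma dias_ideal_module: "1 \<le> n \<Longrightarrow> submodule (dias_ideal n) rat_field (comps free_ns_operad n)"
  using dias_gen(1) by (simp add: ns_ideal_def)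

lemma dias_ideal_facts:
  assumes "1 \<le> n"
  shows "f \<in> dias_ideal n \<Longrightarrow> f \<in> elems free_ns_operad n" "0 \<in> dias_ideal n"
    "\<lbrakk>f \<in> dias_ideal n; g \<in> dias_ideal n\<rbrakk> \<Longrightarrow> f + g \<in> dias_ideal n"
    "f \<in> dias_ideal n \<Longrightarrow> Poly_Mapping.map ((*) c) f \<in> dias_ideal n"
    "f \<in> dias_ideal n \<Longrightarrow> - f \<in> dias_ideal n"
proof -
  note E = submodule_facts[OF free_module dias_ideal_module[OF assms]]
  show 1: "f \<in> dias_ideal n \<Longrightarrow> f \<in> elems free_ns_operad n" for f using E(1) by blast
  show "0 \<in> dias_ideal n" using E(2) by simp
  show "\<lbrakk>f \<in> dias_ideal n; g \<in> dias_ideal n\<rbrakk> \<Longrightarrow> f + g \<in> dias_ideal n" using E(3)[of f g] by simp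
  show "f \<in> dias_ideal n \<Longrightarrow> Poly_Mapping.map ((*) c) f \<in> dias_ideal n" using E(4)[of f c] by simp
  show "f \<in> dias_ideal n \<Longrightarrow> - f \<in> dias_ideal n" using E(5)[of f] free_uminus[OF 1] by metis
qed

definition tree_cong :: "dias_op tree \<Rightarrow> dias_op tree \<Rightarrow> bool"
  where "tree_cong s t \<longleftrightarrow> size1 s = size1 t \<and> tree_op s - tree_op t \<in> dias_ideal (size1 s)"

lemma size1_ge1: "1 \<le> size1 t"
  using size1_ge0[of t] by linarith

lemma tree_cong_refl [simp]: "tree_cong t t"
  using dias_ideal_facts(2)[OF size1_ge1] by (simp add: tree_cong_def)

lemma tree_cong_sym: "tree_cong s t \<Longrightarrow> tree_cong t s"
  using dias_ideal_facts(5)[OF size1_ge1, of "tree_op s - tree_op t" s] by (auto simp: tree_cong_def)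

lemma tree_cong_trans [trans]: "\<lbrakk>tree_cong s t; tree_cong t u\<rbrakk> \<Longrightarrow> tree_cong s u"
  using dias_ideal_facts(3)[OF size1_ge1, of "tree_op s - tree_op t" s "tree_op t - tree_op u"]
  by (auto simp: tree_cong_def)

lemma graft_prod_diff:
  "graft_prod i (tree_op s - tree_op t) (tree_op u) = tree_op (graft s i u) - tree_op (graft t i u)"
  "graft_prod i (tree_op u) (tree_op s - tree_op t) = tree_op (graft u i s) - tree_op (graft u i t)"
proof -
  have neg: "- tree_op x = single x (-1)" for x by (simp add: single_uminus)
  show "graft_prod i (tree_op s - tree_op t) (tree_op u) = tree_op (graft s i u) - tree_op (graft t i u)"
    unfolding diff_conv_add_uminus neg graft_prod_add graft_prod_single by simp
  show "graft_prod i (tree_op u) (tree_op s - tree_op t) = tree_op (graft u i s) - tree_op (graft u i t)"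
    unfolding diff_conv_add_uminus neg graft_prod_add graft_prod_single by simp
qed

lemma tree_op_closed: "size1 t = n \<Longrightarrow> tree_op t \<in> elems free_ns_operad n"
  by simp

lemma tree_cong_graft:
  assumes "tree_cong s t" "1 \<le> i"
  shows "i \<le> size1 s \<Longrightarrow> tree_cong (graft s i u) (graft t i u)"
    and "i \<le> size1 u \<Longrightarrow> tree_cong (graft u i s) (graft u i t)"
proof -
  have st: "size1 t = size1 s" "tree_op s - tree_op t \<in> dias_ideal (size1 s)"
    using assms(1) by (auto simp: tree_cong_def)
  note cl = dias_ideal_facts(1)[OF size1_ge1 st(2)] and u = tree_op_closed[OF refl, of u]
  note ideal = dias_gen(1)[unfolded ns_ideal_def, THEN conjunct2]
  show "tree_cong (graft s i u) (graft t i u)" if i: "i \<le> size1 s"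
  proof -
    have "pcomp free_ns_operad (size1 s) (size1 u) i (tree_op s - tree_op t) (tree_op u) \<in>
        dias_ideal (size1 s + size1 u - 1)"
      using ideal cl u st(2) assms(2) i size1_ge1[of u] by blast
    then show ?thesis
      using size1_graft[of i s u] size1_graft[of i t u] st(1) assms(2) i
      by (simp add: tree_cong_def graft_prod_diff)
  qed
  show "tree_cong (graft u i s) (graft u i t)" if i: "i \<le> size1 u"
  proof -
    have "pcomp free_ns_operad (size1 u) (size1 s) i (tree_op u) (tree_op s - tree_op t) \<in>
        dias_ideal (size1 u + size1 s - 1)"
      using ideal cl u st(2) assms(2) i size1_ge1[of s] by blast
    then show ?thesis
      using size1_graft[of i u s] size1_graft[of i u t] st(1) assms(2) i
      by (simp add: tree_cong_def graft_prod_diff)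
  qed
qed

lemma tree_cong_Node:
  assumes "tree_cong l l'" "tree_cong r r'"
  shows "tree_cong (Node l a r) (Node l' a r')"
proof -
  have "tree_cong (graft (Node Leaf a r) 1 l) (graft (Node Leaf a r) 1 l')"
    by (rule tree_cong_graft(2)[OF assms(1)]) simp_all
  then have 1: "tree_cong (Node l a r) (Node l' a r)" by simp
  have "size1 l' + 1 \<le> size1 (Node l' a Leaf)" by simp
  from tree_cong_graft(2)[OF assms(2) _ this]
  have "tree_cong (Node l' a r) (Node l' a r')" by simp
  with 1 show ?thesis by (rule tree_cong_trans)
qed

lemma tree_cong_substitute:
  assumes "tree_op s - tree_op t \<in> dias_relations 3" "size1 s = 3" "size1 t = 3"
  shows "tree_cong (graft (graft (graft s 3 z) 2 y) 1 x) (graft (graft (graft t 3 z) 2 y) 1 x)"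
proof -
  have "tree_cong s t" using assms dias_gen(2)[of 3] by (auto simp: tree_cong_def)
  then have "tree_cong (graft s 3 z) (graft t 3 z)" by (rule tree_cong_graft(1)) (simp_all add: assms)
  then have "tree_cong (graft (graft s 3 z) 2 y) (graft (graft t 3 z) 2 y)"
    by (rule tree_cong_graft(1)) (simp_all add: assms size1_graft)
  then show ?thesis
    using size1_ge1[of "graft (graft s 3 z) 2 y"] by (rule tree_cong_graft(1)[OF _ order_refl])
qed

lemma dias_tree_cong:
  "tree_cong (x \<stileturn> (y \<turnstile> z)) (x \<stileturn> (y \<stileturn> z))"
  "tree_cong (x \<stileturn> (y \<stileturn> z)) ((x \<stileturn> y) \<stileturn> z)"
  "tree_cong (x \<turnstile> (y \<stileturn> z)) ((x \<turnstile> y) \<stileturn> z)"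
  "tree_cong (x \<turnstile> (y \<turnstile> z)) ((x \<turnstile> y) \<turnstile> z)"
  "tree_cong ((x \<turnstile> y) \<turnstile> z) ((x \<stileturn> y) \<turnstile> z)"
  using tree_cong_substitute[of "Leaf \<stileturn> (Leaf \<turnstile> Leaf)" "Leaf \<stileturn> (Leaf \<stileturn> Leaf)" z y x]
    tree_cong_substitute[of "Leaf \<stileturn> (Leaf \<stileturn> Leaf)" "(Leaf \<stileturn> Leaf) \<stileturn> Leaf" z y x]
    tree_cong_substitute[of "Leaf \<turnstile> (Leaf \<stileturn> Leaf)" "(Leaf \<turnstile> Leaf) \<stileturn> Leaf" z y x]
    tree_cong_substitute[of "Leaf \<turnstile> (Leaf \<turnstile> Leaf)" "(Leaf \<turnstile> Leaf) \<turnstile> Leaf" z y x]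
    tree_cong_substitute[of "(Leaf \<turnstile> Leaf) \<turnstile> Leaf" "(Leaf \<stileturn> Leaf) \<turnstile> Leaf" z y x]
  by (simp_all add: dias_relations_def)

text \<open>The side that an operation sign points away from only counts with its number of leaves.\<close>

lemma tree_cong_add_right: "tree_cong (x \<stileturn> y) (add_right x (size1 y))"
proof (induction y arbitrary: x)
  case (Node l a r)
  have add: "add_right (add_right x j) k = add_right x (j + k)" for x j k
    by (induction k) simp_all
  have cong: "tree_cong x y \<Longrightarrow> tree_cong (add_right x k) (add_right y k)" for x y k
    by (induction k) (auto intro: tree_cong_Node)
  have "tree_cong (x \<stileturn> Node l a r) (x \<stileturn> (l \<stileturn> r))"
    using dias_tree_cong(1)[of x l r] by (cases a) simp_all
  also have "tree_cong \<dots> ((x \<stileturn> l) \<stileturn> r)" by (rule dias_tree_cong(2))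
  also have "tree_cong \<dots> (add_right (x \<stileturn> l) (size1 r))" by (rule Node.IH(2))
  also have "tree_cong \<dots> (add_right (add_right x (size1 l)) (size1 r))" by (rule cong[OF Node.IH(1)])
  finally show ?case by (simp add: add)
qed simp

lemma tree_cong_add_left: "tree_cong (x \<turnstile> y) (add_left (size1 x) y)"
proof (induction x arbitrary: y)
  case (Node l a r)
  have add: "add_left j (add_left k y) = add_left (j + k) y" for j k y
    by (induction j) simp_all
  have "tree_cong (Node l a r \<turnstile> y) ((l \<turnstile> r) \<turnstile> y)"
    using tree_cong_sym[OF dias_tree_cong(5)[of l r y]] by (cases a) simp_all
  also have "tree_cong \<dots> (l \<turnstile> (r \<turnstile> y))" by (rule tree_cong_sym[OF dias_tree_cong(4)])
  also have "tree_cong \<dots> (add_left (size1 l) (r \<turnstile> y))" by (rule Node.IH(1))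
  also have "tree_cong \<dots> (add_left (size1 l) (add_left (size1 r) y))"
  proof -
    have "tree_cong x y \<Longrightarrow> tree_cong (add_left k x) (add_left k y)" for x y k
      by (induction k) (auto intro: tree_cong_Node)
    then show ?thesis using Node.IH(2) by blast
  qed
  finally show ?case by (simp add: add)
qed simp

text \<open>Hence every tree can be brought into the normal form with the same number of leaves and the
  same center, in which the signs \<open>\<stileturn>\<close> act first.\<close>

lemma tree_cong_normal_form: "tree_cong t (normal_form (size1 t) (center t))"
proof (induction t)
  case (Node l a r)
  have l: "1 \<le> center l" "center l \<le> size1 l" and r: "1 \<le> center r" "center r \<le> size1 r"
    using center_bounds by auto
  show ?case
  proof (cases a)
    case Dashv
    have swap: "tree_cong (add_right (add_left j z) k) (add_left j (add_right z k))" for j k z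
    proof (induction k)
      case (Suc k)
      have "tree_cong (add_left j z \<stileturn> Leaf) (add_left j (z \<stileturn> Leaf))" for z
      proof (induction j)
        case (Suc j)
        have "tree_cong ((Leaf \<turnstile> add_left j z) \<stileturn> Leaf) (Leaf \<turnstile> (add_left j z \<stileturn> Leaf))"
          by (rule tree_cong_sym[OF dias_tree_cong(3)])
        also have "tree_cong \<dots> (Leaf \<turnstile> add_left j (z \<stileturn> Leaf))" by (rule tree_cong_Node) (simp_all add: Suc)
        finally show ?case by simp
      qed simp
      then show ?case
        using tree_cong_trans[OF tree_cong_Node[OF Suc.IH tree_cong_refl]] by simp
    qed simp
    have add: "add_right (add_right z j) k = add_right z (j + k)" for z j k
      by (induction k) simp_all
    have "tree_cong (l \<stileturn> r) (normal_form (size1 l) (center l) \<stileturn> r)"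
      by (rule tree_cong_Node[OF Node.IH(1) tree_cong_refl])
    also have "tree_cong \<dots> (add_right (normal_form (size1 l) (center l)) (size1 r))"
      by (rule tree_cong_add_right)
    also have "tree_cong \<dots> (normal_form (size1 l + size1 r) (center l))"
      using swap[of "center l - 1" "add_right Leaf (size1 l - center l)" "size1 r"] l
      by (simp add: normal_form_def add)
    finally show ?thesis by (simp add: Dashv)
  next
    case Vdash
    have add: "add_left j (add_left k z) = add_left (j + k) z" for j k z
      by (induction j) simp_all
    have "tree_cong (l \<turnstile> r) (l \<turnstile> normal_form (size1 r) (center r))"
      by (rule tree_cong_Node[OF tree_cong_refl Node.IH(2)])
    also have "tree_cong \<dots> (add_left (size1 l) (normal_form (size1 r) (center r)))"
      by (rule tree_cong_add_left)
    also have "\<dots> = normal_form (size1 l + size1 r) (size1 l + center r)"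
      using r by (simp add: normal_form_def add)
    finally show ?thesis by (simp add: Vdash)
  qed
qed (simp add: normal_form_def)

definition of_coords :: "nat \<Rightarrow> (nat \<Rightarrow> rat) \<Rightarrow> (dias_op tree \<Rightarrow>\<^sub>0 rat)"
  where "of_coords n v = (\<Sum>j=1..n. single (normal_form n j) (v j))"

lemma of_coords_closed: "of_coords n v \<in> elems free_ns_operad n"
  unfolding of_coords_def
  using keys_sum[of "\<lambda>j. single (normal_form n j) (v j)" "{1..n}"]
  by (fastforce simp: normal_form_sel split: if_splits)

lemma coords_of_coords:
  assumes "sum_zero n v"
  shows "coords (of_coords n v) = v"
proof
  fix p
  have "coords (of_coords n v) p =
      (\<Sum>j=1..n. v j * ((if p = j then 1 else 0) - (if p = n + 1 then 1 else 0)))"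
    unfolding of_coords_def coords_sum by (intro sum.cong) (auto simp: weight_def normal_form_sel)
  also have "\<dots> = (\<Sum>j=1..n. (if p = j then v j else 0)) - (if p = n + 1 then \<Sum>j=1..n. v j else 0)"
  proof -
    have "v j * ((if p = j then 1 else 0) - (if p = n + 1 then 1 else 0)) =
        (if p = j then v j else 0) - (if p = n + 1 then v j else 0)" for j
      by simp
    then show ?thesis by (cases "p = n + 1") (simp_all only: sum_subtractf if_True if_False simp_thms sum.neutral_const)
  qed
  also have "\<dots> = v p"
    using assms by (auto simp: sum_zero_def sum.delta' not_le)
  finally show "coords (of_coords n v) p = v p" .
qed

lemma minus_of_coords_mem_dias_ideal:
  assumes n: "1 \<le> n" and f: "f \<in> elems free_ns_operad n"
  shows "f - of_coords n (coords f) \<in> dias_ideal n"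
proof -
  let ?K = "keys f"
  have t: "size1 t = n" "1 \<le> center t" "center t \<le> n" if "t \<in> ?K" for t
    using f that center_bounds[of t] by auto
  have "of_coords n (coords f) =
      (\<Sum>j=1..n. \<Sum>t\<in>?K. single (normal_form n j) (if j = center t then lookup f t else 0))"
    unfolding of_coords_def
  proof (rule sum.cong[OF refl])
    fix j assume j: "j \<in> {1..n}"
    have single_sum: "single k (sum h T) = (\<Sum>t\<in>T. single k (h t))"
      for k :: "dias_op tree" and h :: "dias_op tree \<Rightarrow> rat" and T
      by (induction T rule: infinite_finite_induct) (simp_all add: single_add)
    have "coords f j = (\<Sum>t\<in>?K. if j = center t then lookup f t else 0)"
      unfolding coords_def using j t by (intro sum.cong) (auto simp: weight_def)
    then show "single (normal_form n j) (coords f j) =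
        (\<Sum>t\<in>?K. single (normal_form n j) (if j = center t then lookup f t else 0))"
      by (simp add: single_sum)
  qed
  also have "\<dots> = (\<Sum>t\<in>?K. \<Sum>j=1..n.
      single (normal_form n j) (if j = center t then lookup f t else 0))"
    by (rule sum.swap)
  also have "\<dots> = (\<Sum>t\<in>?K. single (normal_form n (center t)) (lookup f t))"
  proof (rule sum.cong[OF refl])
    fix t assume "t \<in> ?K"
    then have "center t \<in> {1..n}" using t by auto
    then show "(\<Sum>j=1..n. single (normal_form n j) (if j = center t then lookup f t else 0)) =
        single (normal_form n (center t)) (lookup f t)"
      by (subst sum.remove[of _ "center t"]) auto
  qed
  finally have "f - of_coords n (coords f) =
      (\<Sum>t\<in>?K. single t (lookup f t)) -
      (\<Sum>t\<in>?K. single (normal_form n (center t)) (lookup f t))"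
    by (simp add: sum_singles)
  also have "\<dots> = (\<Sum>t\<in>?K. Poly_Mapping.map ((*) (lookup f t))
      (tree_op t - tree_op (normal_form n (center t))))"
  proof -
    have "Poly_Mapping.map ((*) c) (tree_op s - tree_op t) = single s c - single t c"
      for c and s t :: "dias_op tree"
      by (rule poly_mapping_eqI) (simp add: lookup_minus lookup_single when_def right_diff_distrib)
    then show ?thesis by (simp add: sum_subtractf)
  qed
  also have "\<dots> \<in> dias_ideal n"
  proof -
    have "(\<Sum>t\<in>T. Poly_Mapping.map ((*) (lookup f t))
        (tree_op t - tree_op (normal_form n (center t)))) \<in> dias_ideal n" if "finite T" "T \<subseteq> ?K" for T
      using that
    proof (induction T rule: finite_induct)
      case empty
      then show ?case using dias_ideal_facts(2)[OF n] by simp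
    next
      case (insert t T)
      have "tree_op t - tree_op (normal_form n (center t)) \<in> dias_ideal n"
        using tree_cong_normal_form[of t] t[of t] insert.prems by (simp add: tree_cong_def)
      then show ?case
        using insert dias_ideal_facts(3,4)[OF n] by simp
    qed
    then show ?thesis by simp
  qed
  finally show ?thesis .
qed

text \<open>So \<open>Dias(n)\<close> is the space of vectors of coordinate sum zero: a combination is
  congruent to the combination of normal forms with the same coordinates, and the combinations with
  vanishing coordinates form an ideal that contains the relations.\<close>

lemma mem_dias_ideal_iff:
  assumes n: "1 \<le> n" and f: "f \<in> elems free_ns_operad n"
  shows "f \<in> dias_ideal n \<longleftrightarrow> coords f = (\<lambda>p. 0)"
proof
  let ?K = "\<lambda>n. {f \<in> elems free_ns_operad n. coords f = (\<lambda>p. 0)}"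
  have "ns_ideal free_ns_operad ?K"
    unfolding ns_ideal_def
  proof (intro conjI allI impI ballI)
    fix n :: nat
    interpret V: module rat_field "comps free_ns_operad n :: (rat, dias_op tree \<Rightarrow>\<^sub>0 rat) module"
      by (rule free_module)
    show "submodule (?K n) rat_field (comps free_ns_operad n)"
    proof (rule submodule_ratI[OF free_module])
      fix a b c assume a: "a \<in> ?K n"
      have "c \<odot>\<^bsub>comps free_ns_operad n\<^esub> a \<in> elems free_ns_operad n"
        using a by (intro V.smult_closed) auto
      then show "c \<odot>\<^bsub>comps free_ns_operad n\<^esub> a \<in> ?K n"
        using a by (auto simp: coords_smult fun_eq_iff)
      assume b: "b \<in> ?K n"
      have "a \<oplus>\<^bsub>comps free_ns_operad n\<^esub> b \<in> elems free_ns_operad n"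
        using a b by (intro V.a_closed) auto
      then show "a \<oplus>\<^bsub>comps free_ns_operad n\<^esub> b \<in> ?K n"
        using a b by (auto simp: coords_add fun_eq_iff)
    qed (auto simp: fun_eq_iff)
  next
    fix m n i f g
    assume fg: "f \<in> elems free_ns_operad m" "g \<in> elems free_ns_operad n"
      and i: "1 \<le> i \<and> i \<le> m \<and> 1 \<le> n \<and> (f \<in> ?K m \<or> g \<in> ?K n)"
    have "coords (graft_prod i f g) = (\<lambda>p. 0)"
      using coords_graft_prod[OF _ _ fg, of i] i by (auto simp: coord_comp_def fun_eq_iff)
    moreover have "graft_prod i f g \<in> elems free_ns_operad (m + n - 1)"
      using graft_prod_closed[OF _ _ fg] i by blast
    ultimately show "pcomp free_ns_operad m n i f g \<in> ?K (m + n - 1)"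
      by (simp del: free_ns_operad_sel(1))
  qed
  moreover have "dias_relations k \<subseteq> ?K k" for k
  proof
    fix f assume f: "f \<in> dias_relations k"
    then have "coords f = (\<lambda>p. 0)"
      unfolding dias_relations_def Let_def
      by (auto split: if_splits simp: coords_diff weight_def fun_eq_iff)
    then show "f \<in> ?K k" using dias_relations_closed[of k] f by blast
  qed
  ultimately have "dias_ideal n \<subseteq> ?K n" by (rule dias_gen(3))
  then show "coords f = (\<lambda>p. 0)" if "f \<in> dias_ideal n" using that by blast
next
  assume "coords f = (\<lambda>p. 0)"
  then show "f \<in> dias_ideal n"
    using minus_of_coords_mem_dias_ideal[OF n f] by (simp add: of_coords_def)
qed

section \<open>The anticyclic structure of Dias\<close>

lemmas ns_Dias_ops = quot_ns_operad_ops[OF free_ns_operad dias_gen(1), folded ns_Dias_def]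

abbreviation dias_class :: "nat \<Rightarrow> (dias_op tree \<Rightarrow>\<^sub>0 rat) \<Rightarrow> (dias_op tree \<Rightarrow>\<^sub>0 rat) set"
  where "dias_class \<equiv> quot_map free_ns_operad dias_ideal"

lemma ns_operad_Dias: "ns_operad ns_Dias"
  by (rule ns_Dias_ops(7))

lemma dias_class_closed: "\<lbrakk>1 \<le> n; f \<in> elems free_ns_operad n\<rbrakk> \<Longrightarrow> dias_class n f \<in> elems ns_Dias n"
  using ns_Dias_ops(2)[of n] by blast

lemma dias_class_cases:
  assumes "1 \<le> n" "U \<in> elems ns_Dias n"
  obtains f where "f \<in> elems free_ns_operad n" "U = dias_class n f"
  using ns_Dias_ops(2)[OF assms(1)] assms(2) by blast

lemma dias_class_eq_iff:
  assumes n: "1 \<le> n" and f: "f \<in> elems free_ns_operad n" and g: "g \<in> elems free_ns_operad n"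
  shows "dias_class n f = dias_class n g \<longleftrightarrow> coords f = coords g"
proof -
  have "f - g \<in> elems free_ns_operad n"
    using ns_operad.comps_closed(3)[OF free_ns_operad n f g] free_minus[OF g] by metis
  from mem_dias_ideal_iff[OF n this] show ?thesis
    unfolding ns_Dias_ops(6)[OF n f g] free_minus[OF g] by (simp add: fun_eq_iff coords_diff)
qed

lemma dias_class_uminus:
  assumes "1 \<le> n" "f \<in> elems free_ns_operad n"
  shows "dias_class n (- f) = \<ominus>\<^bsub>comps ns_Dias n\<^esub> dias_class n f"
  using linear_on_uminus[OF free_module ns_operad.vector_space[OF ns_operad_Dias] ns_Dias_ops(1)] assms
    free_uminus[OF assms(2)] by metis

definition rotate_coords :: "nat \<Rightarrow> (nat \<Rightarrow> rat) \<Rightarrow> (nat \<Rightarrow> rat)"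
  where "rotate_coords n v = v \<circ> perm_inv (long_cycle n)"

lemma long_cycle_inv: "perm_inv (long_cycle n) p = (if p = n + 1 then 1 else if 1 \<le> p \<and> p \<le> n then p + 1 else p)"
  by (rule permutes_inv_eq[OF long_cycle_permutes, THEN iffD2]) (auto simp: long_cycle_def)

lemma rotate_coords_apply: "rotate_coords n v p = (if p = n + 1 then v 1 else if 1 \<le> p \<and> p \<le> n then v (p + 1) else v p)"
  by (simp add: rotate_coords_def long_cycle_inv)

lemma sum_zero_rotate_coords: "sum_zero n v \<Longrightarrow> sum_zero n (rotate_coords n v)"
  unfolding sum_zero_def rotate_coords_def
  using sum.permute[OF permutes_inv[OF long_cycle_permutes], of v n]
    permutes_not_in[OF permutes_inv[OF long_cycle_permutes], of _ n] by auto

text \<open>The two anticyclic identities in coordinates.\<close>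

lemma rotate_coord_comp:
  assumes i: "2 \<le> i" "i \<le> m" "1 \<le> n" and v: "sum_zero m v"
  shows "rotate_coords (m + n - 1) (coord_comp n i v w) = coord_comp n (i - 1) (rotate_coords m v) w"
proof
  fix p
  have v0: "v p = 0" if "p < 1 \<or> m + 1 < p" for p using v that unfolding sum_zero_def by blast
  consider "p = 0" | "1 \<le> p" "p < i - 1" | "1 \<le> p" "i - 1 \<le> p" "p < i - 1 + n"
    | "i - 1 + n \<le> p" "p < m + n" | "p = m + n" | "m + n < p" by linarith
  then show "rotate_coords (m + n - 1) (coord_comp n i v w) p = coord_comp n (i - 1) (rotate_coords m v) w p"
  proof cases
    case 1
    then show ?thesis using i v0[of 0] by (simp add: rotate_coords_apply coord_comp_def)
  next
    case 2
    then have "p \<noteq> m + n - 1 + 1" "p \<le> m + n - 1" "p + 1 < i" "p \<noteq> m + 1" "p \<le> m"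
      using i by linarith+
    then show ?thesis using 2 by (simp only: rotate_coords_apply coord_comp_def if_True if_False simp_thms)
  next
    case 3
    then have "p \<noteq> m + n - 1 + 1" "p \<le> m + n - 1" "\<not> p + 1 < i" "p + 1 < i + n" "\<not> p < i - 1"
      "p + 1 + 1 - i = p + 1 - (i - 1)" "i - 1 \<noteq> m + 1" "1 \<le> i - 1" "i - 1 \<le> m" "i - 1 + 1 = i"
      using i by linarith+
    then show ?thesis using 3 by (simp only: rotate_coords_apply coord_comp_def if_True if_False simp_thms)
  next
    case 4
    then have "p \<noteq> m + n - 1 + 1" "1 \<le> p" "p \<le> m + n - 1" "\<not> p + 1 < i" "\<not> p + 1 < i + n" "\<not> p < i - 1"
      "\<not> p < i - 1 + n" "p + 1 + 1 - n = p + 1 - n + 1" "p + 1 - n \<noteq> m + 1" "1 \<le> p + 1 - n" "p + 1 - n \<le> m"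
      using i by linarith+
    then show ?thesis by (simp only: rotate_coords_apply coord_comp_def if_True if_False simp_thms)
  next
    case 5
    then have "p = m + n - 1 + 1" "(1 :: nat) < i" "\<not> p < i - 1" "\<not> p < i - 1 + n" "p + 1 - n = m + 1"
      using i by linarith+
    then show ?thesis by (simp only: rotate_coords_apply coord_comp_def if_True if_False simp_thms)
  next
    case 6
    then have "p \<noteq> m + n - 1 + 1" "\<not> p \<le> m + n - 1" "\<not> p < i" "\<not> p < i + n" "\<not> p < i - 1"
      "\<not> p < i - 1 + n" "p + 1 - n \<noteq> m + 1" "\<not> p + 1 - n \<le> m"
      using i by linarith+
    then show ?thesis by (simp only: rotate_coords_apply coord_comp_def if_True if_False simp_thms)
  qed
qed

lemma rotate_coord_comp_first:
  assumes m: "1 \<le> m" "1 \<le> n" and v: "sum_zero m v" and w: "sum_zero n w"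
  shows "rotate_coords (m + n - 1) (coord_comp n 1 v w) = (\<lambda>p. - coord_comp m n (rotate_coords n w) (rotate_coords m v) p)"
proof
  fix p
  have v0: "v p = 0" if "p < 1 \<or> m + 1 < p" for p using v that unfolding sum_zero_def by blast
  have w0: "w p = 0" if "p < 1 \<or> n + 1 < p" for p using w that unfolding sum_zero_def by blast
  have rot: "rotate_coords m v (m + 1) = v 1" "rotate_coords n w n = w (n + 1)" using m by (simp_all add: rotate_coords_apply)
  consider "p = 0" | "1 \<le> p" "p < n" | "n \<le> p" "p < m + n" | "p = m + n" | "m + n < p" by linarith
  then show "rotate_coords (m + n - 1) (coord_comp n 1 v w) p = - coord_comp m n (rotate_coords n w) (rotate_coords m v) p"
  proof cases
    case 1
    then show ?thesis using m v0[of 0] w0[of 0] by (simp add: rotate_coords_apply coord_comp_def)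
  next
    case 2
    then have "p \<noteq> m + n - 1 + 1" "p \<le> m + n - 1" "\<not> p + 1 < 1" "p + 1 < 1 + n" "p + 1 + 1 - 1 = p + 1"
      "p \<noteq> n + 1" "p \<le> n"
      using m by linarith+
    with 2 have "rotate_coords (m + n - 1) (coord_comp n 1 v w) p = v 1 * w (p + 1)"
      "rotate_coords n w p = w (p + 1)"
      by (simp_all only: rotate_coords_apply coord_comp_def if_True if_False simp_thms)
    then show ?thesis using 2 rot by (simp add: coord_comp_def)
  next
    case 3
    then have "1 \<le> p" "p \<noteq> m + n - 1 + 1" "p \<le> m + n - 1" "\<not> p + 1 < 1" "\<not> p + 1 < 1 + n"
      "p + 1 + 1 - n = p + 1 - n + 1" "p + 1 - n \<noteq> m + 1" "1 \<le> p + 1 - n" "p + 1 - n \<le> m"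
      using m by linarith+
    with 3 have "rotate_coords (m + n - 1) (coord_comp n 1 v w) p = - w (n + 1) * v (p + 1 - n + 1)"
      "rotate_coords m v (p + 1 - n) = v (p + 1 - n + 1)"
      by (simp_all only: rotate_coords_apply coord_comp_def if_True if_False simp_thms)
    then show ?thesis using 3 rot by (simp add: coord_comp_def)
  next
    case 4
    then have "p = m + n - 1 + 1" using m by linarith
    then have "rotate_coords (m + n - 1) (coord_comp n 1 v w) p = v 1 * w 1"
      using m by (simp add: rotate_coords_apply coord_comp_def)
    moreover have "p + 1 - m = n + 1" using 4 by simp
    then have "coord_comp m n (rotate_coords n w) (rotate_coords m v) p = - rotate_coords m v (m + 1) * rotate_coords n w (n + 1)"
      using 4 by (simp add: coord_comp_def)
    ultimately show ?thesis by (simp add: rotate_coords_apply)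
  next
    case 5
    then have p: "p \<noteq> m + n - 1 + 1" "\<not> p \<le> m + n - 1" "\<not> p < 1" "\<not> p < 1 + n" "\<not> p < n" "\<not> p < n + m"
      "p + 1 - m \<noteq> n + 1" "\<not> p + 1 - m \<le> n" "m + 1 < p + 1 - n" "n + 1 < p + 1 - m"
      using m by linarith+
    then have "rotate_coords (m + n - 1) (coord_comp n 1 v w) p = - w (n + 1) * v (p + 1 - n)"
      "coord_comp m n (rotate_coords n w) (rotate_coords m v) p = - rotate_coords m v (m + 1) * w (p + 1 - m)"
      by (simp_all only: rotate_coords_apply coord_comp_def if_True if_False simp_thms)
    then show ?thesis using v0[of "p + 1 - n"] w0[of "p + 1 - m"] p by simp
  qed
qed

text \<open>The map \<open>\<tau>\<close> of \<open>Dias\<close>, computed on an arbitrary representative of a class.\<close>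

definition dias_rotation :: "nat \<Rightarrow> (dias_op tree \<Rightarrow>\<^sub>0 rat) set \<Rightarrow> (dias_op tree \<Rightarrow>\<^sub>0 rat) set"
  where "dias_rotation = (\<lambda>n\<in>{1..}. \<lambda>U\<in>elems ns_Dias n.
    dias_class n (of_coords n (rotate_coords n (coords (SOME f. f \<in> elems free_ns_operad n \<and> dias_class n f = U)))))"

lemma dias_rotation_class:
  assumes n: "1 \<le> n" and f: "f \<in> elems free_ns_operad n" and g: "g \<in> elems free_ns_operad n"
    and eq: "coords g = rotate_coords n (coords f)"
  shows "dias_rotation n (dias_class n f) = dias_class n g"
proof -
  define f' where "f' = (SOME f'. f' \<in> elems free_ns_operad n \<and> dias_class n f' = dias_class n f)"
  have "f' \<in> elems free_ns_operad n \<and> dias_class n f' = dias_class n f"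
    unfolding f'_def by (rule someI) (use f in blast)
  then have "coords f' = coords f" using dias_class_eq_iff[OF n _ f] by blast
  then have "coords (of_coords n (rotate_coords n (coords f'))) = coords g"
    using coords_of_coords[OF sum_zero_rotate_coords[OF sum_zero_coords[OF f]]] eq by simp
  then have "dias_class n (of_coords n (rotate_coords n (coords f'))) = dias_class n g"
    using dias_class_eq_iff[OF n of_coords_closed g] by blast
  then show ?thesis
    using n dias_class_closed[OF n f] by (simp add: dias_rotation_def f'_def)
qed

lemma ex_rotate_coords:
  assumes "f \<in> elems free_ns_operad n"
  obtains g where "g \<in> elems free_ns_operad n" "coords g = rotate_coords n (coords f)"
  using coords_of_coords[OF sum_zero_rotate_coords[OF sum_zero_coords[OF assms]]] of_coords_closed that by blast

lemma dias_rotation_closed: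
  assumes "1 \<le> n" "U \<in> elems ns_Dias n"
  shows "dias_rotation n U \<in> elems ns_Dias n"
proof -
  obtain f where f: "f \<in> elems free_ns_operad n" "U = dias_class n f" using dias_class_cases[OF assms] .
  obtain g where "g \<in> elems free_ns_operad n" "coords g = rotate_coords n (coords f)" using ex_rotate_coords[OF f(1)] .
  then show ?thesis using dias_rotation_class[OF assms(1) f(1)] f(2) dias_class_closed[OF assms(1)] by simp
qed

lemma dias_rotation_pow:
  assumes n: "1 \<le> n" and f: "f \<in> elems free_ns_operad n"
  shows "\<exists>g\<in>elems free_ns_operad n. coords g = coords f \<circ> (perm_inv (long_cycle n) ^^ k) \<and>
    (dias_rotation n ^^ k) (dias_class n f) = dias_class n g"
proof (induction k)
  case 0
  then show ?case using f by (intro bexI[of _ f]) simp_all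
next
  case (Suc k)
  then obtain g where g: "g \<in> elems free_ns_operad n" "coords g = coords f \<circ> (perm_inv (long_cycle n) ^^ k)"
    "(dias_rotation n ^^ k) (dias_class n f) = dias_class n g" by blast
  obtain h where h: "h \<in> elems free_ns_operad n" "coords h = rotate_coords n (coords g)" using ex_rotate_coords[OF g(1)] .
  show ?case
  proof (intro bexI conjI)
    show "coords h = coords f \<circ> (perm_inv (long_cycle n) ^^ Suc k)"
      unfolding h(2) rotate_coords_def g(2) funpow_Suc_right by (simp only: comp_assoc)
    show "(dias_rotation n ^^ Suc k) (dias_class n f) = dias_class n h"
      using g(3) dias_rotation_class[OF n g(1) h] by simp
  qed (fact h(1))
qed

lemma dias_rotation_1:
  assumes "U \<in> elems ns_Dias 1"
  shows "dias_rotation 1 U = \<ominus>\<^bsub>comps ns_Dias 1\<^esub> U"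
proof -
  obtain f where f: "f \<in> elems free_ns_operad 1" "U = dias_class 1 f" using dias_class_cases[OF order_refl assms] .
  note z = sum_zero_coords[OF f(1)]
  have 0: "coords f p = 0" if "p < 1 \<or> 1 + 1 < p" for p
    using z that unfolding sum_zero_def by blast
  have 12: "coords f 1 + coords f 2 = 0"
    using z by (simp add: sum_zero_def eval_nat_numeral)
  have "coords (- f) = rotate_coords 1 (coords f)"
  proof
    fix p :: nat
    consider "p = 1" | "p = 2" | "p < 1 \<or> 1 + 1 < p" by linarith
    then show "coords (- f) p = rotate_coords 1 (coords f) p"
    proof cases
      case 1
      then show ?thesis using 12 by (simp add: coords_uminus rotate_coords_apply numeral_2_eq_2)
    next
      case 2
      then show ?thesis using 12 by (simp add: coords_uminus rotate_coords_apply numeral_2_eq_2)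
    next
      case 3
      then show ?thesis using 0[OF 3] by (auto simp: coords_uminus rotate_coords_apply)
    qed
  qed
  moreover have "- f \<in> elems free_ns_operad 1" using f(1) by simp
  ultimately show ?thesis
    unfolding f(2) dias_class_uminus[OF order_refl f(1), symmetric]
    by (intro dias_rotation_class[OF order_refl f(1)])
qed

lemma dias_rotation_anticyclic: "ns_anticyclic_operad ns_Dias dias_rotation"
proof (rule ns_anticyclic_operad.intro[OF ns_operad_Dias], rule ns_anticyclic_operad_axioms.intro)
  show "dias_rotation \<in> (\<Pi>\<^sub>E n\<in>{1..}. elems ns_Dias n \<rightarrow>\<^sub>E elems ns_Dias n)"
    by (intro PiE_I) (simp_all add: dias_rotation_closed, simp_all add: dias_rotation_def)
next
  fix n :: nat assume n: "1 \<le> n"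
  note L = linear_onD[OF ns_Dias_ops(1)[OF n]] and cl = ns_operad.comps_closed[OF free_ns_operad n]
  show "linear_on (comps ns_Dias n) (comps ns_Dias n) (dias_rotation n)"
  proof (rule linear_onI)
    fix U assume U: "U \<in> elems ns_Dias n"
    show "dias_rotation n U \<in> elems ns_Dias n" by (rule dias_rotation_closed[OF n U])
    obtain f where f: "f \<in> elems free_ns_operad n" "U = dias_class n f" using dias_class_cases[OF n U] .
    obtain f' where f': "f' \<in> elems free_ns_operad n" "coords f' = rotate_coords n (coords f)" using ex_rotate_coords[OF f(1)] .
    note rf = dias_rotation_class[OF n f(1) f']
    show "dias_rotation n (c \<odot>\<^bsub>comps ns_Dias n\<^esub> U) = c \<odot>\<^bsub>comps ns_Dias n\<^esub> dias_rotation n U" for c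
    proof -
      have "dias_rotation n (dias_class n (c \<odot>\<^bsub>comps free_ns_operad n\<^esub> f)) =
          dias_class n (c \<odot>\<^bsub>comps free_ns_operad n\<^esub> f')"
        by (rule dias_rotation_class[OF n cl(5)[OF f(1)] cl(5)[OF f'(1)]])
          (simp add: fun_eq_iff coords_smult f'(2) rotate_coords_def)
      then show ?thesis unfolding f(2) rf L(3)[OF f(1)] L(3)[OF f'(1)] .
    qed
    fix V assume V: "V \<in> elems ns_Dias n"
    obtain g where g: "g \<in> elems free_ns_operad n" "V = dias_class n g" using dias_class_cases[OF n V] .
    obtain g' where g': "g' \<in> elems free_ns_operad n" "coords g' = rotate_coords n (coords g)" using ex_rotate_coords[OF g(1)] .
    note rg = dias_rotation_class[OF n g(1) g']
    have "dias_rotation n (dias_class n (f \<oplus>\<^bsub>comps free_ns_operad n\<^esub> g)) =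
        dias_class n (f' \<oplus>\<^bsub>comps free_ns_operad n\<^esub> g')"
      by (rule dias_rotation_class[OF n cl(4)[OF f(1) g(1)] cl(4)[OF f'(1) g'(1)]])
        (simp add: fun_eq_iff coords_add f'(2) g'(2) rotate_coords_def)
    then show "dias_rotation n (U \<oplus>\<^bsub>comps ns_Dias n\<^esub> V) =
        dias_rotation n U \<oplus>\<^bsub>comps ns_Dias n\<^esub> dias_rotation n V"
      unfolding f(2) g(2) rf rg L(2)[OF f(1) g(1)] L(2)[OF f'(1) g'(1)] .
  qed
  fix U assume "U \<in> elems ns_Dias n"
  then obtain f where f: "f \<in> elems free_ns_operad n" "U = dias_class n f" using dias_class_cases[OF n] by blast
  obtain g where g: "g \<in> elems free_ns_operad n"
    "coords g = coords f \<circ> (perm_inv (long_cycle n) ^^ (n + 1))"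
    "(dias_rotation n ^^ (n + 1)) (dias_class n f) = dias_class n g"
    using dias_rotation_pow[OF n f(1)] by blast
  have "perm_inv (long_cycle n) ^^ (n + 1) = id"
    using inv_fn[OF permutes_bij[OF long_cycle_permutes], of "n + 1" n] long_cycle_pow_Suc[of n]
    by (simp add: inv_id del: funpow.simps)
  then have "coords g = coords f" using g(2) by (simp del: funpow.simps)
  then show "(dias_rotation n ^^ (n + 1)) U = U"
    using g(3) f(2) dias_class_eq_iff[OF n g(1) f(1)] by simp
next
  show "anticyclic_identities ns_Dias dias_rotation"
    unfolding anticyclic_identities_def
  proof (intro conjI allI ballI impI)
    show "dias_rotation 1 (unit ns_Dias) = \<ominus>\<^bsub>comps ns_Dias 1\<^esub> unit ns_Dias"
      by (rule dias_rotation_1[OF ns_operad.unit_closed[OF ns_operad_Dias]])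
    fix m n :: nat and U V
    assume m: "1 \<le> m" "1 \<le> n" and UV: "U \<in> elems ns_Dias m" "V \<in> elems ns_Dias n"
    obtain f where f: "f \<in> elems free_ns_operad m" "U = dias_class m f" using dias_class_cases[OF m(1) UV(1)] .
    obtain f' where f': "f' \<in> elems free_ns_operad m" "coords f' = rotate_coords m (coords f)" using ex_rotate_coords[OF f(1)] .
    obtain g where g: "g \<in> elems free_ns_operad n" "V = dias_class n g" using dias_class_cases[OF m(2) UV(2)] .
    obtain g' where g': "g' \<in> elems free_ns_operad n" "coords g' = rotate_coords n (coords g)" using ex_rotate_coords[OF g(1)] .
    have N: "1 \<le> m + n - 1" "n + m - 1 = m + n - 1" using m by auto
    note rf = dias_rotation_class[OF m(1) f(1) f'] and rg = dias_rotation_class[OF m(2) g(1) g']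
    {
      fix i assume i: "2 \<le> i \<and> i \<le> m"
      then have i': "1 \<le> i" "i \<le> m" "1 \<le> i - 1" "i - 1 \<le> m" by auto
      have eq: "coords (graft_prod (i - 1) f' g) = rotate_coords (m + n - 1) (coords (graft_prod i f g))"
        using coords_graft_prod[OF i'(3,4) f'(1) g(1)] coords_graft_prod[OF i'(1,2) f(1) g(1)]
          rotate_coord_comp[of i m n "coords f" "coords g"] i m(2) sum_zero_coords[OF f(1)] f'(2) by simp
      show "dias_rotation (m + n - 1) (pcomp ns_Dias m n i U V) = pcomp ns_Dias m n (i - 1) (dias_rotation m U) V"
        using dias_rotation_class[OF N(1) graft_prod_closed[OF i'(1,2) f(1) g(1)]
            graft_prod_closed[OF i'(3,4) f'(1) g(1)] eq]
          ns_Dias_ops(5)[OF i'(1,2) m(2) f(1) g(1)] ns_Dias_ops(5)[OF i'(3,4) m(2) f'(1) g(1)] rf f(2) g(2)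
        by (simp del: One_nat_def)
    }
    note cg = graft_prod_closed[OF m(2) order_refl g'(1) f'(1)]
    have "- graft_prod n g' f' \<in> elems free_ns_operad (m + n - 1)" using cg by (simp add: add.commute)
    moreover have "coords (- graft_prod n g' f') = rotate_coords (m + n - 1) (coords (graft_prod 1 f g))"
      unfolding coords_graft_prod[OF order_refl m(1) f(1) g(1)]
        rotate_coord_comp_first[OF m sum_zero_coords[OF f(1)] sum_zero_coords[OF g(1)]]
      using coords_graft_prod[OF m(2) order_refl g'(1) f'(1)] f'(2) g'(2)
      by (simp add: fun_eq_iff coords_uminus)
    ultimately have "dias_rotation (m + n - 1) (dias_class (m + n - 1) (graft_prod 1 f g)) =
        dias_class (m + n - 1) (- graft_prod n g' f')"
      by (rule dias_rotation_class[OF N(1) graft_prod_closed[OF order_refl m(1) f(1) g(1)]])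
    also have "\<dots> = \<ominus>\<^bsub>comps ns_Dias (m + n - 1)\<^esub> dias_class (n + m - 1) (graft_prod n g' f')"
      using dias_class_uminus[OF N(1)] cg by (simp only: N(2))
    finally show "dias_rotation (m + n - 1) (pcomp ns_Dias m n 1 U V) =
      \<ominus>\<^bsub>comps ns_Dias (m + n - 1)\<^esub> pcomp ns_Dias n m n (dias_rotation n V) (dias_rotation m U)"
      using ns_Dias_ops(5)[OF order_refl m f(1) g(1)] ns_Dias_ops(5)[OF m(2) order_refl m(1) g'(1) f'(1)]
        rf rg f(2) g(2)
      by (simp del: One_nat_def)
  qed
qed

lemma dias_generators_closed: "dias_dashv \<in> elems ns_Dias 2" "dias_vdash \<in> elems ns_Dias 2"
  unfolding dias_dashv_def dias_vdash_def by (intro dias_class_closed; simp)+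

lemma dias_rotation_generators:
  "dias_rotation 2 dias_dashv = \<ominus>\<^bsub>comps ns_Dias 2\<^esub> dias_vdash"
  "dias_rotation 2 dias_vdash = dias_dashv \<ominus>\<^bsub>comps ns_Dias 2\<^esub> dias_vdash"
proof -
  let ?d = "tree_op (Leaf \<stileturn> Leaf)" and ?v = "tree_op (Leaf \<turnstile> Leaf)"
  have cl: "?d \<in> elems free_ns_operad 2" "?v \<in> elems free_ns_operad 2" by simp_all
  have neg: "- ?v \<in> elems free_ns_operad 2" by simp
  have diff: "?d - ?v \<in> elems free_ns_operad 2"
    using ns_operad.comps_closed(3)[OF free_ns_operad _ cl] free_minus[OF cl(2)] by simp
  have "coords (- ?v) = rotate_coords 2 (coords ?d)" "coords (?d - ?v) = rotate_coords 2 (coords ?v)"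
    by (auto simp: fun_eq_iff coords_uminus coords_diff rotate_coords_apply weight_def)
  then have 1: "dias_rotation 2 (dias_class 2 ?d) = dias_class 2 (- ?v)"
    and 2: "dias_rotation 2 (dias_class 2 ?v) = dias_class 2 (?d - ?v)"
    using dias_rotation_class[OF _ cl(1) neg] dias_rotation_class[OF _ cl(2) diff] by simp_all
  show "dias_rotation 2 dias_dashv = \<ominus>\<^bsub>comps ns_Dias 2\<^esub> dias_vdash"
    using 1 dias_class_uminus[OF _ cl(2)] by (simp add: dias_dashv_def dias_vdash_def)
  show "dias_rotation 2 dias_vdash = dias_dashv \<ominus>\<^bsub>comps ns_Dias 2\<^esub> dias_vdash"
    using 2 linear_on_minus[OF free_module ns_operad.vector_space[OF ns_operad_Dias] ns_Dias_ops(1) cl]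
      free_minus[OF cl(2)] by (simp add: dias_dashv_def dias_vdash_def)
qed

text \<open>Every tree arises from the generators by compositions, so the anticyclic identities leave no
  choice for \<open>\<tau>\<close>.\<close>

lemma ns_Dias_anticyclic_unique:
  assumes T: "ns_anticyclic_operad ns_Dias \<tau>" and T': "ns_anticyclic_operad ns_Dias \<tau>'"
    and 1: "\<And>U. U \<in> elems ns_Dias 1 \<Longrightarrow> \<tau> 1 U = \<tau>' 1 U"
    and 2: "\<tau> 2 dias_dashv = \<tau>' 2 dias_dashv" "\<tau> 2 dias_vdash = \<tau>' 2 dias_vdash"
  shows "\<tau> = \<tau>'"
proof -
  interpret T: ns_anticyclic_operad ns_Dias \<tau> by fact
  interpret T': ns_anticyclic_operad ns_Dias \<tau>' by fact
  have cl: "dias_class (size1 t) (tree_op t) \<in> elems ns_Dias (size1 t)" for t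
    by (rule dias_class_closed[OF size1_ge1]) simp
  have trees: "\<tau> (size1 t) (dias_class (size1 t) (tree_op t)) = \<tau>' (size1 t) (dias_class (size1 t) (tree_op t))" for t
  proof (induction t)
    case Leaf
    then show ?case using 1 cl[of Leaf] by simp
  next
    case (Node l a r)
    let ?m = "size1 l" and ?n = "size1 r"
    have sz: "2 + ?n - 1 = size1 (Node Leaf a r)" "size1 (Node Leaf a r) + ?m - 1 = size1 (Node l a r)" by simp_all
    let ?g = "dias_class 2 (tree_op (Node Leaf a Leaf))"
    have g: "\<tau> 2 ?g = \<tau>' 2 ?g" "?g \<in> elems ns_Dias 2"
    proof -
      show "\<tau> 2 ?g = \<tau>' 2 ?g"
        using 2 unfolding dias_dashv_def dias_vdash_def by (cases a) (simp_all only:)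
      show "?g \<in> elems ns_Dias 2"
        by (rule dias_class_closed) simp_all
    qed
    have "pcomp ns_Dias 2 ?n 2 ?g (dias_class ?n (tree_op r)) =
        dias_class (2 + ?n - 1) (graft_prod 2 (tree_op (Node Leaf a Leaf)) (tree_op r))"
      using ns_Dias_ops(5)[of 2 2 ?n "tree_op (Node Leaf a Leaf)" "tree_op r"] size1_ge1[of r] by simp
    then have X: "dias_class (size1 (Node Leaf a r)) (tree_op (Node Leaf a r)) =
        pcomp ns_Dias 2 ?n 2 ?g (dias_class ?n (tree_op r))"
      by (simp add: graft_prod_single)
    have "\<tau> (size1 (Node Leaf a r)) (dias_class (size1 (Node Leaf a r)) (tree_op (Node Leaf a r))) =
        pcomp ns_Dias 2 ?n (2 - 1) (\<tau> 2 ?g) (dias_class ?n (tree_op r))"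
      unfolding X unfolding sz(1)[symmetric]
      by (rule T.tau_pcomp(1)[OF _ size1_ge1 g(2) cl]) simp_all
    also have "\<dots> = \<tau>' (size1 (Node Leaf a r)) (dias_class (size1 (Node Leaf a r)) (tree_op (Node Leaf a r)))"
      unfolding X unfolding sz(1)[symmetric] g(1)
      by (rule T'.tau_pcomp(1)[symmetric, OF _ size1_ge1 g(2) cl]) simp_all
    finally have IH: "\<tau> (size1 (Node Leaf a r)) (dias_class (size1 (Node Leaf a r)) (tree_op (Node Leaf a r))) =
      \<tau>' (size1 (Node Leaf a r)) (dias_class (size1 (Node Leaf a r)) (tree_op (Node Leaf a r)))" .
    have "pcomp ns_Dias (size1 (Node Leaf a r)) ?m 1 (dias_class (size1 (Node Leaf a r)) (tree_op (Node Leaf a r)))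
          (dias_class ?m (tree_op l)) =
        dias_class (size1 (Node Leaf a r) + ?m - 1) (graft_prod 1 (tree_op (Node Leaf a r)) (tree_op l))"
      using ns_Dias_ops(5)[of 1 "size1 (Node Leaf a r)" ?m "tree_op (Node Leaf a r)" "tree_op l"] size1_ge1[of l]
      by simp
    then have Y: "dias_class (size1 (Node l a r)) (tree_op (Node l a r)) =
        pcomp ns_Dias (size1 (Node Leaf a r)) ?m 1
          (dias_class (size1 (Node Leaf a r)) (tree_op (Node Leaf a r))) (dias_class ?m (tree_op l))"
      by (simp add: graft_prod_single add.commute)
    show ?case
      unfolding Y unfolding sz(2)[symmetric] T.tau_pcomp(2)[OF size1_ge1 size1_ge1 cl cl]
        T'.tau_pcomp(2)[OF size1_ge1 size1_ge1 cl cl] IH Node.IH(1) ..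
  qed
  have eq: "\<tau> n U = \<tau>' n U" if n: "1 \<le> n" and U: "U \<in> elems ns_Dias n" for n U
  proof -
    obtain f where f: "f \<in> elems free_ns_operad n" "U = dias_class n f" using dias_class_cases[OF n U] .
    note L = linear_onD(2,3)[OF linear_on_compose[OF ns_Dias_ops(1)[OF n] T.tau_linear[OF n]]]
    note L' = linear_onD(2,3)[OF linear_on_compose[OF ns_Dias_ops(1)[OF n] T'.tau_linear[OF n]]]
    have "(\<Sum>t\<in>B. single t (lookup f t)) \<in> elems free_ns_operad n \<and>
        \<tau> n (dias_class n (\<Sum>t\<in>B. single t (lookup f t))) =
        \<tau>' n (dias_class n (\<Sum>t\<in>B. single t (lookup f t)))"
      if "finite B" "B \<subseteq> keys f" for B
      using that
    proof (induction B rule: finite_induct)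
      case empty
      have "dias_class n 0 = \<zero>\<^bsub>comps ns_Dias n\<^esub>" using ns_Dias_ops(3)[OF n] by simp
      then show ?case using T.tau_pow_zero[OF n, of 1] T'.tau_pow_zero[OF n, of 1] by simp
    next
      case (insert t B)
      then have t: "size1 t = n" using f(1) by simp
      let ?c = "lookup f t" and ?s = "\<Sum>t\<in>B. single t (lookup f t)"
      have s: "?s \<in> elems free_ns_operad n" "\<tau> n (dias_class n ?s) = \<tau>' n (dias_class n ?s)"
        using insert by blast+
      have c: "single t ?c = ?c \<odot>\<^bsub>comps free_ns_operad n\<^esub> tree_op t" by simp
      have to: "tree_op t \<in> elems free_ns_operad n" using t by simp
      note tc = ns_operad.comps_closed(5)[OF free_ns_operad n to, of ?c, folded c]
      have tt: "\<tau> n (dias_class n (single t ?c)) = \<tau>' n (dias_class n (single t ?c))"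
        unfolding c L(2)[OF to] L'(2)[OF to] using trees[of t] t by simp
      have "\<tau> n (dias_class n (single t ?c \<oplus>\<^bsub>comps free_ns_operad n\<^esub> ?s)) =
          \<tau>' n (dias_class n (single t ?c \<oplus>\<^bsub>comps free_ns_operad n\<^esub> ?s))"
        unfolding L(1)[OF tc s(1)] L'(1)[OF tc s(1)] s(2) tt ..
      moreover have "single t ?c \<oplus>\<^bsub>comps free_ns_operad n\<^esub> ?s \<in> elems free_ns_operad n"
        by (rule ns_operad.comps_closed(4)[OF free_ns_operad n tc s(1)])
      moreover have "(\<Sum>t\<in>insert t B. single t (lookup f t)) =
          single t ?c \<oplus>\<^bsub>comps free_ns_operad n\<^esub> ?s"
        using insert by simp
      ultimately show ?case by (simp only:)
    qed
    from this[OF finite_keys order_refl] show ?thesis unfolding f(2) sum_singles by blast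
  qed
  show ?thesis
  proof (rule PiE_ext[OF T.tau_typed T'.tau_typed])
    fix n :: nat assume n: "n \<in> {1..}"
    show "\<tau> n = \<tau>' n"
      by (rule PiE_ext[OF PiE_mem[OF T.tau_typed n] PiE_mem[OF T'.tau_typed n]]) (use eq n in simp)
  qed
qed

lemma dias_tau_eq: "dias_tau = dias_rotation"
  unfolding dias_tau_def
proof (rule the_equality)
  show "ns_anticyclic_operad ns_Dias dias_rotation \<and>
    (\<forall>f\<in>elems ns_Dias 1. dias_rotation 1 f = \<ominus>\<^bsub>comps ns_Dias 1\<^esub> f) \<and>
    dias_rotation 2 dias_dashv = \<ominus>\<^bsub>comps ns_Dias 2\<^esub> dias_vdash \<and>
    dias_rotation 2 dias_vdash = dias_dashv \<ominus>\<^bsub>comps ns_Dias 2\<^esub> dias_vdash"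
    using dias_rotation_anticyclic dias_rotation_1 dias_rotation_generators by blast
  fix \<tau> assume "ns_anticyclic_operad ns_Dias \<tau> \<and>
    (\<forall>f\<in>elems ns_Dias 1. \<tau> 1 f = \<ominus>\<^bsub>comps ns_Dias 1\<^esub> f) \<and>
    \<tau> 2 dias_dashv = \<ominus>\<^bsub>comps ns_Dias 2\<^esub> dias_vdash \<and>
    \<tau> 2 dias_vdash = dias_dashv \<ominus>\<^bsub>comps ns_Dias 2\<^esub> dias_vdash"
  then show "\<tau> = dias_rotation"
    using dias_rotation_1 dias_rotation_generators
    by (intro ns_Dias_anticyclic_unique[OF _ dias_rotation_anticyclic]) simp_all
qed

lemma dias_tau: "ns_anticyclic_operad ns_Dias dias_tau"
  "dias_tau 2 dias_dashv = \<ominus>\<^bsub>comps ns_Dias 2\<^esub> dias_vdash"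
  "dias_tau 2 dias_vdash = dias_dashv \<ominus>\<^bsub>comps ns_Dias 2\<^esub> dias_vdash"
  unfolding dias_tau_eq by (rule dias_rotation_anticyclic dias_rotation_generators)+

lemma Dias_anticyclic: "anticyclic_operad Dias Dias_action"
  unfolding Dias_def Dias_action_def
  by (rule ns_anticyclic_operad.induced_action_anticyclic[OF dias_tau(1)])

section \<open>The operad Perm\<close>

lemma perms_2: "\<sigma> permutes {1..2 :: nat} \<longleftrightarrow> \<sigma> = id \<or> \<sigma> = transpose 1 2"
proof -
  have "{1..2 :: nat} = {1, 2}" by auto
  then show ?thesis by (simp add: permutes_doubleton_iff)
qed

text \<open>The element \<open>a \<otimes> id + b \<otimes> (1 2)\<close> of \<open>Dias(2)\<close>.\<close>

definition dias_pair :: "(dias_op tree \<Rightarrow>\<^sub>0 rat) set \<Rightarrow> (dias_op tree \<Rightarrow>\<^sub>0 rat) set \<Rightarrow> dias_elem"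
  where "dias_pair a b = (\<lambda>\<rho>\<in>perms 2. if \<rho> = id then a else b)"

lemma transpose_12_neq_id: "transpose 1 (2 :: nat) \<noteq> id"
  by (metis id_apply one_eq_numeral_iff semiring_norm(85) transpose_apply_first)

lemma dias_pair_closed:
  "\<lbrakk>a \<in> elems ns_Dias 2; b \<in> elems ns_Dias 2\<rbrakk> \<Longrightarrow> dias_pair a b \<in> elems (symmetrization ns_Dias) 2"
  by (auto simp: dias_pair_def)

lemma Dias_action_pair:
  assumes "a \<in> elems ns_Dias 2" "b \<in> elems ns_Dias 2"
  shows "Dias_action 2 (long_cycle 2) (dias_pair a b) = dias_pair (dias_tau 2 a) (dias_tau 2 (dias_tau 2 b))"
proof
  fix \<rho> :: "nat \<Rightarrow> nat"
  note u = dias_pair_closed[OF assms]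
  interpret T: ns_anticyclic_operad ns_Dias dias_tau by (rule dias_tau(1))
  have two: "(1 :: nat) \<le> 2" by simp
  have t: "transpose 1 2 permutes {1..2 :: nat}" by (simp only: perms_2 simp_thms)
  have c1: "long_cycle 2 \<circ> id = id \<circ> (long_cycle 2 ^^ 1)" by simp
  have c2: "long_cycle 2 \<circ> transpose 1 2 = transpose 1 2 \<circ> (long_cycle 2 ^^ 2)"
    by (auto simp: fun_eq_iff long_cycle_def transpose_def numeral_2_eq_2)
  note apply_id = T.induced_action_apply[OF two u long_cycle_permutes permutes_id permutes_id c1]
  note apply_t = T.induced_action_apply[OF two u long_cycle_permutes t t c2]
  consider "\<rho> \<notin> perms 2" | "\<rho> = id" | "\<rho> = transpose 1 2" using perms_2 by auto
  then show "Dias_action 2 (long_cycle 2) (dias_pair a b) \<rho> =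
      dias_pair (dias_tau 2 a) (dias_tau 2 (dias_tau 2 b)) \<rho>"
  proof cases
    case 1
    then show ?thesis
      using PiE_arb[OF T.induced_action_closed[OF two u long_cycle_permutes] 1]
      by (simp add: Dias_action_def dias_pair_def)
  next
    case 2
    then show ?thesis using apply_id permutes_id[of "{1..2}"] by (simp add: Dias_action_def dias_pair_def)
  next
    case 3
    have "(dias_tau 2 ^^ 2) b = dias_tau 2 (dias_tau 2 b)" by (simp add: numeral_2_eq_2)
    then show ?thesis
      using apply_t t transpose_12_neq_id unfolding 3 by (simp add: Dias_action_def dias_pair_def)
  qed
qed

lemma perm_relations_closed: "perm_relations k \<subseteq> elems Dias k"
proof (cases "k = 2")
  case True
  interpret T: ns_anticyclic_operad ns_Dias dias_tau by (rule dias_tau(1))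
  have "(1 :: nat) \<le> 2" by simp
  note cl = ns_operad.comps_closed(3)[OF T.symmetrization_ns_operad this, folded Dias_def]
  have "pure_tensor ns_Dias 2 dias_dashv id \<in> elems Dias 2"
      "pure_tensor ns_Dias 2 dias_vdash (transpose 1 2) \<in> elems Dias 2"
    using dias_generators_closed T.comps_closed(1)[of 2] by (auto simp: Dias_def pure_tensor_def)
  then show ?thesis using cl True by (simp add: perm_relations_def)
qed (simp add: perm_relations_def)

lemmas perm_gen =
  gen_sym_ideal[OF anticyclic_operad.axioms(1)[OF Dias_anticyclic] perm_relations_closed,
    folded perm_ideal_def]

text \<open>With \<open>a = x \<stileturn> y\<close>, \<open>b = - x \<turnstile> y\<close> and \<open>c = - a - b\<close>, the map \<open>\<tau>\<close> permutes \<open>a, b, c\<close> cyclically.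
  The defining relation \<open>r\<close> of \<open>Perm\<close> has the coefficients \<open>(a, b)\<close>, the long cycle sends it to
  \<open>(b, a)\<close>, which is \<open>r\<close> with its inputs exchanged, and then to \<open>(c, c)\<close>, which is minus the sum of
  the two.\<close>

lemma perm_ideal_stable:
  assumes "1 \<le> n" "\<sigma> permutes {1..n + 1}" "f \<in> perm_ideal n"
  shows "Dias_action n \<sigma> f \<in> perm_ideal n"
proof -
  interpret D: anticyclic_operad Dias Dias_action by (rule Dias_anticyclic)
  interpret T: ns_anticyclic_operad ns_Dias dias_tau by (rule dias_tau(1))
  have two: "(1 :: nat) \<le> 2" by simp
  interpret V: module rat_field "comps ns_Dias 2" by (rule T.vector_space[OF two])
  have t: "transpose 1 2 permutes {1..2 :: nat}" by (simp only: perms_2 simp_thms)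
  have t_inv: "perm_inv (transpose 1 2) = transpose 1 (2 :: nat)" by simp
  define a where "a = dias_dashv"
  define b where "b = \<ominus>\<^bsub>comps ns_Dias 2\<^esub> dias_vdash"
  define c where "c = dias_vdash \<ominus>\<^bsub>comps ns_Dias 2\<^esub> dias_dashv"
  note d = dias_generators_closed
  have abc: "a \<in> elems ns_Dias 2" "b \<in> elems ns_Dias 2" "c \<in> elems ns_Dias 2"
    using d by (simp_all add: a_def b_def c_def)
  note L = T.tau_linear[OF two] and M = T.vector_space[OF two]
  have \<tau>a: "dias_tau 2 a = b" by (simp add: a_def b_def dias_tau(2))
  have \<tau>b: "dias_tau 2 b = c"
    unfolding b_def c_def linear_on_uminus[OF M M L d(2)] dias_tau(3)
    using d by (simp add: a_minus_def V.minus_add V.a_comm)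
  have \<tau>c: "dias_tau 2 c = a"
    unfolding a_def c_def linear_on_minus[OF M M L d(2,1)] dias_tau(2,3)
    using d by (simp add: a_minus_def V.a_assoc V.l_neg)
  have c_eq: "\<ominus>\<^bsub>comps ns_Dias 2\<^esub> (a \<oplus>\<^bsub>comps ns_Dias 2\<^esub> b) = c" "\<ominus>\<^bsub>comps ns_Dias 2\<^esub> (b \<oplus>\<^bsub>comps ns_Dias 2\<^esub> a) = c"
    unfolding a_def b_def c_def using d by (simp_all add: a_minus_def V.minus_add V.a_comm)
  have pure: "pure_tensor ns_Dias 2 dias_dashv id \<in> elems Dias 2"
      "pure_tensor ns_Dias 2 dias_vdash (transpose 1 2) \<in> elems Dias 2"
    using d by (auto simp: Dias_def pure_tensor_def)
  have rel: "perm_relations 2 = {dias_pair a b}"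
  proof -
    have "pure_tensor ns_Dias 2 dias_dashv id
        \<ominus>\<^bsub>comps Dias 2\<^esub> pure_tensor ns_Dias 2 dias_vdash (transpose 1 2) = dias_pair a b"
      unfolding a_minus_def Dias_def T.symmetrization_uminus[OF two pure(2)[unfolded Dias_def]]
        symmetrization_sel dias_pair_def
    proof (rule restrict_ext)
      have "\<ominus>\<^bsub>comps ns_Dias 2\<^esub> \<zero>\<^bsub>comps ns_Dias 2\<^esub> = \<zero>\<^bsub>comps ns_Dias 2\<^esub>"
        using uminus_smult_rat[OF M T.comps_closed(1)[OF two]] V.smult_r_null[of "-1"] by simp
      fix \<rho> assume "\<rho> \<in> perms 2"
      then have "\<rho> = id \<or> \<rho> = transpose 1 2" using perms_2 by simp
      then show "pure_tensor ns_Dias 2 dias_dashv id \<rho> \<oplus>\<^bsub>comps ns_Dias 2\<^esub>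
          (\<lambda>\<rho>\<in>perms 2. \<ominus>\<^bsub>comps ns_Dias 2\<^esub> pure_tensor ns_Dias 2 dias_vdash (transpose 1 2) \<rho>) \<rho> =
        (if \<rho> = id then a else b)"
      proof
        assume "\<rho> = id"
        then show ?thesis
          using \<open>\<ominus>\<^bsub>comps ns_Dias 2\<^esub> \<zero>\<^bsub>comps ns_Dias 2\<^esub> = \<zero>\<^bsub>comps ns_Dias 2\<^esub>\<close> d permutes_id[of "{1..2}"]
            transpose_12_neq_id[symmetric]
          by (simp add: pure_tensor_def a_def)
      next
        assume "\<rho> = transpose 1 2"
        then show ?thesis
          using d t transpose_12_neq_id by (simp add: pure_tensor_def b_def)
      qed
    qed
    then show ?thesis by (simp add: perm_relations_def)
  qed
  have sub: "submodule (perm_ideal 2) rat_field (comps Dias 2)"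
    using perm_gen(1) by (simp add: sym_ideal_def ns_ideal_def)
  note E = submodule_facts[OF D.vector_space[OF two] sub]
  have sact: "sact Dias n \<sigma> f \<in> perm_ideal n" if "1 \<le> n" "\<sigma> permutes {1..n}" "f \<in> perm_ideal n" for n \<sigma> f
    using perm_gen(1) that by (simp add: sym_ideal_def)
  have ab: "dias_pair a b \<in> perm_ideal 2" using perm_gen(2)[of 2] rel by simp
  have swap: "sact Dias 2 (transpose 1 2) (dias_pair a b) = dias_pair b a"
    unfolding Dias_def symmetrization_sel dias_pair_def
  proof (rule restrict_ext)
    fix \<rho> assume "\<rho> \<in> perms 2"
    then have "\<rho> = id \<or> \<rho> = transpose 1 2" using perms_2 by simp
    then show "(\<lambda>\<rho>\<in>perms 2. if \<rho> = id then a else b) (perm_inv (transpose 1 2) \<circ> \<rho>) =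
        (if \<rho> = id then b else a)"
      using t transpose_12_neq_id permutes_id[of "{1..2}"] by (auto simp: t_inv)
  qed
  have ba: "dias_pair b a \<in> perm_ideal 2" using sact[OF two t ab] by (simp only: swap)
  have "dias_pair c c = \<ominus>\<^bsub>comps Dias 2\<^esub> (dias_pair a b \<oplus>\<^bsub>comps Dias 2\<^esub> dias_pair b a)"
  proof -
    have sum: "dias_pair a b \<oplus>\<^bsub>comps Dias 2\<^esub> dias_pair b a \<in> elems Dias 2"
      using E(1) E(3)[OF ab ba] by blast
    show ?thesis
      unfolding Dias_def T.symmetrization_uminus[OF two sum[unfolded Dias_def]]
      unfolding symmetrization_sel dias_pair_def
      using c_eq by (intro restrict_ext) simp
  qed
  then have cc: "dias_pair c c \<in> perm_ideal 2" using E(5)[OF E(3)[OF ab ba]] by simp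
  define M where "M = {dias_pair a b, dias_pair b a, dias_pair c c}"
  have M_ideal: "M \<subseteq> perm_ideal 2" using ab ba cc by (simp add: M_def)
  have M_elems: "x \<in> elems Dias 2" if "x \<in> M" for x using that M_ideal E(1) by blast
  have M_cycle: "Dias_action 2 (long_cycle 2) x \<in> M" if "x \<in> M" for x
    using that abc by (auto simp: M_def Dias_action_pair \<tau>a \<tau>b \<tau>c)
  have M_pow: "Dias_action 2 (long_cycle 2 ^^ k) (dias_pair a b) \<in> M" for k
  proof (induction k)
    case 0
    have "dias_pair a b \<in> M" by (simp add: M_def)
    then show ?case using D.cact_id[OF two M_elems] by (simp only: funpow.simps)
  next
    case (Suc k)
    have "dias_pair a b \<in> elems Dias 2" by (rule M_elems) (simp add: M_def)
    then have "Dias_action 2 (long_cycle 2 ^^ Suc k) (dias_pair a b) =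
        Dias_action 2 (long_cycle 2) (Dias_action 2 (long_cycle 2 ^^ k) (dias_pair a b))"
      using D.cact_comp[OF two long_cycle_permutes permutes_funpow[OF long_cycle_permutes]]
      by (simp only: funpow.simps)
    then show ?case using M_cycle[OF Suc.IH] by (simp only:)
  qed
  have orbit: "Dias_action n \<sigma> s \<in> perm_ideal n" if s: "s \<in> perm_relations n" and \<sigma>: "\<sigma> permutes {1..n + 1}" for n s \<sigma>
  proof -
    have n: "n = 2" using s by (simp add: perm_relations_def split: if_splits)
    then have s: "s = dias_pair a b" using s rel by simp
    obtain \<rho> k where \<rho>: "\<rho> permutes {1..2}" "\<sigma> = \<rho> \<circ> (long_cycle 2 ^^ k)"
      using permutes_long_cycle_decomp[OF \<sigma>] unfolding n by blast
    have r: "dias_pair a b \<in> elems Dias 2" by (rule M_elems) (simp add: M_def)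
    have "Dias_action 2 \<sigma> (dias_pair a b) = sact Dias 2 \<rho> (Dias_action 2 (long_cycle 2 ^^ k) (dias_pair a b))"
      unfolding \<rho>(2) D.cact_comp[OF two permutes_Suc[OF \<rho>(1)] permutes_funpow[OF long_cycle_permutes] r]
      by (rule D.cact_extends[OF two \<rho>(1) M_elems[OF M_pow]])
    then show ?thesis
      unfolding n s using sact[OF two \<rho>(1)] M_pow[of k] M_ideal by auto
  qed
  show ?thesis
    unfolding perm_ideal_def
    by (rule gen_sym_ideal_stable[OF Dias_anticyclic perm_relations_closed orbit[unfolded perm_ideal_def]
          assms(1,2) assms(3)[unfolded perm_ideal_def]])
qed

theorem theorem5p1:
  shows "\<exists>!A. anticyclic_operad Perm A \<and>
    anticyclic_operad_hom Dias Dias_action Perm A Dias_to_Perm"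
  unfolding Perm_def Dias_to_Perm_def
  by (rule anticyclic_quotient[OF Dias_anticyclic perm_gen(1) perm_ideal_stable])

end
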